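(* Let $r$ be any constant. For any $\epsilon>0$, there is a two-sided adaptive algorithm for $\epsilon$-testing $r$-Decision List, and one for $\epsilon$-testing $r$-DNF, with respect to the uniform distribution, that makes $\tilde O(1/\epsilon)$ queries.
   Context: Boolean functions $f:\{0,1\}^n\to\{0,1\}$ are accessed through a membership-query oracle that returns $f(x)$ for a queried $x$. $f$ is $\epsilon$-far from a class $C$ (with respect to the uniform distribution) if $\Pr_{x}[f(x)\neq g(x)]\ge\epsilon$ for every $g\in C$, with $x$ uniform on $\{0,1\}^n$. A two-sided adaptive algorithm for $\epsilon$-testing $C$ is a randomized algorithm that, given $\epsilon$ and membership-query access to an arbitrary $f$ (and able to draw uniform random strings), chooses queries possibly adaptively, accepts with probability at least $2/3$ if $f\in C$, and rejects with probability at least $2/3$ if $f$ is $\epsilon$-far from every function in $C$. $\tilde O(T)$ means $O(T\cdot\mathrm{poly}(\log T))$. An $r$-term is a conjunction of at most $r$ literals. An $r$-decision list is a sequence $(T_1,\xi_1,a_1),\dots,(T_s,\xi_s,a_s)$ (any $s$) where $T_j$ are $r$-terms and $\xi_j,a_j\in\{0,1\}$, representing the function: if $T_1=\xi_1$ output $a_1$, else if $T_2=\xi_2$ output $a_2$, \dots, else if $T_s=\xi_s$ output $a_s$; $r$-Decision List is the class of all $r$-decision lists. An $r$-DNF is a disjunction (of any number) of $r$-terms; $r$-DNF is the class of all $r$-DNFs. *)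

theory Defs
  imports
    "HOL-Probability.Probability"
    "HOL-Library.Landau_Symbols"
    "HOL-Computational_Algebra.Polynomial"
begin

(* Boolean functions on {0,1}^n are represented by functions of type bool list => bool, of which
   only the values on lists of length n are ever relevant.  The number n of variables is a value,
   not a type, so that query bounds can be stated uniformly in n. *)

definition cube :: "nat \<Rightarrow> bool list set" where
  "cube n = {x. length x = n}"

lemma finite_cube [simp]: "finite (cube n)"
  using finite_lists_length_eq[of "UNIV :: bool set" n] by (simp add: cube_def)

lemma cube_nonempty [simp]: "cube n \<noteq> {}"
  unfolding cube_def using Ex_list_of_length by auto

definition far_from :: "nat \<Rightarrow> real \<Rightarrow> (bool list \<Rightarrow> bool) set \<Rightarrow> (bool list \<Rightarrow> bool) \<Rightarrow> bool" where
  "far_from n \<epsilon> C f \<longleftrightarrow>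
     (\<forall>g\<in>C. measure_pmf.prob (pmf_of_set (cube n)) {x. f x \<noteq> g x} \<ge> \<epsilon>)"

datatype literal = Pos nat | Neg nat

fun lit_var :: "literal \<Rightarrow> nat" where
  "lit_var (Pos i) = i"
| "lit_var (Neg i) = i"

fun lit_eval :: "literal \<Rightarrow> bool list \<Rightarrow> bool" where
  "lit_eval (Pos i) x = x ! i"
| "lit_eval (Neg i) x = (\<not> x ! i)"

(* A term is the list of its literals; the empty term is the constant 1. *)

definition r_terms :: "nat \<Rightarrow> nat \<Rightarrow> literal list set" where
  "r_terms r n = {T. length T \<le> r \<and> (\<forall>l\<in>set T. lit_var l < n)}"

definition term_eval :: "literal list \<Rightarrow> bool list \<Rightarrow> bool" where
  "term_eval T x \<longleftrightarrow> (\<forall>l\<in>set T. lit_eval l x)"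

(* None: no test of the list succeeds, so the list assigns no value to x. *)

fun dl_eval :: "(literal list \<times> bool \<times> bool) list \<Rightarrow> bool list \<Rightarrow> bool option" where
  "dl_eval [] x = None"
| "dl_eval ((T, \<xi>, a) # L) x = (if term_eval T x = \<xi> then Some a else dl_eval L x)"

definition r_decision_list :: "nat \<Rightarrow> nat \<Rightarrow> (bool list \<Rightarrow> bool) set" where
  "r_decision_list r n =
     {f. \<exists>L. (\<forall>(T, \<xi>, a)\<in>set L. T \<in> r_terms r n) \<and> (\<forall>x\<in>cube n. dl_eval L x = Some (f x))}"

definition r_DNF :: "nat \<Rightarrow> nat \<Rightarrow> (bool list \<Rightarrow> bool) set" where
  "r_DNF r n =
     {f. \<exists>D. set D \<subseteq> r_terms r n \<and> (\<forall>x\<in>cube n. f x \<longleftrightarrow> (\<exists>T\<in>set D. term_eval T x))}"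

(* A deterministic adaptive algorithm is a decision tree: Query x t0 t1 asks for f x and continues
   with t0 if the answer is 0 and with t1 if it is 1; Output True means accept.  A randomized
   algorithm is a probability distribution on such trees, i.e. all its random choices
   (in particular its uniform random strings) are drawn before the first query. *)

datatype (queried: 'x) dtree = Output bool | Query 'x "'x dtree" "'x dtree"

primrec run :: "'x dtree \<Rightarrow> ('x \<Rightarrow> bool) \<Rightarrow> bool" where
  "run (Output b) f = b"
| "run (Query x t0 t1) f = (if f x then run t1 f else run t0 f)"

primrec depth :: "'x dtree \<Rightarrow> nat" where
  "depth (Output b) = 0"
| "depth (Query x t0 t1) = Suc (max (depth t0) (depth t1))"

definition query_algorithm :: "nat \<Rightarrow> nat \<Rightarrow> bool list dtree pmf \<Rightarrow> bool" where
  "query_algorithm n q A \<longleftrightarrow> (\<forall>t\<in>set_pmf A. queried t \<subseteq> cube n \<and> depth t \<le> q)"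

definition accept_prob :: "'x dtree pmf \<Rightarrow> ('x \<Rightarrow> bool) \<Rightarrow> real" where
  "accept_prob A f = measure_pmf.prob A {t. run t f}"

definition reject_prob :: "'x dtree pmf \<Rightarrow> ('x \<Rightarrow> bool) \<Rightarrow> real" where
  "reject_prob A f = measure_pmf.prob A {t. \<not> run t f}"

definition two_sided_tester ::
  "nat \<Rightarrow> real \<Rightarrow> (bool list \<Rightarrow> bool) set \<Rightarrow> bool list dtree pmf \<Rightarrow> bool" where
  "two_sided_tester n \<epsilon> C A \<longleftrightarrow>
     (\<forall>f\<in>C. accept_prob A f \<ge> 2 / 3) \<and>
     (\<forall>f. far_from n \<epsilon> C f \<longrightarrow> reject_prob A f \<ge> 2 / 3)"

definition soft_O :: "'a filter \<Rightarrow> ('a \<Rightarrow> real) \<Rightarrow> ('a \<Rightarrow> real) set" where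
  "soft_O F T = (\<Union>p :: real poly. O[F](\<lambda>x. T x * poly p (ln (T x))))"

(* C n is the class of functions on n variables.  The query bound q may depend on \<epsilon> only. *)

definition testable_with_queries ::
  "(nat \<Rightarrow> (bool list \<Rightarrow> bool) set) \<Rightarrow> (real \<Rightarrow> nat) \<Rightarrow> bool" where
  "testable_with_queries C q \<longleftrightarrow>
     (\<exists>A. \<forall>\<epsilon>>0. \<forall>n. query_algorithm n (q \<epsilon>) (A \<epsilon> n) \<and> two_sided_tester n \<epsilon> (C n) (A \<epsilon> n))"

end

(* Proof idea. A decision list over r-terms is, up to a tiny error delta, a junta on polylog(1/delta)
   variables. Hash the n variables into m = polylog(1/epsilon) blocks, so that the relevant variables are
   separated. Re-randomizing one block at a time finds the blocks of non-negligible influence; for each of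
   them the restriction of f to that block (the other blocks frozen at a witness) should be a literal,
   which serves as a "reader" of the only relevant variable of the block. That a reader is close to a
   literal or a constant is tested with precision epsilon/polylog by an affinity test combined with a
   random splitting of the coordinates. Then f is compared on polylog(1/epsilon)/epsilon random samples
   with all functions of the class on m variables, fed with the outputs of the readers. Soundness is an
   Occam argument, because the class is closed under substituting literals and constants. Every query is
   marginally uniform, so for f in the class none of them distinguishes f from the junta, provided that
   delta is a small power of epsilon. *)

theory Submission
  imports Defs
begin

text \<open>The junta near \<open>f\<close> need not lie in the class, so it never serves as a
  hypothesis; it only shows that each block behaves like a single variable. The consistent
  hypothesis in the completeness proof is \<open>f\<close> itself, with signed block values
  substituted for the detected variables and constants for all others. The same closure property
  thus drives both directions, and decision lists and DNFs share one proof.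

  A witness that has exposed influence is, given that fact, no longer a uniform point. Completeness
  therefore takes the union bound over all probes, used or not, so that every point concerned is
  uniform. Up to logarithms this lists \<open>(1 / \<epsilon>) ^ 2\<close> points although only
  \<open>1 / \<epsilon>\<close> are queried, and so the error \<delta> of the junta has to beat the
  square of \<epsilon>. Since \<delta> decays geometrically in the parameter \<open>M\<close> of the
  sparsification, while all other parameters are polynomial in \<open>M\<close>, a logarithmic
  \<open>M\<close> is enough.

  Soundness takes nothing from hashing or probing: it holds for arbitrary readers that are fixed
  before the trials and samples are drawn.\<close>

abbreviation unif :: "nat \<Rightarrow> bool list pmf" where
  "unif n \<equiv> pmf_of_set (cube n)"

subsection \<open>Finite probability\<close>

lemma prob_mono:
  assumes "\<And>x. x \<in> set_pmf p \<Longrightarrow> x \<in> A \<Longrightarrow> x \<in> B"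
  shows "measure_pmf.prob p A \<le> measure_pmf.prob p B"
proof -
  have "measure_pmf.prob p A = measure_pmf.prob p (A \<inter> set_pmf p)"
    by (simp add: measure_Int_set_pmf)
  also have "\<dots> \<le> measure_pmf.prob p B"
    using assms by (intro measure_pmf.finite_measure_mono) auto
  finally show ?thesis .
qed

lemma prob_cong:
  assumes "\<And>x. x \<in> set_pmf p \<Longrightarrow> x \<in> A \<longleftrightarrow> x \<in> B"
  shows "measure_pmf.prob p A = measure_pmf.prob p B"
  using assms by (intro antisym prob_mono) auto

lemma prob_compl: "measure_pmf.prob p {x. \<not> P x} = 1 - measure_pmf.prob p {x. P x}"
proof -
  have "{x. \<not> P x} = UNIV - {x. P x}" by auto
  then show ?thesis using measure_pmf.prob_compl[of "{x. P x}" p] by simp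
qed

lemma prob_Un_le:
  assumes "\<And>x. x \<in> set_pmf p \<Longrightarrow> R x \<Longrightarrow> P x \<or> Q x"
    and "measure_pmf.prob p {x. P x} \<le> a" and "measure_pmf.prob p {x. Q x} \<le> b"
  shows "measure_pmf.prob p {x. R x} \<le> a + b"
proof -
  have "measure_pmf.prob p {x. R x} \<le> measure_pmf.prob p ({x. P x} \<union> {x. Q x})"
    using assms(1) by (intro prob_mono) auto
  also have "\<dots> \<le> measure_pmf.prob p {x. P x} + measure_pmf.prob p {x. Q x}"
    by (intro measure_Un_le) auto
  finally show ?thesis using assms by linarith
qed

lemma prob_UN_le:
  assumes "finite I"
    and "\<And>x. x \<in> set_pmf p \<Longrightarrow> R x \<Longrightarrow> \<exists>i\<in>I. P i x"
    and "\<And>i. i \<in> I \<Longrightarrow> measure_pmf.prob p {x. P i x} \<le> c"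
  shows "measure_pmf.prob p {x. R x} \<le> real (card I) * c"
proof -
  have "measure_pmf.prob p {x. R x} \<le> measure_pmf.prob p (\<Union>i\<in>I. {x. P i x})"
    using assms(2) by (intro prob_mono) auto
  also have "\<dots> \<le> (\<Sum>i\<in>I. measure_pmf.prob p {x. P i x})"
    using assms(1) by (intro measure_pmf.finite_measure_subadditive_finite) auto
  also have "\<dots> \<le> (\<Sum>i\<in>I. c)" using assms(3) by (intro sum_mono) auto
  finally show ?thesis by simp
qed

lemma prob_pos_imp_ex:
  assumes "measure_pmf.prob p {x. P x} > 0"
  shows "\<exists>x\<in>set_pmf p. P x"
proof (rule ccontr)
  assume "\<not> ?thesis"
  then have "measure_pmf.prob p {x. P x} \<le> measure_pmf.prob p {}" by (intro prob_mono) auto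
  then show False using assms by simp
qed

lemma prob_map_pmf: "measure_pmf.prob (map_pmf g p) {y. P y} = measure_pmf.prob p {x. P (g x)}"
  by (simp add: vimage_def)

lemma prob_map_eq:
  assumes "map_pmf g p = q"
  shows "measure_pmf.prob p {x. P (g x)} = measure_pmf.prob q {y. P y}"
  using prob_map_pmf[of g p P] assms by simp

lemma prob_bind_pmf:
  "measure_pmf.prob (bind_pmf p k) A = (\<integral>x. measure_pmf.prob (k x) A \<partial>measure_pmf p)"
  unfolding measure_pmf_bind
  by (rule measure_pmf.measure_bind[where N="count_space UNIV"])
     (auto simp: space_subprob_algebra intro!: subprob_space_measure_pmf)

lemma prob_pair_pmf:
  "measure_pmf.prob (pair_pmf p q) {w. P (fst w) (snd w)} =
     (\<integral>x. measure_pmf.prob q {y. P x y} \<partial>measure_pmf p)"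
proof -
  have "pair_pmf p q = bind_pmf p (\<lambda>x. map_pmf (Pair x) q)"
    by (simp add: pair_pmf_def map_pmf_def)
  then show ?thesis by (simp add: prob_bind_pmf vimage_def)
qed

lemma prob_pair_le:
  assumes "\<And>x. x \<in> set_pmf p \<Longrightarrow> measure_pmf.prob q {y. P x y} \<le> c"
  shows "measure_pmf.prob (pair_pmf p q) {w. P (fst w) (snd w)} \<le> c"
proof -
  have "(\<integral>x. measure_pmf.prob q {y. P x y} \<partial>measure_pmf p) \<le> (\<integral>x. c \<partial>measure_pmf p)"
    using assms
    by (intro integral_mono_AE measure_pmf.integrable_const measure_pmf.integrable_const_bound[where B=1])
       (auto simp: AE_measure_pmf_iff)
  then show ?thesis unfolding prob_pair_pmf by simp
qed

lemma prob_pair_ge: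
  assumes "\<And>x. x \<in> set_pmf p \<Longrightarrow> c \<le> measure_pmf.prob q {y. P x y}"
  shows "c \<le> measure_pmf.prob (pair_pmf p q) {w. P (fst w) (snd w)}"
proof -
  have "(\<integral>x. c \<partial>measure_pmf p) \<le> (\<integral>x. measure_pmf.prob q {y. P x y} \<partial>measure_pmf p)"
    using assms
    by (intro integral_mono_AE measure_pmf.integrable_const measure_pmf.integrable_const_bound[where B=1])
       (auto simp: AE_measure_pmf_iff)
  then show ?thesis unfolding prob_pair_pmf by simp
qed

lemma prob_fst_pair: "measure_pmf.prob (pair_pmf p q) {w. P (fst w)} = measure_pmf.prob p {x. P x}"
  using prob_map_eq[OF map_fst_pair_pmf] .

lemma prob_snd_pair: "measure_pmf.prob (pair_pmf p q) {w. P (snd w)} = measure_pmf.prob q {x. P x}"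
  using prob_map_eq[OF map_snd_pair_pmf] .

lemma prob_Pi_component:
  assumes "finite I" "i \<in> I"
  shows "measure_pmf.prob (Pi_pmf I d p) {\<omega>. P (\<omega> i)} = measure_pmf.prob (p i) {x. P x}"
  using prob_map_eq[of "\<lambda>\<omega>. \<omega> i" "Pi_pmf I d p" "p i" P] Pi_pmf_component[OF assms(1), of i d p] assms(2)
  by simp

lemma prob_Pi_all:
  assumes "finite I"
  shows "measure_pmf.prob (Pi_pmf I d p) {\<omega>. \<forall>i\<in>I. P i (\<omega> i)} = (\<Prod>i\<in>I. measure_pmf.prob (p i) {x. P i x})"
proof -
  have "measure_pmf.prob (Pi_pmf I d p) {\<omega>. \<forall>i\<in>I. P i (\<omega> i)} =
      measure_pmf.prob (Pi_pmf I d p) (PiE_dflt I d (\<lambda>i. {x. P i x}))"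
    using set_Pi_pmf_subset[OF assms, of d p] by (intro prob_cong) (auto simp: PiE_dflt_def)
  then show ?thesis using measure_Pi_pmf_PiE_dflt[OF assms] by simp
qed

lemma prob_Pi_all_sub:
  assumes "finite I" "K \<subseteq> I" "\<And>i. i \<in> K \<Longrightarrow> measure_pmf.prob (p i) {x. P i x} \<le> c"
  shows "measure_pmf.prob (Pi_pmf I d p) {\<omega>. \<forall>i\<in>K. P i (\<omega> i)} \<le> c ^ card K"
proof -
  have "measure_pmf.prob (Pi_pmf I d p) {\<omega>. \<forall>i\<in>K. P i (\<omega> i)} =
    measure_pmf.prob (Pi_pmf I d p) {\<omega>. \<forall>i\<in>I. (\<lambda>i x. i \<in> K \<longrightarrow> P i x) i (\<omega> i)}"
    using assms(2) by (intro prob_cong) auto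
  also have "\<dots> = (\<Prod>i\<in>I. measure_pmf.prob (p i) {x. i \<in> K \<longrightarrow> P i x})"
    by (rule prob_Pi_all[OF assms(1)])
  also have "\<dots> = (\<Prod>i\<in>K. measure_pmf.prob (p i) {x. i \<in> K \<longrightarrow> P i x})"
    using assms(1,2) by (intro prod.mono_neutral_right) auto
  also have "\<dots> \<le> (\<Prod>i\<in>K. c)" using assms(3) by (intro prod_mono) auto
  finally show ?thesis by simp
qed

text \<open>Pairwise independence of the hash values is all that the collision bound for the blocks
  uses.\<close>

lemma map_Pi_two_components:
  assumes "finite I" "i \<in> I" "j \<in> I" "i \<noteq> j"
  shows "map_pmf (\<lambda>\<omega>. (\<omega> i, \<omega> j)) (Pi_pmf I d p) = pair_pmf (p i) (p j)"
proof -
  have I: "I = insert i (I - {i})" using assms by auto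
  have "Pi_pmf I d p = map_pmf (\<lambda>(f,y). f(i:=y)) (pair_pmf (Pi_pmf (I - {i}) d p) (p i))"
    by (subst I, subst Pi_pmf_insert) (use assms in \<open>auto simp: pair_commute_pmf[of "p i"] map_pmf_comp case_prod_unfold\<close>)
  then have "map_pmf (\<lambda>\<omega>. (\<omega> i, \<omega> j)) (Pi_pmf I d p) =
     map_pmf (\<lambda>(a,b). (b, a)) (map_pmf (\<lambda>(f,y). (f j, y)) (pair_pmf (Pi_pmf (I - {i}) d p) (p i)))"
    using assms by (simp add: map_pmf_comp case_prod_unfold)
  also have "map_pmf (\<lambda>(f,y). (f j, y)) (pair_pmf (Pi_pmf (I - {i}) d p) (p i)) = pair_pmf (p j) (p i)"
    using map_pair[of "\<lambda>f. f j" "\<lambda>y. y" "Pi_pmf (I - {i}) d p" "p i"] assms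
    by (simp add: Pi_pmf_component)
  also have "map_pmf (\<lambda>(a,b). (b, a)) (pair_pmf (p j) (p i)) = pair_pmf (p i) (p j)"
    using pair_commute_pmf by metis
  finally show ?thesis .
qed

subsection \<open>Uniform points of the cube\<close>

lemma set_unif [simp]: "set_pmf (unif n) = cube n"
  by (simp add: set_pmf_of_set)

lemma map_unif_bij:
  assumes "bij_betw g (cube n) (cube n)"
  shows "map_pmf g (unif n) = unif n"
  using map_pmf_of_set_bij_betw[OF assms] by simp

lemma bij_betw_involution:
  assumes "\<And>x. x \<in> A \<Longrightarrow> g x \<in> A" "\<And>x. x \<in> A \<Longrightarrow> g (g x) = x"
  shows "bij_betw g A A"
  by (rule bij_betw_byWitness[where f'=g]) (use assms in auto)

lemma pair_unif: "pair_pmf (unif n) (unif n) = pmf_of_set (cube n \<times> cube n)"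
  by (rule pmf_eqI) (auto simp: pmf_pair card_cartesian_product indicator_def)

lemma cube_eqI: "x \<in> cube n \<Longrightarrow> y \<in> cube n \<Longrightarrow> (\<And>i. i < n \<Longrightarrow> x ! i = y ! i) \<Longrightarrow> x = y"
  by (auto simp: cube_def intro: nth_equalityI)

section \<open>Flipping a single coordinate\<close>

definition flip :: "nat \<Rightarrow> bool list \<Rightarrow> bool list" where
  "flip i x = x[i := \<not> x ! i]"

lemma length_flip [simp]: "length (flip i x) = length x"
  by (simp add: flip_def)

lemma flip_in_cube [simp]: "flip i x \<in> cube n \<longleftrightarrow> x \<in> cube n"
  by (simp add: cube_def)

lemma nth_flip: "i < length x \<Longrightarrow> flip i x ! j = (if j = i then \<not> x ! i else x ! j)"
  by (auto simp: flip_def nth_list_update)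

lemma flip_flip [simp]: "i < length x \<Longrightarrow> flip i (flip i x) = x"
  by (simp add: flip_def)

lemma map_flip_unif:
  assumes "i < n"
  shows "map_pmf (flip i) (unif n) = unif n"
  by (intro map_unif_bij bij_betw_involution) (use assms in \<open>auto simp: cube_def\<close>)

text \<open>Interpolates between the points: the \<open>k\<close>-th hybrid takes its first
  \<open>k\<close> coordinates from \<open>y\<close>, and consecutive hybrids are equal or differ by
  a flip outside \<open>J\<close>.\<close>

lemma flip_invariant_imp:
  assumes inv: "\<And>i x. i < n \<Longrightarrow> i \<notin> J \<Longrightarrow> x \<in> cube n \<Longrightarrow> F (flip i x) = F x"
    and "x \<in> cube n" "y \<in> cube n" "\<And>i. i \<in> J \<Longrightarrow> i < n \<Longrightarrow> x ! i = y ! i"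
  shows "F x = F y"
proof -
  have "F x = F (map (\<lambda>i. if i < k then y ! i else x ! i) [0..<n])" (is "_ = F (?h k)") if "k \<le> n" for k
    using that
  proof (induction k)
    case 0
    have "map (\<lambda>i. if i < 0 then y ! i else x ! i) [0..<n] = x"
      using assms(2) by (auto simp: cube_def intro: nth_equalityI)
    then show ?case by simp
  next
    case (Suc k)
    show ?case
    proof (cases "x ! k = y ! k")
      case True
      then have "?h (Suc k) = ?h k" by (intro nth_equalityI) (auto simp: less_Suc_eq)
      then show ?thesis using Suc.IH Suc.prems by (metis Suc_leD)
    next
      case False
      then have "k \<notin> J" using assms(4)[of k] Suc.prems by auto
      moreover have "?h (Suc k) = flip k (?h k)"
        using False Suc.prems by (intro nth_equalityI) (auto simp: nth_flip less_Suc_eq)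
      ultimately show ?thesis using Suc inv[of k "?h k"] by (simp add: cube_def)
    qed
  qed
  from this[of n] have "F x = F (map (\<lambda>i. if i < n then y ! i else x ! i) [0..<n])" by simp
  also have "map (\<lambda>i. if i < n then y ! i else x ! i) [0..<n] = y"
    using assms(3) by (auto simp: cube_def intro: nth_equalityI)
  finally show ?thesis .
qed

section \<open>Mixing two points\<close>

definition mix :: "nat \<Rightarrow> (nat \<Rightarrow> bool) \<Rightarrow> bool list \<Rightarrow> bool list \<Rightarrow> bool list" where
  "mix n P w z = map (\<lambda>i. if P i then z ! i else w ! i) [0..<n]"

lemma length_mix [simp]: "length (mix n P w z) = n"
  by (simp add: mix_def)

lemma mix_in_cube [simp]: "mix n P w z \<in> cube n"
  by (simp add: cube_def)

lemma nth_mix [simp]: "i < n \<Longrightarrow> mix n P w z ! i = (if P i then z ! i else w ! i)"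
  by (simp add: mix_def)

text \<open>Exchanging the \<open>P\<close>-coordinates of two points is an involution on pairs.
  Keeping both outputs shows that they are again independent, which the hybrid argument over blocks
  relies on.\<close>

lemma map_mix_pair:
  "map_pmf (\<lambda>v. (mix n P (fst v) (snd v), mix n P (snd v) (fst v))) (pair_pmf (unif n) (unif n))
     = pair_pmf (unif n) (unif n)"
  unfolding pair_unif
proof (intro map_pmf_of_set_bij_betw bij_betw_involution)
  fix v :: "bool list \<times> bool list" assume "v \<in> cube n \<times> cube n"
  then show "(mix n P (fst (mix n P (fst v) (snd v), mix n P (snd v) (fst v)))
         (snd (mix n P (fst v) (snd v), mix n P (snd v) (fst v))),
        mix n P (snd (mix n P (fst v) (snd v), mix n P (snd v) (fst v)))
         (fst (mix n P (fst v) (snd v), mix n P (snd v) (fst v)))) = v"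
    by (auto simp: prod_eq_iff intro!: cube_eqI[where n=n] split: if_splits)
qed auto

lemma map_mix: "map_pmf (\<lambda>v. mix n P (fst v) (snd v)) (pair_pmf (unif n) (unif n)) = unif n"
proof -
  have "map_pmf fst (map_pmf (\<lambda>v. (mix n P (fst v) (snd v), mix n P (snd v) (fst v))) (pair_pmf (unif n) (unif n))) = unif n"
    unfolding map_mix_pair by (rule map_fst_pair_pmf)
  then show ?thesis by (simp add: map_pmf_comp)
qed

lemma prob_mix:
  "measure_pmf.prob (pair_pmf (unif n) (unif n)) {v. Q (mix n P (fst v) (snd v))} =
   measure_pmf.prob (unif n) {x. Q x}"
  by (rule prob_map_eq[OF map_mix])

section \<open>Addition modulo 2 on the cube\<close>

definition xr :: "bool list \<Rightarrow> bool list \<Rightarrow> bool list" where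
  "xr x y = map2 (\<noteq>) x y"

lemma xr_in_cube [simp]: "x \<in> cube n \<Longrightarrow> y \<in> cube n \<Longrightarrow> xr x y \<in> cube n"
  by (simp add: xr_def cube_def)

lemma nth_xr [simp]: "x \<in> cube n \<Longrightarrow> y \<in> cube n \<Longrightarrow> i < n \<Longrightarrow> xr x y ! i = (x ! i \<noteq> y ! i)"
  by (simp add: xr_def cube_def)

lemma xr_commute: "x \<in> cube n \<Longrightarrow> y \<in> cube n \<Longrightarrow> xr x y = xr y x"
  by (rule cube_eqI[where n=n]) auto

lemma xr_assoc: "x \<in> cube n \<Longrightarrow> y \<in> cube n \<Longrightarrow> z \<in> cube n \<Longrightarrow> xr (xr x y) z = xr x (xr y z)"
  by (rule cube_eqI[where n=n]) (auto simp del: xr_in_cube simp: nth_xr[where n=n] xr_in_cube[where n=n])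

lemma xr_cancel [simp]: "x \<in> cube n \<Longrightarrow> y \<in> cube n \<Longrightarrow> xr x (xr x y) = y"
  by (rule cube_eqI[where n=n]) auto

lemma map_xr_unif: "a \<in> cube n \<Longrightarrow> map_pmf (xr a) (unif n) = unif n"
  by (intro map_unif_bij bij_betw_involution) auto

subsection \<open>Testing for dependence on at most one coordinate\<close>

text \<open>Averaging. Finite support makes the minimum over \<open>x\<close> attained, so that a
  strict bound at every point stays strict for the mean.\<close>

lemma prob_pair_le_imp_ex:
  assumes fin: "finite (set_pmf p)"
    and le: "measure_pmf.prob (pair_pmf p q) {w. P (fst w) (snd w)} \<le> c"
  shows "\<exists>x\<in>set_pmf p. measure_pmf.prob q {y. P x y} \<le> c"
proof (rule ccontr)
  let ?f = "\<lambda>x. measure_pmf.prob q {y. P x y}"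
  assume "\<not> ?thesis"
  then have gt: "\<And>x. x \<in> set_pmf p \<Longrightarrow> ?f x > c" by auto
  have ne: "finite (?f ` set_pmf p)" "?f ` set_pmf p \<noteq> {}" using fin set_pmf_not_empty by auto
  have "Min (?f ` set_pmf p) \<le> measure_pmf.prob (pair_pmf p q) {w. P (fst w) (snd w)}"
    using ne by (intro prob_pair_ge) auto
  moreover have "Min (?f ` set_pmf p) > c" using ne gt by (subst Min_gr_iff) auto
  ultimately show False using le by simp
qed

definition unary_on :: "nat \<Rightarrow> (bool list \<Rightarrow> bool) \<Rightarrow> bool" where
  "unary_on n \<psi> \<longleftrightarrow> (\<exists>c. \<forall>x\<in>cube n. \<psi> x = c) \<or> (\<exists>i<n. \<exists>c. \<forall>x\<in>cube n. \<psi> x = (x ! i \<noteq> c))"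

text \<open>The linearity test over two elements in its four-point form, which affine functions pass
  as well. Each of the four points is uniform.\<close>

definition affine_ok :: "(bool list \<Rightarrow> bool) \<Rightarrow> bool list \<Rightarrow> bool list \<Rightarrow> bool list \<Rightarrow> bool" where
  "affine_ok \<phi> x y u \<longleftrightarrow> ((\<phi> x \<noteq> \<phi> y) = (\<phi> u \<noteq> \<phi> (xr x (xr y u))))"

text \<open>The string \<open>a\<close> splits the coordinates into two random parts. A function of
  one coordinate ignores the part that lacks it, whereas a parity of several coordinates notices
  changes in both parts with constant probability.\<close>

definition split_ok :: "nat \<Rightarrow> (bool list \<Rightarrow> bool) \<Rightarrow> bool list \<Rightarrow> bool list \<Rightarrow> bool list \<Rightarrow> bool" where
  "split_ok n \<phi> a z v \<longleftrightarrow> \<phi> z = \<phi> (mix n (\<lambda>i. a ! i) z v) \<or> \<phi> z = \<phi> (mix n (\<lambda>i. \<not> a ! i) z v)"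

abbreviation unif3 :: "nat \<Rightarrow> (bool list \<times> bool list \<times> bool list) pmf" where
  "unif3 n \<equiv> pair_pmf (unif n) (pair_pmf (unif n) (unif n))"

text \<open>The pairs \<open>y, a + y\<close> and \<open>z, a + z\<close> have the same sum, so both can be compared with
  \<open>\<phi> u + \<phi> (y + z + u)\<close> by one affinity test each.\<close>

lemma affine_imp_collision:
  assumes beta: "measure_pmf.prob (unif3 n) {(x, y, u). \<not> affine_ok \<phi> x y u} \<le> \<beta>"
    and a: "a \<in> cube n"
  shows "measure_pmf.prob (pair_pmf (unif n) (unif n))
      {w. (\<phi> (fst w) \<noteq> \<phi> (xr a (fst w))) \<noteq> (\<phi> (snd w) \<noteq> \<phi> (xr a (snd w)))} \<le> 2 * \<beta>"
proof -
  define p where "p = unif3 n"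
  have b: "measure_pmf.prob p {w. \<not> affine_ok \<phi> (fst w) (fst (snd w)) (snd (snd w))} \<le> \<beta>"
    using beta unfolding p_def by (simp add: case_prod_unfold)
  have "map_pmf (\<lambda>(x, yu). (xr a x, (\<lambda>(y, u). (xr a y, u)) yu)) p = p"
    unfolding p_def map_pair using map_xr_unif[OF a] by (simp add: map_pair[where g="\<lambda>x. x"])
  then have m: "map_pmf (\<lambda>w. (xr a (fst w), xr a (fst (snd w)), snd (snd w))) p = p"
    by (simp add: case_prod_unfold)
  have b2: "measure_pmf.prob p {w. \<not> affine_ok \<phi> (xr a (fst w)) (xr a (fst (snd w))) (snd (snd w))} \<le> \<beta>"
    using prob_map_eq[OF m, of "\<lambda>w. \<not> affine_ok \<phi> (fst w) (fst (snd w)) (snd (snd w))"] b by simp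
  have "measure_pmf.prob p {w. (\<phi> (fst w) \<noteq> \<phi> (xr a (fst w))) \<noteq> (\<phi> (fst (snd w)) \<noteq> \<phi> (xr a (fst (snd w))))}
     \<le> \<beta> + \<beta>"
  proof (rule prob_Un_le[OF _ b b2])
    fix w assume w: "w \<in> set_pmf p"
      and ne: "(\<phi> (fst w) \<noteq> \<phi> (xr a (fst w))) \<noteq> (\<phi> (fst (snd w)) \<noteq> \<phi> (xr a (fst (snd w))))"
    obtain x y u where [simp]: "w = (x, y, u)" by (cases w) auto
    have c: "x \<in> cube n" "y \<in> cube n" "u \<in> cube n" using w by (auto simp: p_def)
    have "xr (xr a x) (xr (xr a y) u) = xr x (xr y u)"
      by (rule cube_eqI[where n=n]) (use a c in \<open>auto simp: nth_xr[where n=n] xr_in_cube[where n=n] simp del: xr_in_cube\<close>)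
    then show "\<not> affine_ok \<phi> (fst w) (fst (snd w)) (snd (snd w)) \<or>
         \<not> affine_ok \<phi> (xr a (fst w)) (xr a (fst (snd w))) (snd (snd w))"
      using ne by (auto simp: affine_ok_def)
  qed
  moreover have "map_pmf (\<lambda>w. (fst w, fst (snd w))) p = pair_pmf (unif n) (unif n)"
    unfolding p_def using map_pair[of "\<lambda>x. x" fst "unif n" "pair_pmf (unif n) (unif n)"]
    by (simp add: case_prod_unfold map_fst_pair_pmf)
  from prob_map_eq[OF this, of "\<lambda>w. (\<phi> (fst w) \<noteq> \<phi> (xr a (fst w))) \<noteq> (\<phi> (snd w) \<noteq> \<phi> (xr a (snd w)))"]
  have "measure_pmf.prob p {w. (\<phi> (fst w) \<noteq> \<phi> (xr a (fst w))) \<noteq> (\<phi> (fst (snd w)) \<noteq> \<phi> (xr a (fst (snd w))))}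
      = measure_pmf.prob (pair_pmf (unif n) (unif n))
      {w. (\<phi> (fst w) \<noteq> \<phi> (xr a (fst w))) \<noteq> (\<phi> (snd w) \<noteq> \<phi> (xr a (snd w)))}" by simp
  ultimately show ?thesis by simp
qed

text \<open>Independent draws disagree with probability \<open>2 * \<pi> * (1 - \<pi>)\<close>. The
  larger of \<pi> and \<open>1 - \<pi>\<close> is at least \<open>1 / 2\<close>, so the smaller one
  is at most \<open>2 * \<beta>\<close>.\<close>

lemma collision_majority:
  fixes P :: "'a \<Rightarrow> bool"
  assumes "measure_pmf.prob (pair_pmf q q) {w. P (fst w) \<noteq> P (snd w)} \<le> 2 * \<beta>"
  shows "\<exists>g. measure_pmf.prob q {y. P y \<noteq> g} \<le> 2 * \<beta>"
proof -
  define \<pi> where "\<pi> = measure_pmf.prob q {y. P y}"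
  have pi: "0 \<le> \<pi>" "\<pi> \<le> 1" by (auto simp: \<pi>_def)
  have c: "measure_pmf.prob q {y. \<not> P y} = 1 - \<pi>" unfolding \<pi>_def by (rule prob_compl)
  have "measure_pmf.prob (pair_pmf q q) {w. P (fst w) \<noteq> P (snd w)}
     = (\<integral>x. measure_pmf.prob q {y. P x \<noteq> P y} \<partial>measure_pmf q)"
    by (rule prob_pair_pmf)
  also have "\<dots> = (\<integral>x. (1 - \<pi>) * indicator {x. P x} x + \<pi> * indicator {x. \<not> P x} x \<partial>measure_pmf q)"
    by (intro Bochner_Integration.integral_cong) (auto simp: c \<pi>_def indicator_def)
  also have "\<dots> = (1 - \<pi>) * \<pi> + \<pi> * (1 - \<pi>)"
    by (subst Bochner_Integration.integral_add)
       (auto simp: c \<pi>_def[symmetric] measure_pmf.emeasure_eq_measure)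
  finally have *: "\<pi> * (1 - \<pi>) \<le> \<beta>" using assms by (simp add: mult.commute)
  show ?thesis
  proof (cases "\<pi> \<ge> 1 / 2")
    case True
    then have "(1/2) * (1 - \<pi>) \<le> \<pi> * (1 - \<pi>)" using pi by (intro mult_right_mono) auto
    then have "measure_pmf.prob q {y. P y \<noteq> True} \<le> 2 * \<beta>" using * c by simp
    then show ?thesis by blast
  next
    case False
    then have "\<pi> * (1/2) \<le> \<pi> * (1 - \<pi>)" using pi by (intro mult_left_mono) auto
    then have "measure_pmf.prob q {y. P y \<noteq> False} \<le> 2 * \<beta>" using * \<pi>_def by simp
    then show ?thesis by blast
  qed
qed

definition additive_on :: "nat \<Rightarrow> (bool list \<Rightarrow> bool) \<Rightarrow> bool" where
  "additive_on n g \<longleftrightarrow> (\<forall>a\<in>cube n. \<forall>b\<in>cube n. g (xr a b) = (g a \<noteq> g b))"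

text \<open>Self-correction: \<open>g a\<close> is the majority value of \<phi> at \<open>y\<close>
  plus \<phi> at \<open>a + y\<close>. Additivity of \<open>g\<close> combines three majorities,
  each wrong with probability at most \<open>2 * \<beta>\<close>; as \<open>6 * \<beta> < 1\<close>,
  some \<open>y\<close> is good for all three, so \<open>g\<close> is additive exactly.\<close>

lemma close_to_affine:
  assumes beta: "measure_pmf.prob (unif3 n) {(x, y, u). \<not> affine_ok \<phi> x y u} \<le> \<beta>"
    and small: "6 * \<beta> < 1"
  shows "\<exists>g c. additive_on n g \<and> measure_pmf.prob (unif n) {x. \<phi> x \<noteq> (g x \<noteq> c)} \<le> 2 * \<beta>"
proof -
  have "\<exists>b. measure_pmf.prob (unif n) {y. (\<phi> y \<noteq> \<phi> (xr a y)) \<noteq> b} \<le> 2 * \<beta>" if "a \<in> cube n" for a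
    using collision_majority[OF affine_imp_collision[OF beta that]] .
  then obtain g where g: "\<And>a. a \<in> cube n \<Longrightarrow> measure_pmf.prob (unif n) {y. (\<phi> y \<noteq> \<phi> (xr a y)) \<noteq> g a} \<le> 2 * \<beta>"
    by metis
  have add: "additive_on n g"
    unfolding additive_on_def
  proof (intro ballI)
    fix a b assume ab: "a \<in> cube n" "b \<in> cube n"
    have 2: "measure_pmf.prob (unif n) {y. (\<phi> (xr a y) \<noteq> \<phi> (xr b (xr a y))) \<noteq> g b} \<le> 2 * \<beta>"
      using g[OF ab(2)] prob_map_eq[OF map_xr_unif[OF ab(1)], of "\<lambda>y. (\<phi> y \<noteq> \<phi> (xr b y)) \<noteq> g b"] by simp
    have 3: "measure_pmf.prob (unif n) {y. (\<phi> y \<noteq> \<phi> (xr (xr a b) y)) \<noteq> g (xr a b)} \<le> 2 * \<beta>"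
      using ab by (intro g) auto
    have "measure_pmf.prob (unif n) {y. ((\<phi> y \<noteq> \<phi> (xr a y)) \<noteq> g a \<or> (\<phi> (xr a y) \<noteq> \<phi> (xr b (xr a y))) \<noteq> g b)
        \<or> (\<phi> y \<noteq> \<phi> (xr (xr a b) y)) \<noteq> g (xr a b)} \<le> (2 * \<beta> + 2 * \<beta>) + 2 * \<beta>"
      by (intro prob_Un_le[OF _ prob_Un_le[OF _ g[OF ab(1)] 2] 3]) auto
    also have "\<dots> < 1" using small by simp
    finally have "measure_pmf.prob (unif n) {y. \<not> (((\<phi> y \<noteq> \<phi> (xr a y)) \<noteq> g a \<or> (\<phi> (xr a y) \<noteq> \<phi> (xr b (xr a y))) \<noteq> g b)
        \<or> (\<phi> y \<noteq> \<phi> (xr (xr a b) y)) \<noteq> g (xr a b))} > 0"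
      by (subst prob_compl) linarith
    from prob_pos_imp_ex[OF this] obtain y where y: "y \<in> cube n"
      "(\<phi> y \<noteq> \<phi> (xr a y)) = g a" "(\<phi> (xr a y) \<noteq> \<phi> (xr b (xr a y))) = g b"
      "(\<phi> y \<noteq> \<phi> (xr (xr a b) y)) = g (xr a b)" by auto
    have "xr b (xr a y) = xr (xr a b) y"
      using ab y(1) by (metis xr_assoc xr_commute)
    then show "g (xr a b) = (g a \<noteq> g b)" using y by auto
  qed
  \<comment> \<open>With the shift now random too, averaging over \<open>y\<close> yields one
    \<open>y\<close> for which \<open>g\<close> is right at most shifts.\<close>
  have "measure_pmf.prob (pair_pmf (unif n) (unif n)) {w. (\<phi> (fst w) \<noteq> \<phi> (xr (snd w) (fst w))) \<noteq> g (snd w)} \<le> 2 * \<beta>"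
  proof -
    have "measure_pmf.prob (pair_pmf (unif n) (unif n)) {w. (\<phi> (snd w) \<noteq> \<phi> (xr (fst w) (snd w))) \<noteq> g (fst w)} \<le> 2 * \<beta>"
      by (rule prob_pair_le) (use g in auto)
    moreover have "map_pmf (\<lambda>w. (snd w, fst w)) (pair_pmf (unif n) (unif n)) = pair_pmf (unif n) (unif n)"
      using pair_commute_pmf[of "unif n" "unif n"] by (simp add: case_prod_unfold)
    from prob_map_eq[OF this, of "\<lambda>w. (\<phi> (snd w) \<noteq> \<phi> (xr (fst w) (snd w))) \<noteq> g (fst w)"]
    have "measure_pmf.prob (pair_pmf (unif n) (unif n)) {w. (\<phi> (snd w) \<noteq> \<phi> (xr (fst w) (snd w))) \<noteq> g (fst w)}
        = measure_pmf.prob (pair_pmf (unif n) (unif n)) {w. (\<phi> (fst w) \<noteq> \<phi> (xr (snd w) (fst w))) \<noteq> g (snd w)}"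
      by simp
    ultimately show ?thesis by simp
  qed
  from prob_pair_le_imp_ex[OF _ this]
  obtain y where y: "y \<in> cube n" "measure_pmf.prob (unif n) {u. (\<phi> y \<noteq> \<phi> (xr u y)) \<noteq> g u} \<le> 2 * \<beta>" by auto
  \<comment> \<open>Translating \<open>u\<close> by \<open>y\<close> turns \<phi> at
    \<open>u + y\<close> into \<phi> at \<open>u\<close>; the constant \<open>c\<close> is the sum
    of \<phi> and \<open>g\<close> at \<open>y\<close>.\<close>
  have "measure_pmf.prob (unif n) {u. (\<phi> y \<noteq> \<phi> (xr u y)) \<noteq> g u} =
        measure_pmf.prob (unif n) {u. (\<phi> y \<noteq> \<phi> (xr (xr y u) y)) \<noteq> g (xr y u)}"
    using prob_map_eq[OF map_xr_unif[OF y(1)], of "\<lambda>u. (\<phi> y \<noteq> \<phi> (xr u y)) \<noteq> g u"] by simp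
  also have "\<dots> = measure_pmf.prob (unif n) {u. \<phi> u \<noteq> (g u \<noteq> (\<phi> y \<noteq> g y))}"
  proof (rule prob_cong)
    fix u assume "u \<in> set_pmf (unif n)"
    then have u: "u \<in> cube n" by simp
    have "xr (xr y u) y = u" using u y(1) by (metis xr_cancel xr_commute xr_in_cube)
    then show "u \<in> {u. (\<phi> y \<noteq> \<phi> (xr (xr y u) y)) \<noteq> g (xr y u)} \<longleftrightarrow> u \<in> {u. \<phi> u \<noteq> (g u \<noteq> (\<phi> y \<noteq> g y))}"
      using add u y(1) by (auto simp: additive_on_def)
  qed
  finally have "measure_pmf.prob (unif n) {u. \<phi> u \<noteq> (g u \<noteq> (\<phi> y \<noteq> g y))} \<le> 2 * \<beta>"
    using y(2) by linarith
  with add show ?thesis by blast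
qed

text \<open>Read backwards, a lower bound: if every point or its image under \<sigma> lies in
  \<open>E\<close>, then \<open>E\<close> has probability at least \<open>1 / 2\<close>.\<close>

lemma prob_double_le:
  assumes "map_pmf \<sigma> p = p"
  shows "measure_pmf.prob p {x. E x \<or> E (\<sigma> x)} \<le> 2 * measure_pmf.prob p {x. E x}"
proof -
  have "measure_pmf.prob p {x. E (\<sigma> x)} = measure_pmf.prob p {x. E x}" by (rule prob_map_eq[OF assms])
  then have "measure_pmf.prob p {x. E x \<or> E (\<sigma> x)} \<le> measure_pmf.prob p {x. E x} + measure_pmf.prob p {x. E x}"
    by (intro prob_Un_le[where P=E and Q="\<lambda>x. E (\<sigma> x)"]) auto
  then show ?thesis by simp
qed

text \<open>An additive \<open>g\<close> is a parity, and its value at the \<open>i\<close>-th unit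
  vector, written as a flip of the zero vector, tells whether coordinate \<open>i\<close> takes
  part.\<close>

lemma additive_flip:
  assumes "additive_on n g" "i < n" "x \<in> cube n"
  shows "g (flip i x) = (g x \<noteq> g (flip i (replicate n False)))"
proof -
  define e where "e = flip i (replicate n False)"
  have e: "e \<in> cube n" by (simp add: cube_def e_def)
  have nth: "e ! j = (j = i)" if "j < n" for j using that assms(2) by (simp add: e_def nth_flip)
  have "flip i x = xr x e"
  proof (rule cube_eqI[where n=n])
    fix j assume "j < n"
    then show "flip i x ! j = xr x e ! j"
      using assms(2,3) nth_xr[OF assms(3) e, of j] nth_flip[of i x j] nth[of j] by (auto simp: cube_def)
  qed (use assms(3) e in simp_all)
  moreover have "g (xr x e) = (g x \<noteq> g e)"
    using assms(1,3) e unfolding additive_on_def by blast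
  ultimately show ?thesis unfolding e_def by metis
qed

text \<open>Both \<open>i\<close> and \<open>i'\<close> take part in the parity \<open>g\<close>.
  Three measure-preserving flips, of \<open>a\<close> at \<open>i\<close> and of \<open>v\<close> at
  \<open>i\<close> and at \<open>i'\<close>, are enough to turn any seed into a rejected one; each
  of them costs a factor 2.\<close>

lemma split_reject_ge:
  assumes add: "additive_on n g" and i: "i < n" "i' < n" "i \<noteq> i'"
    and S: "g (flip i (replicate n False))" "g (flip i' (replicate n False))"
  shows "measure_pmf.prob (unif3 n) {(a, z, v). \<not> split_ok n g a z v} \<ge> 1 / 8"
proof -
  define E where "E = (\<lambda>(a, z, v). \<not> split_ok n g a z v)"
  define s2 where "s2 = (\<lambda>(a :: bool list, z :: bool list, v). (a, z, flip i v))"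
  define s3 where "s3 = (\<lambda>(a :: bool list, z :: bool list, v). (a, z, flip i' v))"
  define s1 where "s1 = (\<lambda>(a, z :: bool list, v :: bool list). (flip i a, z, v))"
  define E1 where "E1 = (\<lambda>w. E w \<or> E (s2 w))"
  define E2 where "E2 = (\<lambda>w. E1 w \<or> E1 (s3 w))"
  define E3 where "E3 = (\<lambda>w. E2 w \<or> E2 (s1 w))"
  have mv: "map_pmf (\<lambda>(a, z, v). (a, z, flip k v)) (unif3 n) = unif3 n" if "k < n" for k
  proof -
    have "map_pmf (\<lambda>(a, zv). (a, (\<lambda>(z, v). (z, flip k v)) zv)) (unif3 n) = unif3 n"
      unfolding map_pair[where f="\<lambda>x. x"] using map_flip_unif[OF that] by simp
    then show ?thesis by (simp add: case_prod_unfold)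
  qed
  have ma: "map_pmf (\<lambda>(a, z, v). (flip k a, z, v)) (unif3 n) = unif3 n" if "k < n" for k
  proof -
    have "map_pmf (\<lambda>(a, zv). (flip k a, zv)) (unif3 n) = unif3 n"
      unfolding map_pair[where g="\<lambda>x. x"] using map_flip_unif[OF that] by simp
    then show ?thesis by (simp add: case_prod_unfold)
  qed
  have all: "E3 w" if w: "w \<in> set_pmf (unif3 n)" for w
  proof -
    have g0: "g (mix n P z (flip k v)) = g (mix n P z v)" if "\<not> P k" "k < n" "v \<in> cube n" for P z k v
    proof -
      have "mix n P z (flip k v) = mix n P z v"
        using that by (intro nth_equalityI) (auto simp: nth_flip cube_def)
      then show ?thesis by simp
    qed
    have g1: "g (mix n P z (flip k v)) = (\<not> g (mix n P z v))"
      if "P k" "k < n" "v \<in> cube n" "g (flip k (replicate n False))" for P z k v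
    proof -
      have "mix n P z (flip k v) = flip k (mix n P z v)"
        using that by (intro nth_equalityI) (auto simp: nth_flip cube_def)
      then show ?thesis using additive_flip[OF add that(2), of "mix n P z v"] that by simp
    qed
    \<comment> \<open>If \<open>a\<close> separates \<open>i\<close> from \<open>i'\<close>,
      flipping \<open>v\<close> at either of them toggles exactly one of the two mixed values, so
      both can be made to differ from \<open>g z\<close>.\<close>
    have split: "E2 (a, z, v)" if "a ! i \<noteq> a ! i'" "v \<in> cube n" for a z v
      unfolding E2_def E1_def E_def s2_def s3_def split_ok_def
      using that i S
      by (cases "a ! i"; cases "a ! i'") (auto simp: g0 g1)
    obtain a z v where [simp]: "w = (a, z, v)" by (cases w) auto
    have c: "a \<in> cube n" "v \<in> cube n" using w by auto
    show ?thesis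
    proof (cases "a ! i = a ! i'")
      case True
      then have "flip i a ! i \<noteq> flip i a ! i'" using i c(1) by (auto simp: nth_flip cube_def)
      then show ?thesis using split[of "flip i a" v z] c by (simp add: E3_def s1_def)
    next
      case False
      then show ?thesis using split[of a v z] c by (simp add: E3_def)
    qed
  qed
  have "1 = measure_pmf.prob (unif3 n) UNIV" by simp
  also have "\<dots> \<le> measure_pmf.prob (unif3 n) {w. E3 w}"
    using all by (intro prob_mono) auto
  also have "\<dots> \<le> 2 * measure_pmf.prob (unif3 n) {w. E2 w}"
    unfolding E3_def s1_def using prob_double_le[OF ma[OF i(1)]] .
  also have "measure_pmf.prob (unif3 n) {w. E2 w} \<le> 2 * measure_pmf.prob (unif3 n) {w. E1 w}"
    unfolding E2_def s3_def using prob_double_le[OF mv[OF i(2)]] .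
  also have "measure_pmf.prob (unif3 n) {w. E1 w} \<le> 2 * measure_pmf.prob (unif3 n) {w. E w}"
    unfolding E1_def s2_def using prob_double_le[OF mv[OF i(1)]] .
  finally show ?thesis by (simp add: E_def case_prod_unfold)
qed

lemma map_unif3_z: "map_pmf (\<lambda>w. fst (snd w)) (unif3 n) = unif n"
proof -
  have "map_pmf (\<lambda>w. fst (snd w)) (unif3 n) = map_pmf fst (map_pmf snd (unif3 n))"
    by (simp only: map_pmf_comp)
  then show ?thesis by (simp only: map_snd_pair_pmf map_fst_pair_pmf)
qed

lemma map_unif3_mix:
  "map_pmf (\<lambda>w. mix n (Q (fst w)) (fst (snd w)) (snd (snd w))) (unif3 n) = unif n"
proof -
  have "map_pmf (\<lambda>w. mix n (Q (fst w)) (fst (snd w)) (snd (snd w))) (unif3 n) =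
    bind_pmf (unif n) (\<lambda>a. map_pmf (\<lambda>v. mix n (Q a) (fst v) (snd v)) (pair_pmf (unif n) (unif n)))"
    by (simp only: pair_pmf_def map_pmf_def bind_assoc_pmf bind_return_pmf fst_conv snd_conv)
  also have "\<dots> = unif n" by (simp add: map_mix)
  finally show ?thesis .
qed

lemma flip_invariant_const:
  assumes "\<And>i x. i < n \<Longrightarrow> x \<in> cube n \<Longrightarrow> F (flip i x) = F x"
  shows "\<exists>c. \<forall>x\<in>cube n. F x = c"
  using flip_invariant_imp[of n "{}" F] assms by blast

text \<open>Adding the only participating coordinate, if there is one, leaves a function invariant
  under all flips, hence a constant.\<close>

lemma additive_unary:
  assumes add: "additive_on n g"
    and one: "\<And>i i'. i < n \<Longrightarrow> i' < n \<Longrightarrow> i \<noteq> i' \<Longrightarrow> g (flip i (replicate n False)) \<Longrightarrow>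
                \<not> g (flip i' (replicate n False))"
  shows "unary_on n (\<lambda>x. g x \<noteq> c)"
proof (cases "\<exists>i<n. g (flip i (replicate n False))")
  case False
  have "\<exists>c. \<forall>x\<in>cube n. g x = c"
  proof (rule flip_invariant_const)
    fix j x assume "j < n" "x \<in> cube n"
    then show "g (flip j x) = g x" using additive_flip[OF add, of j x] False by metis
  qed
  then obtain b where "\<forall>x\<in>cube n. g x = b" by blast
  then have "\<forall>x\<in>cube n. (g x \<noteq> c) = (b \<noteq> c)" by simp
  then show ?thesis unfolding unary_on_def by (intro disjI1 exI)
next
  case True
  then obtain i where i: "i < n" "g (flip i (replicate n False))" by blast
  have "\<exists>b. \<forall>x\<in>cube n. (g x \<noteq> x ! i) = b"
  proof (rule flip_invariant_const)
    fix j x assume j: "j < n" "x \<in> cube n"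
    have "flip j x ! i = (x ! i \<noteq> (i = j))" using j i(1) by (simp add: nth_flip cube_def)
    moreover have "g (flip j (replicate n False)) = (i = j)" using one[OF i(1) j(1)] i by auto
    moreover have "g (flip j x) = (g x \<noteq> g (flip j (replicate n False)))" by (rule additive_flip[OF add j])
    ultimately show "(g (flip j x) \<noteq> flip j x ! i) = (g x \<noteq> x ! i)" by argo
  qed
  then obtain b where b: "\<And>x. x \<in> cube n \<Longrightarrow> (g x \<noteq> x ! i) = b" by blast
  have "\<forall>x\<in>cube n. (g x \<noteq> c) = (x ! i \<noteq> (c \<noteq> b))"
  proof
    fix x assume "x \<in> cube n"
    from b[OF this] show "(g x \<noteq> c) = (x ! i \<noteq> (c \<noteq> b))" by argo
  qed
  then show ?thesis unfolding unary_on_def using i(1) by (intro disjI2 exI conjI)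
qed

abbreviation unif6 where "unif6 n \<equiv> pair_pmf (unif3 n) (unif3 n)"

definition trial_ok where
  "trial_ok n \<phi> = (\<lambda>((x, y, u), (a, z, v)). affine_ok \<phi> x y u \<and> split_ok n \<phi> a z v)"

text \<open>The affinity test gives a parity \<open>2 * \<beta>\<close>-close to \<phi>, up to a
  constant. If it had two coordinates, the split test would reject it with probability at least
  \<open>1 / 8\<close>. Replacing \<phi> by the parity at the three split points costs
  \<open>6 * \<beta>\<close>, and the trial itself rejects with probability below \<beta>; so
  \<open>1 / 8 < 7 * \<beta>\<close>, which \<open>1 / 56\<close> excludes.\<close>

theorem trial_sound:
  assumes rej: "measure_pmf.prob (unif6 n) {w. \<not> trial_ok n \<phi> w} < \<beta>" and small: "\<beta> \<le> 1 / 56"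
  shows "\<exists>\<psi>. unary_on n \<psi> \<and> measure_pmf.prob (unif n) {x. \<phi> x \<noteq> \<psi> x} \<le> 2 * \<beta>"
proof -
  let ?A = "\<lambda>w. \<not> (\<lambda>(x, y, u). affine_ok \<phi> x y u) w" and ?S = "\<lambda>w. \<not> (\<lambda>(a, z, v). split_ok n \<phi> a z v) w"
  have "measure_pmf.prob (unif3 n) {w. ?A w} = measure_pmf.prob (unif6 n) {w. ?A (fst w)}"
    by (rule prob_fst_pair[symmetric])
  also have "\<dots> \<le> measure_pmf.prob (unif6 n) {w. \<not> trial_ok n \<phi> w}"
    by (rule prob_mono) (auto simp: trial_ok_def)
  finally have "measure_pmf.prob (unif3 n) {(x, y, u). \<not> affine_ok \<phi> x y u} \<le> \<beta>"
    using rej by (simp add: case_prod_unfold)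
  from close_to_affine[OF this] small obtain g c where g: "additive_on n g"
    "measure_pmf.prob (unif n) {x. \<phi> x \<noteq> (g x \<noteq> c)} \<le> 2 * \<beta>" by auto
  have "\<not> g (flip i' (replicate n False))"
    if i: "i < n" "i' < n" "i \<noteq> i'" "g (flip i (replicate n False))" for i i'
  proof
    assume i': "g (flip i' (replicate n False))"
    let ?B = "\<lambda>x. \<phi> x \<noteq> (g x \<noteq> c)"
    have "measure_pmf.prob (unif3 n) {w. ?S w} = measure_pmf.prob (unif6 n) {w. ?S (snd w)}"
      by (rule prob_snd_pair[symmetric])
    also have "\<dots> \<le> measure_pmf.prob (unif6 n) {w. \<not> trial_ok n \<phi> w}"
      by (rule prob_mono) (auto simp: trial_ok_def)
    finally have s: "measure_pmf.prob (unif3 n) {w. ?S w} \<le> measure_pmf.prob (unif6 n) {w. \<not> trial_ok n \<phi> w}" .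
    have b1: "measure_pmf.prob (unif3 n) {w. ?B (fst (snd w))} \<le> 2 * \<beta>"
      using g(2) prob_map_eq[OF map_unif3_z[of n], of ?B] by simp
    have b2: "measure_pmf.prob (unif3 n) {w. ?B (mix n (Q (fst w)) (fst (snd w)) (snd (snd w)))} \<le> 2 * \<beta>" for Q
      using g(2) prob_map_eq[OF map_unif3_mix[of n Q], of ?B] by simp
    have "measure_pmf.prob (unif3 n) {w. \<not> (\<lambda>(a, z, v). split_ok n g a z v) w}
       \<le> measure_pmf.prob (unif3 n) {w. ?S w} + (2 * \<beta> + (2 * \<beta> + 2 * \<beta>))"
      by (intro prob_Un_le[OF _ order_refl prob_Un_le[OF _ b1 prob_Un_le[OF _ b2[of "\<lambda>a i. a ! i"] b2[of "\<lambda>a i. \<not> a ! i"]]]])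
         (auto simp: split_ok_def)
    moreover have "1 / 8 \<le> measure_pmf.prob (unif3 n) {w. \<not> (\<lambda>(a, z, v). split_ok n g a z v) w}"
      using split_reject_ge[OF g(1) i(1-3) i(4) i'] by (simp add: case_prod_unfold)
    ultimately show False using s rej small by linarith
  qed
  then have "unary_on n (\<lambda>x. g x \<noteq> c)" by (intro additive_unary[OF g(1)]) auto
  then show ?thesis using g(2) by blast
qed

subsection \<open>Sparsification of lists of terms\<close>

definition sat :: "literal set \<Rightarrow> bool list \<Rightarrow> bool" where
  "sat T x \<longleftrightarrow> (\<forall>l\<in>T. lit_eval l x)"

text \<open>Injectivity of \<open>lit_var\<close> forbids a literal next to its negation, so that
  the term is satisfied with probability exactly \<open>1 / 2 ^ card T\<close>.\<close>

definition consistent_term :: "nat \<Rightarrow> nat \<Rightarrow> literal set \<Rightarrow> bool" where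
  "consistent_term n s T \<longleftrightarrow> finite T \<and> inj_on lit_var T \<and> lit_var ` T \<subseteq> {..<n} \<and> card T \<le> s"

lemma lit_eval_flip:
  "i < n \<Longrightarrow> lit_var l < n \<Longrightarrow> x \<in> cube n \<Longrightarrow> lit_eval l (flip i x) = (lit_eval l x \<noteq> (lit_var l = i))"
  by (cases l) (auto simp: nth_flip cube_def)

lemma sat_flip:
  assumes "i < n" "i \<notin> lit_var ` T" "lit_var ` T \<subseteq> {..<n}" "x \<in> cube n"
  shows "sat T (flip i x) = sat T x"
proof -
  have "lit_eval l (flip i x) = lit_eval l x" if "l \<in> T" for l
    using lit_eval_flip[of i n l x] assms that by auto
  then show ?thesis by (simp add: sat_def)
qed

text \<open>Flipping the variable of \<open>l\<close> preserves \<open>A\<close> and exchanges the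
  two values of \<open>l\<close>.\<close>

lemma prob_and_literal:
  assumes A: "\<And>x. x \<in> cube n \<Longrightarrow> A (flip (lit_var l) x) = A x" and l: "lit_var l < n"
  shows "measure_pmf.prob (unif n) {x. A x \<and> lit_eval l x} = measure_pmf.prob (unif n) {x. A x} / 2"
proof -
  have "measure_pmf.prob (unif n) {x. A x \<and> lit_eval l x} =
        measure_pmf.prob (unif n) {x. A (flip (lit_var l) x) \<and> lit_eval l (flip (lit_var l) x)}"
    using prob_map_eq[OF map_flip_unif[OF l], of "\<lambda>x. A x \<and> lit_eval l x"] by simp
  also have "\<dots> = measure_pmf.prob (unif n) {x. A x \<and> \<not> lit_eval l x}"
    using A lit_eval_flip[OF l l] by (intro prob_cong) auto
  finally have eq: "measure_pmf.prob (unif n) {x. A x \<and> lit_eval l x} = \<dots>" .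
  have "measure_pmf.prob (unif n) {x. A x} =
     measure_pmf.prob (unif n) ({x. A x \<and> lit_eval l x} \<union> {x. A x \<and> \<not> lit_eval l x})"
    by (intro prob_cong) auto
  also have "\<dots> = measure_pmf.prob (unif n) {x. A x \<and> lit_eval l x} + measure_pmf.prob (unif n) {x. A x \<and> \<not> lit_eval l x}"
    by (intro measure_pmf.finite_measure_Union) auto
  finally show ?thesis using eq by simp
qed

lemma prob_and_term:
  assumes "finite T" "inj_on lit_var T" "lit_var ` T \<subseteq> {..<n}"
    and "\<And>i x. i \<in> lit_var ` T \<Longrightarrow> x \<in> cube n \<Longrightarrow> A (flip i x) = A x"
  shows "measure_pmf.prob (unif n) {x. A x \<and> sat T x} = measure_pmf.prob (unif n) {x. A x} / 2 ^ card T"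
  using assms
proof (induction T rule: finite_induct)
  case empty
  then show ?case by (simp add: sat_def)
next
  case (insert l T)
  have l: "lit_var l < n" "lit_var l \<notin> lit_var ` T" using insert by auto
  have "measure_pmf.prob (unif n) {x. A x \<and> sat (insert l T) x} =
        measure_pmf.prob (unif n) {x. (A x \<and> sat T x) \<and> lit_eval l x}"
    by (intro prob_cong) (auto simp: sat_def)
  also have "\<dots> = measure_pmf.prob (unif n) {x. A x \<and> sat T x} / 2"
  proof (rule prob_and_literal[OF _ l(1)])
    fix x assume x: "x \<in> cube n"
    have "A (flip (lit_var l) x) = A x" using insert.prems(3)[of "lit_var l" x] x by simp
    moreover have "sat T (flip (lit_var l) x) = sat T x"
      using l insert.prems(2) x by (intro sat_flip) auto
    ultimately show "(A (flip (lit_var l) x) \<and> sat T (flip (lit_var l) x)) = (A x \<and> sat T x)" by simp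
  qed
  also have "measure_pmf.prob (unif n) {x. A x \<and> sat T x} = measure_pmf.prob (unif n) {x. A x} / 2 ^ card T"
    using insert.prems by (intro insert.IH) (auto simp: inj_on_def)
  finally show ?case using insert.hyps by simp
qed

definition var_disjoint :: "(nat \<Rightarrow> literal set) \<Rightarrow> nat set \<Rightarrow> bool" where
  "var_disjoint T D \<longleftrightarrow> (\<forall>d\<in>D. \<forall>e\<in>D. d \<noteq> e \<longrightarrow> lit_var ` T d \<inter> lit_var ` T e = {})"

lemma var_disjoint_subset: "var_disjoint T D \<Longrightarrow> D' \<subseteq> D \<Longrightarrow> var_disjoint T D'"
  unfolding var_disjoint_def by (meson subsetD)

text \<open>Terms without common variables are independent, and each one fails with probability at
  most \<open>1 - 1 / 2 ^ s\<close>.\<close>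

lemma prob_no_term_le:
  assumes "finite D" "\<And>d. d \<in> D \<Longrightarrow> consistent_term n s (T d)" "var_disjoint T D"
  shows "measure_pmf.prob (unif n) {x. \<forall>d\<in>D. \<not> sat (T d) x} \<le> (1 - 1 / 2 ^ s) ^ card D"
  using assms
proof (induction D rule: finite_induct)
  case empty
  then show ?case by simp
next
  case (insert d D)
  let ?A = "\<lambda>x. \<forall>e\<in>D. \<not> sat (T e) x"
  have d: "finite (T d)" "inj_on lit_var (T d)" "lit_var ` T d \<subseteq> {..<n}" "card (T d) \<le> s"
    using insert.prems(1)[of d] by (auto simp: consistent_term_def)
  have inv: "?A (flip i x) = ?A x" if "i \<in> lit_var ` T d" "x \<in> cube n" for i x
  proof -
    have "sat (T e) (flip i x) = sat (T e) x" if "e \<in> D" for e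
    proof (rule sat_flip)
      show "i < n" using \<open>i \<in> lit_var ` T d\<close> d by auto
      have "lit_var ` T d \<inter> lit_var ` T e = {}"
        using insert.prems(2) insert.hyps that unfolding var_disjoint_def by (metis insertCI)
      then show "i \<notin> lit_var ` T e" using \<open>i \<in> lit_var ` T d\<close> by blast
      show "lit_var ` T e \<subseteq> {..<n}" using insert.prems(1)[of e] that by (auto simp: consistent_term_def)
    qed fact
    then show ?thesis by simp
  qed
  have IH: "measure_pmf.prob (unif n) {x. ?A x} \<le> (1 - 1 / 2 ^ s) ^ card D"
    using insert.prems by (intro insert.IH) (auto simp: var_disjoint_def)
  have "measure_pmf.prob (unif n) {x. ?A x} =
     measure_pmf.prob (unif n) ({x. ?A x \<and> \<not> sat (T d) x} \<union> {x. ?A x \<and> sat (T d) x})"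
    by (intro prob_cong) auto
  also have "\<dots> = measure_pmf.prob (unif n) {x. ?A x \<and> \<not> sat (T d) x} + measure_pmf.prob (unif n) {x. ?A x \<and> sat (T d) x}"
    by (intro measure_pmf.finite_measure_Union) auto
  also have "measure_pmf.prob (unif n) {x. ?A x \<and> sat (T d) x} = measure_pmf.prob (unif n) {x. ?A x} / 2 ^ card (T d)"
    by (rule prob_and_term[OF d(1-3) inv])
  finally have "measure_pmf.prob (unif n) {x. ?A x \<and> \<not> sat (T d) x} =
      measure_pmf.prob (unif n) {x. ?A x} * (1 - 1 / 2 ^ card (T d))"
    by (simp add: algebra_simps)
  also have "\<dots> \<le> (1 - 1 / 2 ^ s) ^ card D * (1 - 1 / 2 ^ s)"
  proof (rule mult_mono[OF IH])
    have "(2::real) ^ card (T d) \<le> 2 ^ s" using d(4) by (intro power_increasing) auto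
    then show "1 - 1 / 2 ^ card (T d) \<le> 1 - 1 / (2::real) ^ s" by (simp add: field_simps)
  qed (auto simp: field_simps)
  also have "{x. ?A x \<and> \<not> sat (T d) x} = {x. \<forall>e\<in>insert d D. \<not> sat (T e) x}" by auto
  finally show ?case using insert.hyps by (simp add: mult.commute)
qed

text \<open>If \<open>P' \<subseteq> P\<close> and \<open>x\<close> is not \<open>undominated\<close>, then \<open>P\<close> and \<open>P'\<close> have the same first satisfied
  term at \<open>x\<close>.\<close>

definition undominated :: "(nat \<Rightarrow> literal set) \<Rightarrow> nat set \<Rightarrow> nat set \<Rightarrow> bool list \<Rightarrow> bool" where
  "undominated T P P' x \<longleftrightarrow> (\<exists>p\<in>P. sat (T p) x \<and> \<not> (\<exists>q\<in>P'. q \<le> p \<and> sat (T q) x))"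

text \<open>\<open>Q\<close> is the part of the list strictly before the first index at which
  \<open>M\<close> variable-disjoint terms have appeared, and \<open>E\<close> holds the term at
  that index. The last conjunct says that every term beyond \<open>Q\<close> comes no earlier than
  the whole family, so a satisfied member of the family dominates it.\<close>

lemma shortest_prefix:
  fixes P :: "nat set" and T :: "nat \<Rightarrow> literal set" and M :: nat
  assumes "M > 0" "finite P"
  defines "has \<equiv> \<lambda>Q. \<exists>D\<subseteq>Q. card D = M \<and> var_disjoint T D"
  shows "\<exists>Q E. Q \<subseteq> P \<and> E \<subseteq> P \<and> card E \<le> 1 \<and> \<not> has Q \<and>
           (Q = P \<or> has (Q \<union> E) \<and> (\<forall>q\<in>P - Q. \<forall>d\<in>Q \<union> E. d \<le> q))"
proof (cases "\<exists>p. has {q\<in>P. q \<le> p}")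
  case False
  have "\<not> has P"
  proof
    assume "has P"
    moreover have "P = {q\<in>P. q \<le> Max P}" using assms(2) by auto
    ultimately show False using False by metis
  qed
  then show ?thesis by (intro exI[of _ P] exI[of _ "{}"]) auto
next
  case True
  define p where "p = (LEAST p. has {q\<in>P. q \<le> p})"
  have p: "has {q\<in>P. q \<le> p}" unfolding p_def using True by (rule LeastI_ex)
  have "\<not> has {q\<in>P. q < p}"
  proof (cases p)
    case 0
    then show ?thesis using assms(1) by (auto simp: has_def)
  next
    case (Suc p')
    then have "{q\<in>P. q < p} = {q\<in>P. q \<le> p'}" by auto
    moreover have "\<not> has {q\<in>P. q \<le> p'}" using not_less_Least[of p' "\<lambda>p. has {q\<in>P. q \<le> p}"] Suc p_def by simp
    ultimately show ?thesis by simp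
  qed
  moreover have "has ({q\<in>P. q < p} \<union> ({p} \<inter> P))"
  proof -
    have "{q\<in>P. q \<le> p} = {q\<in>P. q < p} \<union> ({p} \<inter> P)" by auto
    with p show ?thesis by simp
  qed
  moreover have "card ({p} \<inter> P) \<le> 1" using card_mono[of "{p}" "{p} \<inter> P"] by simp
  moreover have "\<forall>q\<in>P - {q\<in>P. q < p}. \<forall>d\<in>{q\<in>P. q < p} \<union> ({p} \<inter> P). d \<le> q" by auto
  ultimately show ?thesis
    by (intro exI[of _ "{q\<in>P. q < p}"] exI[of _ "{p} \<inter> P"] conjI disjI2) simp_all
qed

text \<open>A family maximal under inclusion meets every further term. Members of \<open>D\<close>
  are left out of the claim because a term without variables does not even meet itself.\<close>

lemma maximal_disjoint:
  assumes "finite Q" "\<not> (\<exists>D\<subseteq>Q. card D = M \<and> var_disjoint T D)"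
  shows "\<exists>D\<subseteq>Q. card D < M \<and> (\<forall>q\<in>Q - D. \<exists>d\<in>D. lit_var ` T q \<inter> lit_var ` T d \<noteq> {})"
proof -
  let ?F = "{D. D \<subseteq> Q \<and> var_disjoint T D}"
  have fin: "finite ?F" using assms(1) by simp
  have "{} \<in> ?F" by (auto simp: var_disjoint_def)
  then obtain D where D: "D \<in> ?F" and max: "\<And>D'. D' \<in> ?F \<Longrightarrow> D \<subseteq> D' \<Longrightarrow> D = D'"
    using finite_has_maximal[OF fin] by auto
  have finD: "finite D" using D assms(1) finite_subset by auto
  have "card D < M"
  proof (rule ccontr)
    assume "\<not> card D < M"
    then obtain D' where "D' \<subseteq> D" "card D' = M" by (meson not_less obtain_subset_with_card_n)
    moreover have "var_disjoint T D'" using D by (intro var_disjoint_subset[OF _ \<open>D' \<subseteq> D\<close>]) simp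
    ultimately show False using assms(2) D by (metis (no_types, lifting) mem_Collect_eq order_trans)
  qed
  moreover have "\<forall>q\<in>Q - D. \<exists>d\<in>D. lit_var ` T q \<inter> lit_var ` T d \<noteq> {}"
  proof
    fix q assume q: "q \<in> Q - D"
    show "\<exists>d\<in>D. lit_var ` T q \<inter> lit_var ` T d \<noteq> {}"
    proof (rule ccontr)
      assume neg: "\<not> (\<exists>d\<in>D. lit_var ` T q \<inter> lit_var ` T d \<noteq> {})"
      have "lit_var ` T q \<inter> lit_var ` T d = {}" "lit_var ` T d \<inter> lit_var ` T q = {}" if "d \<in> D" for d
        using neg that by (metis, metis Int_commute)
      then have "insert q D \<in> ?F" using D q unfolding var_disjoint_def by simp
      then show False using max[of "insert q D"] q by auto
    qed
  qed
  ultimately show ?thesis using D by (intro exI[of _ D] conjI) simp_all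
qed

text \<open>Cut the list as soon as it contains \<open>M\<close> variable-disjoint terms: one of them is almost surely satisfied.
  Before the cut every term shares a variable with a maximal disjoint family of fewer than \<open>M\<close> terms, hence
  contains one of at most \<open>2 * r * M\<close> literals; recurse on the terms containing a given literal, with that
  literal removed.\<close>

lemma sparsify:
  assumes "finite P" "\<And>p. p \<in> P \<Longrightarrow> consistent_term n s (T p)" "s \<le> r" "M > 0"
  shows "\<exists>P'\<subseteq>P. card P' \<le> (1 + M) * (1 + 2 * r * M) ^ s \<and>
     measure_pmf.prob (unif n) {x. undominated T P P' x} \<le> (1 - 1 / 2 ^ r) ^ M * real ((1 + 2 * r * M) ^ s)"
  using assms
proof (induction s arbitrary: P T)
  case 0
  show ?case
  proof (cases "P = {}")
    case True
    then show ?thesis by (intro exI[of _ "{}"]) (auto simp: undominated_def)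
  next
    case False
    have "T p = {}" if "p \<in> P" for p using "0.prems"(2)[OF that] by (auto simp: consistent_term_def)
    \<comment> \<open>Empty terms are always satisfied, so the list never gets beyond its first
      one.\<close>
    then have "\<not> undominated T P {Min P} x" for x
      using False "0.prems"(1) by (auto simp: undominated_def sat_def)
    then show ?thesis using False "0.prems"(1) by (intro exI[of _ "{Min P}"]) auto
  qed
next
  case (Suc s)
  let ?w = "1 + 2 * r * M"
  let ?\<gamma> = "(1 - 1 / 2 ^ r) ^ M :: real"
  have gam: "0 \<le> ?\<gamma>" by simp
  from shortest_prefix[OF \<open>M > 0\<close> \<open>finite P\<close>, of T]
  obtain Q E where QE: "Q \<subseteq> P" "E \<subseteq> P" "card E \<le> 1"
    "\<not> (\<exists>D\<subseteq>Q. card D = M \<and> var_disjoint T D)"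
    and prefix: "Q = P \<or> (\<exists>D\<subseteq>Q \<union> E. card D = M \<and> var_disjoint T D) \<and> (\<forall>q\<in>P - Q. \<forall>d\<in>Q \<union> E. d \<le> q)"
    by auto
  have finQ: "finite Q" using QE(1) Suc.prems(1) finite_subset by auto
  from maximal_disjoint[OF finQ QE(4)] obtain D where D: "D \<subseteq> Q" "card D < M"
    and meets: "\<And>q. q \<in> Q - D \<Longrightarrow> \<exists>d\<in>D. lit_var ` T q \<inter> lit_var ` T d \<noteq> {}" by auto
  have finD: "finite D" using D(1) finQ finite_subset by auto
  define V where "V = (\<Union>d\<in>D. lit_var ` T d)"
  have finT: "finite (T p)" "card (T p) \<le> Suc s" if "p \<in> P" for p
    using Suc.prems(2)[OF that] by (auto simp: consistent_term_def)
  have DP: "D \<subseteq> P" using D QE by auto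
  have finV: "finite V" unfolding V_def using finD finT DP by auto
  have "card V \<le> (\<Sum>d\<in>D. card (lit_var ` T d))" unfolding V_def by (rule card_UN_le[OF finD])
  \<comment> \<open>Bounding by \<open>r\<close> instead of \<open>Suc s\<close> gives every level
    of the recursion the same branching factor.\<close>
  also have "\<dots> \<le> (\<Sum>d\<in>D. r)"
  proof (rule sum_mono)
    fix d assume "d \<in> D"
    then have "d \<in> P" using DP by auto
    then show "card (lit_var ` T d) \<le> r"
      using card_image_le[OF finT(1), of d lit_var] finT(2)[of d] Suc.prems(3) by linarith
  qed
  also have "\<dots> \<le> M * r" using D(2) by simp
  finally have cardV: "card V \<le> M * r" .
  \<comment> \<open>The shared variable may occur with either sign, hence the factor 2.\<close>
  define Ls where "Ls = Pos ` V \<union> Neg ` V"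
  have finLs: "finite Ls" using finV by (simp add: Ls_def)
  have "card Ls \<le> card (Pos ` V) + card (Neg ` V)" unfolding Ls_def by (rule card_Un_le)
  also have "\<dots> \<le> card V + card V" by (intro add_mono card_image_le finV)
  finally have cardLs: "card Ls \<le> 2 * r * M" using cardV by (simp add: mult.commute mult.left_commute)
  define Pl where "Pl = (\<lambda>l. {q\<in>Q. l \<in> T q})"
  define Tl where "Tl = (\<lambda>l p. T p - {l})"
  have IH: "\<exists>P'\<subseteq>Pl l. card P' \<le> (1 + M) * ?w ^ s \<and>
     measure_pmf.prob (unif n) {x. undominated (Tl l) (Pl l) P' x} \<le> ?\<gamma> * real (?w ^ s)" for l
  proof (rule Suc.IH)
    show "finite (Pl l)" using finQ by (simp add: Pl_def)
    show "s \<le> r" using Suc.prems by simp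
    fix p assume "p \<in> Pl l"
    then have p: "p \<in> P" "l \<in> T p" using QE by (auto simp: Pl_def)
    then show "consistent_term n s (Tl l p)"
      using Suc.prems(2)[OF p(1)] unfolding consistent_term_def Tl_def
      by (auto simp: inj_on_def card_Diff_singleton)
  qed (rule Suc.prems(4))
  define R where "R = (\<lambda>l. SOME P'. P' \<subseteq> Pl l \<and> card P' \<le> (1 + M) * ?w ^ s \<and>
     measure_pmf.prob (unif n) {x. undominated (Tl l) (Pl l) P' x} \<le> ?\<gamma> * real (?w ^ s))"
  have R: "\<And>l. R l \<subseteq> Pl l" "\<And>l. card (R l) \<le> (1 + M) * ?w ^ s"
    "\<And>l. measure_pmf.prob (unif n) {x. undominated (Tl l) (Pl l) (R l) x} \<le> ?\<gamma> * real (?w ^ s)"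
    subgoal for l using someI_ex[OF IH[of l]] unfolding R_def by (elim conjE)
    subgoal for l using someI_ex[OF IH[of l]] unfolding R_def by (elim conjE)
    subgoal for l using someI_ex[OF IH[of l]] unfolding R_def by (elim conjE)
    done
  \<comment> \<open>Kept terms retain their indices, so the order that decides the first satisfied
    term is preserved.\<close>
  define P' where "P' = E \<union> D \<union> (\<Union>l\<in>Ls. R l)"
  have RP: "R l \<subseteq> P" for l using R(1)[of l] QE(1) by (auto simp: Pl_def)
  then have "P' \<subseteq> P" unfolding P'_def using QE(2) DP by blast
  moreover have "card P' \<le> (1 + M) * ?w ^ Suc s"
  proof -
    have "card (\<Union>l\<in>Ls. R l) \<le> (\<Sum>l\<in>Ls. card (R l))" by (rule card_UN_le[OF finLs])
    also have "\<dots> \<le> (\<Sum>l\<in>Ls. (1 + M) * ?w ^ s)" by (intro sum_mono R(2))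
    also have "\<dots> \<le> (2 * r * M) * ((1 + M) * ?w ^ s)" using mult_le_mono1[OF cardLs] by (simp only: sum_constant of_nat_id)
    finally have u: "card (\<Union>l\<in>Ls. R l) \<le> (2 * r * M) * ((1 + M) * ?w ^ s)" .
    have "card P' \<le> card (E \<union> D) + card (\<Union>l\<in>Ls. R l)" unfolding P'_def by (rule card_Un_le)
    also have "\<dots> \<le> card E + card D + (2 * r * M) * ((1 + M) * ?w ^ s)"
      by (rule add_mono[OF card_Un_le u])
    also have "\<dots> \<le> (1 + M) * 1 + (2 * r * M) * ((1 + M) * ?w ^ s)"
      by (rule add_right_mono) (use QE(3) D(2) in simp)
    also have "\<dots> \<le> (1 + M) * ?w ^ s + (2 * r * M) * ((1 + M) * ?w ^ s)"
      by (rule add_right_mono, rule mult_le_mono2) (simp add: one_le_power)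
    also have "\<dots> = (1 + M) * ?w ^ Suc s" by (simp add: algebra_simps)
    finally show ?thesis .
  qed
  moreover have "measure_pmf.prob (unif n) {x. undominated T P P' x} \<le> ?\<gamma> * real (?w ^ Suc s)"
  proof -
    \<comment> \<open>The bad event of the cut: there are terms behind it, yet no family of
      \<open>M\<close> disjoint terms up to the cut has a satisfied member.\<close>
    define N where "N = (\<lambda>x. Q \<noteq> P \<and> (\<forall>D\<subseteq>Q \<union> E. card D = M \<and> var_disjoint T D \<longrightarrow> (\<forall>d\<in>D. \<not> sat (T d) x)))"
    have N: "measure_pmf.prob (unif n) {x. N x} \<le> ?\<gamma>"
    proof (cases "Q = P")
      case True
      then show ?thesis using gam by (simp add: N_def)
    next
      case False
      then obtain D' where D': "D' \<subseteq> Q \<union> E" "card D' = M" "var_disjoint T D'" using prefix by auto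
      have "measure_pmf.prob (unif n) {x. N x} \<le> measure_pmf.prob (unif n) {x. \<forall>d\<in>D'. \<not> sat (T d) x}"
        using D' by (intro prob_mono) (auto simp: N_def)
      also have "\<dots> \<le> (1 - 1 / 2 ^ r) ^ card D'"
      proof (rule prob_no_term_le[OF _ _ D'(3)])
        show "finite D'" using D'(1) QE(1,2) finite_subset[OF _ Suc.prems(1), of D'] by blast
        fix d assume "d \<in> D'"
        then have "d \<in> P" using D' QE by auto
        then show "consistent_term n r (T d)" using Suc.prems(2)[of d] Suc.prems(3)
          by (auto simp: consistent_term_def)
      qed
      finally show ?thesis using D'(2) by simp
    qed
    have U: "measure_pmf.prob (unif n) {x. \<exists>l\<in>Ls. undominated (Tl l) (Pl l) (R l) x} \<le> real (card Ls) * (?\<gamma> * real (?w ^ s))"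
      by (rule prob_UN_le[OF finLs, where P="\<lambda>l x. undominated (Tl l) (Pl l) (R l) x"]) (use R(3) in auto)
    have key: "N x \<or> (\<exists>l\<in>Ls. undominated (Tl l) (Pl l) (R l) x)" if und: "undominated T P P' x" for x
    proof (rule ccontr)
      assume neg: "\<not> ?thesis"
      \<comment> \<open>The literal \<open>l\<close> removed for the recursion is true at
        \<open>x\<close> because \<open>p\<close> contains it. Hence the shortened term that the
        recursion supplies is satisfied with \<open>l\<close> put back.\<close>
      have dom: "\<exists>q\<in>P'. q \<le> p \<and> sat (T q) x" if p: "p \<in> Q" "sat (T p) x" for p
      proof (cases "p \<in> D")
        case True
        then show ?thesis using p by (auto simp: P'_def)
      next
        case False
        then obtain d where d: "d \<in> D" "lit_var ` T p \<inter> lit_var ` T d \<noteq> {}" using meets p by blast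
        then obtain l where l: "l \<in> T p" "lit_var l \<in> lit_var ` T d" by auto
        then have "lit_var l \<in> V" using d by (auto simp: V_def)
        then have lL: "l \<in> Ls" unfolding Ls_def by (cases l) auto
        have "p \<in> Pl l" using p l by (simp add: Pl_def)
        moreover have "sat (Tl l p) x" using p by (simp add: sat_def Tl_def)
        ultimately obtain q where q: "q \<in> R l" "q \<le> p" "sat (Tl l q) x"
          using neg lL unfolding undominated_def by blast
        moreover have "lit_eval l x" using p l by (simp add: sat_def)
        ultimately have "sat (T q) x" by (auto simp: sat_def Tl_def)
        then show ?thesis using q lL by (auto simp: P'_def)
      qed
      obtain p where p: "p \<in> P" "sat (T p) x" "\<not> (\<exists>q\<in>P'. q \<le> p \<and> sat (T q) x)"
        using und by (auto simp: undominated_def)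
      have pQ: "p \<notin> Q" using dom p by blast
      then have "Q \<noteq> P" using p by auto
      then obtain D' d where D': "D' \<subseteq> Q \<union> E" "d \<in> D'" "sat (T d) x" using neg unfolding N_def by auto
      have dp: "d \<le> p" using prefix \<open>Q \<noteq> P\<close> D' pQ p(1) by blast
      show False
      proof (cases "d \<in> E")
        case True
        then show ?thesis using p(3) dp D' by (auto simp: P'_def)
      next
        case False
        then have "d \<in> Q" using D' by auto
        then show ?thesis using dom[of d] D'(3) dp p(3) order_trans by blast
      qed
    qed
    have "measure_pmf.prob (unif n) {x. undominated T P P' x} \<le> ?\<gamma> + real (card Ls) * (?\<gamma> * real (?w ^ s))"
      by (rule prob_Un_le[OF key N U])
    also have "\<dots> \<le> ?\<gamma> * real (?w ^ s) + real (2 * r * M) * (?\<gamma> * real (?w ^ s))"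
    proof (intro add_mono mult_right_mono)
      have "1 \<le> real (?w ^ s)" by (simp add: one_le_power)
      then have "?\<gamma> * 1 \<le> ?\<gamma> * real (?w ^ s)" using gam by (rule mult_left_mono)
      then show "?\<gamma> \<le> ?\<gamma> * real (?w ^ s)" by simp
      show "real (card Ls) \<le> real (2 * r * M)" using cardLs by (simp only: of_nat_le_iff)
    qed (use gam in auto)
    also have "\<dots> = ?\<gamma> * real (?w ^ Suc s)" by (simp add: algebra_simps)
    finally show ?thesis .
  qed
  ultimately show ?case by (intro exI[of _ P'] conjI)
qed

subsection \<open>Decision lists are close to juntas\<close>

definition junta_on :: "nat \<Rightarrow> nat set \<Rightarrow> (bool list \<Rightarrow> bool) \<Rightarrow> bool" where
  "junta_on n J g \<longleftrightarrow> (\<forall>x\<in>cube n. \<forall>y\<in>cube n. (\<forall>i\<in>J. x ! i = y ! i) \<longrightarrow> g x = g y)"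

fun negate :: "literal \<Rightarrow> literal" where
  "negate (Pos i) = Neg i"
| "negate (Neg i) = Pos i"

lemma lit_eval_negate [simp]: "lit_eval (negate l) x = (\<not> lit_eval l x)"
  by (cases l) auto

lemma lit_var_negate [simp]: "lit_var (negate l) = lit_var l"
  by (cases l) auto

text \<open>A test \<open>T = 0\<close> is a disjunction of negated literals and is replaced by one test per literal.\<close>

definition expand_item :: "literal list \<times> bool \<times> bool \<Rightarrow> (literal set \<times> bool) list" where
  "expand_item = (\<lambda>(T, \<xi>, a). if \<xi> then [(set T, a)] else map (\<lambda>l. ({negate l}, a)) T)"

lemma find_append: "find P (xs @ ys) = (case find P xs of None \<Rightarrow> find P ys | Some x \<Rightarrow> Some x)"
  by (induction xs) auto

lemma sat_set: "sat (set T) x = term_eval T x"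
  by (simp add: sat_def term_eval_def)

lemma find_negated_literals:
  "find (\<lambda>(T, a). sat T x) (map (\<lambda>l. ({negate l}, a)) T) =
     (if term_eval T x then None else Some ({negate (the (find (\<lambda>l. \<not> lit_eval l x) T))}, a))"
  by (induction T) (auto simp: sat_def term_eval_def)

lemma dl_eval_expand:
  "dl_eval L x = map_option snd (find (\<lambda>(T, a). sat T x) (concat (map expand_item L)))"
proof (induction L)
  case (Cons i L)
  obtain T \<xi> a where i: "i = (T, \<xi>, a)" by (cases i) auto
  show ?case
    by (cases \<xi>) (auto simp: i expand_item_def find_append Cons find_negated_literals sat_set)
qed simp

text \<open>Justifies discarding contradictory terms: they can never be the first satisfied
  one.\<close>

lemma sat_imp_inj_on: "sat T x \<Longrightarrow> inj_on lit_var T"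
proof (rule inj_onI)
  fix l l' assume "sat T x" "l \<in> T" "l' \<in> T" "lit_var l = lit_var l'"
  moreover from this have "lit_eval l x" "lit_eval l' x" by (simp_all add: sat_def)
  ultimately show "l = l'" by (cases l; cases l') simp_all
qed

lemma sat_cong:
  assumes "\<And>i. i \<in> lit_var ` T \<Longrightarrow> x ! i = y ! i"
  shows "sat T x = sat T y"
proof -
  have "lit_eval l x = lit_eval l y" if "l \<in> T" for l
    using assms[of "lit_var l"] that by (cases l) force+
  then show ?thesis by (simp add: sat_def)
qed

text \<open>Off the undominated points, the first satisfied term survives sparsification, and the
  few kept terms mention few variables. Here \<open>M\<close> trades size against error: the size is
  polynomial in \<open>M\<close>, the error decays geometrically.\<close>

lemma decision_list_near_junta:
  assumes f: "f \<in> r_decision_list r n" and M: "M > 0"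
  shows "\<exists>J g. J \<subseteq> {..<n} \<and> card J \<le> r * ((1 + M) * (1 + 2 * r * M) ^ r) \<and> junta_on n J g \<and>
     measure_pmf.prob (unif n) {x. f x \<noteq> g x} \<le> (1 - 1 / 2 ^ r) ^ M * real ((1 + 2 * r * M) ^ r)"
proof -
  obtain L0 where L0: "\<And>T \<xi> a. (T, \<xi>, a) \<in> set L0 \<Longrightarrow> T \<in> r_terms r n"
    "\<And>x. x \<in> cube n \<Longrightarrow> dl_eval L0 x = Some (f x)"
    using f unfolding r_decision_list_def by fastforce
  define L where "L = concat (map expand_item L0)"
  have L: "finite T \<and> lit_var ` T \<subseteq> {..<n} \<and> card T \<le> r" if "(T, a) \<in> set L" for T a
  proof -
    obtain T0 \<xi> a0 where T0: "(T0, \<xi>, a0) \<in> set L0" "(T, a) \<in> set (expand_item (T0, \<xi>, a0))"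
      using \<open>(T, a) \<in> set L\<close> unfolding L_def by auto
    have "T0 \<in> r_terms r n" using L0(1) T0(1) .
    then have len: "length T0 \<le> r" "\<And>l. l \<in> set T0 \<Longrightarrow> lit_var l < n" by (auto simp: r_terms_def)
    show ?thesis
    proof (cases \<xi>)
      case True
      then have "T = set T0" using T0(2) by (simp add: expand_item_def)
      then show ?thesis using len card_length[of T0] by auto
    next
      case False
      then obtain l where l: "l \<in> set T0" "T = {negate l}" using T0(2) by (auto simp: expand_item_def)
      \<comment> \<open>The expanded test is a single literal, which has to fit into the
        width.\<close>
      then have "r \<ge> 1" using len(1) by (cases T0) auto
      then show ?thesis using l len(2) by auto
    qed
  qed
  define T where "T = (\<lambda>p. fst (L ! p))"
  define a where "a = (\<lambda>p. snd (L ! p))"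
  have first: "\<exists>p<length L. sat (T p) x \<and> f x = a p \<and> (\<forall>q<p. \<not> sat (T q) x)" if "x \<in> cube n" for x
  proof -
    have "map_option snd (find (\<lambda>(T, a). sat T x) L) = Some (f x)"
      using L0(2)[OF that] dl_eval_expand[of L0 x] by (simp add: L_def)
    then obtain i where i: "find (\<lambda>(T, a). sat T x) L = Some i" "snd i = f x" by auto
    then show ?thesis unfolding find_Some_iff T_def a_def by (auto simp: case_prod_unfold)
  qed
  define P where "P = {p. p < length L \<and> inj_on lit_var (T p)}"
  have Pc: "consistent_term n r (T p)" if "p \<in> P" for p
    using that L[of "fst (L ! p)" "snd (L ! p)"] by (auto simp: consistent_term_def P_def T_def)
  have finP: "finite P" by (simp add: P_def)
  have "\<exists>P'\<subseteq>P. card P' \<le> (1 + M) * (1 + 2 * r * M) ^ r \<and>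
     measure_pmf.prob (unif n) {x. undominated T P P' x} \<le> (1 - 1 / 2 ^ r) ^ M * real ((1 + 2 * r * M) ^ r)"
    by (rule sparsify[OF finP _ order_refl M]) (rule Pc)
  then obtain P' where P': "P' \<subseteq> P"
    "card P' \<le> (1 + M) * (1 + 2 * r * M) ^ r"
    "measure_pmf.prob (unif n) {x. undominated T P P' x} \<le> (1 - 1 / 2 ^ r) ^ M * real ((1 + 2 * r * M) ^ r)"
    by blast
  have finP': "finite P'" using P'(1) finP finite_subset by blast
  define J where "J = (\<Union>p\<in>P'. lit_var ` T p)"
  \<comment> \<open>If no kept term is satisfied, \<open>LEAST\<close> is an unspecified index, but
    it still depends only on which kept terms hold; so \<open>g\<close> is a junta in any
    case.\<close>
  define g where "g = (\<lambda>x. a (LEAST p. p \<in> P' \<and> sat (T p) x))"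
  have "J \<subseteq> {..<n}" unfolding J_def using Pc P'(1) unfolding consistent_term_def by blast
  moreover have "card J \<le> r * ((1 + M) * (1 + 2 * r * M) ^ r)"
  proof -
    have "card J \<le> (\<Sum>p\<in>P'. card (lit_var ` T p))" unfolding J_def by (rule card_UN_le[OF finP'])
    also have "\<dots> \<le> (\<Sum>p\<in>P'. r)"
    proof (rule sum_mono)
      fix p assume "p \<in> P'"
      then have "finite (T p)" "card (T p) \<le> r" using Pc P'(1) by (auto simp: consistent_term_def)
      then show "card (lit_var ` T p) \<le> r" using card_image_le[of "T p" lit_var] by linarith
    qed
    also have "\<dots> \<le> r * ((1 + M) * (1 + 2 * r * M) ^ r)" using mult_le_mono2[OF P'(2), of r] by (simp add: mult.commute)
    finally show ?thesis .
  qed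
  moreover have "junta_on n J g"
    unfolding junta_on_def
  proof (intro ballI impI)
    fix x y :: "bool list" assume "\<forall>i\<in>J. x ! i = y ! i"
    then have "sat (T p) x = sat (T p) y" if "p \<in> P'" for p
      using that by (intro sat_cong) (auto simp: J_def)
    then have "(\<lambda>p. p \<in> P' \<and> sat (T p) x) = (\<lambda>p. p \<in> P' \<and> sat (T p) y)" by auto
    then show "g x = g y" unfolding g_def by simp
  qed
  moreover have "measure_pmf.prob (unif n) {x. f x \<noteq> g x} \<le> measure_pmf.prob (unif n) {x. undominated T P P' x}"
  proof (rule prob_mono, rule ccontr)
    fix x assume x: "x \<in> set_pmf (unif n)" "x \<in> {x. f x \<noteq> g x}" "x \<notin> {x. undominated T P P' x}"
    then obtain p where p: "p < length L" "sat (T p) x" "f x = a p" "\<And>q. q < p \<Longrightarrow> \<not> sat (T q) x"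
      using first[of x] by auto
    have "p \<in> P" using p sat_imp_inj_on by (auto simp: P_def)
    then obtain q where q: "q \<in> P'" "q \<le> p" "sat (T q) x" using x(3) p(2) by (auto simp: undominated_def)
    then have "q = p" using p(4)[of q] by (cases "q = p") auto
    have "(LEAST p. p \<in> P' \<and> sat (T p) x) = p"
    proof (rule Least_equality)
      show "p \<in> P' \<and> sat (T p) x" using q \<open>q = p\<close> by simp
      fix q' assume "q' \<in> P' \<and> sat (T q') x"
      then show "p \<le> q'" using p(4)[of q'] by (meson not_le)
    qed
    then show False using x(2) p(3) by (simp add: g_def)
  qed
  ultimately show ?thesis using P'(3) by (intro exI[of _ J] exI[of _ g] conjI) linarith+
qed

subsection \<open>Substituting literals and constants\<close>

lemma literal_subst:
  assumes "unary_on n \<psi>"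
  shows "(\<exists>c. \<forall>x\<in>cube n. (\<psi> x = b) = c) \<or> (\<exists>l. lit_var l < n \<and> (\<forall>x\<in>cube n. (\<psi> x = b) = lit_eval l x))"
proof (cases "\<exists>c. \<forall>x\<in>cube n. \<psi> x = c")
  case True
  then obtain c where "\<forall>x\<in>cube n. \<psi> x = c" by auto
  then have "\<forall>x\<in>cube n. (\<psi> x = b) = (c = b)" by simp
  then show ?thesis by (intro disjI1 exI)
next
  case False
  then obtain i c where i: "i < n" "\<forall>x\<in>cube n. \<psi> x = (x ! i \<noteq> c)" using assms unfolding unary_on_def by auto
  have "\<forall>x\<in>cube n. (\<psi> x = b) = lit_eval (if b = c then Neg i else Pos i) x"
    using i(2) by (cases b; cases c) auto
  moreover have "lit_var (if b = c then Neg i else Pos i) < n" using i by simp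
  ultimately show ?thesis by (intro disjI2 exI conjI)
qed

definition subst_point :: "nat \<Rightarrow> (nat \<Rightarrow> bool list \<Rightarrow> bool) \<Rightarrow> bool list \<Rightarrow> bool list" where
  "subst_point m \<psi> x = map (\<lambda>j. \<psi> j x) [0..<m]"

lemma subst_point_in_cube [simp]: "subst_point m \<psi> x \<in> cube m"
  by (simp add: subst_point_def cube_def)

lemma nth_subst_point [simp]: "j < m \<Longrightarrow> subst_point m \<psi> x ! j = \<psi> j x"
  by (simp add: subst_point_def)

lemma lit_eval_subst:
  assumes "\<forall>j<m. unary_on n (\<psi> j)" "lit_var l < m"
  shows "(\<exists>c. \<forall>x\<in>cube n. lit_eval l (subst_point m \<psi> x) = c) \<or>
    (\<exists>l'. lit_var l' < n \<and> (\<forall>x\<in>cube n. lit_eval l (subst_point m \<psi> x) = lit_eval l' x))"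
proof (cases l)
  case (Pos j)
  then show ?thesis using literal_subst[of n "\<psi> j" True] assms by simp
next
  case (Neg j)
  then show ?thesis using literal_subst[of n "\<psi> j" False] assms by simp
qed

text \<open>A true constant removes its literal and a false one kills the term. The second
  alternative is separate since the constant 0 need not be an \<open>r\<close>-term, for instance
  when \<open>r\<close> is 1.\<close>

lemma term_eval_subst:
  assumes \<psi>: "\<forall>j<m. unary_on n (\<psi> j)" and "T \<in> r_terms r m"
  shows "(\<exists>T'\<in>r_terms r n. \<forall>x\<in>cube n. term_eval T (subst_point m \<psi> x) = term_eval T' x) \<or>
    (\<forall>x\<in>cube n. \<not> term_eval T (subst_point m \<psi> x))"
  using assms(2)
proof (induction T arbitrary: r)
  case Nil
  then show ?case by (intro disjI1 bexI[of _ "[]"]) (auto simp: r_terms_def term_eval_def)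
next
  case (Cons l T)
  then obtain r' where r: "r = Suc r'" "T \<in> r_terms r' m" and l: "lit_var l < m"
    by (cases r) (auto simp: r_terms_def)
  have ev: "term_eval (l # T) y = (lit_eval l y \<and> term_eval T y)" for l T y
    by (simp add: term_eval_def)
  from Cons.IH[OF r(2)] consider
    (false) "\<forall>x\<in>cube n. \<not> term_eval T (subst_point m \<psi> x)"
  | (ok) T' where "T' \<in> r_terms r' n" "\<forall>x\<in>cube n. term_eval T (subst_point m \<psi> x) = term_eval T' x" by blast
  then show ?case
  proof cases
    case false
    then show ?thesis by (simp add: ev)
  next
    case (ok T')
    from lit_eval_subst[OF \<psi> l] consider
      (const) c where "\<forall>x\<in>cube n. lit_eval l (subst_point m \<psi> x) = c"
    | (lit) l' where "lit_var l' < n" "\<forall>x\<in>cube n. lit_eval l (subst_point m \<psi> x) = lit_eval l' x" by auto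
    then show ?thesis
    proof cases
      case (const c)
      have "T' \<in> r_terms r n" using ok(1) r(1) by (simp add: r_terms_def)
      moreover have "\<forall>x\<in>cube n. term_eval (l # T) (subst_point m \<psi> x) = (c \<and> term_eval T' x)"
        using const ok(2) by (simp add: ev)
      ultimately show ?thesis by (cases c) auto
    next
      case (lit l')
      have "l' # T' \<in> r_terms r n" using ok(1) r(1) lit(1) by (simp add: r_terms_def)
      moreover have "\<forall>x\<in>cube n. term_eval (l # T) (subst_point m \<psi> x) = term_eval (l' # T') x"
        using lit(2) ok(2) by (simp add: ev)
      ultimately show ?thesis by blast
    qed
  qed
qed

lemma decision_list_subst:
  assumes \<psi>: "\<forall>j<m. unary_on n (\<psi> j)" and G: "G \<in> r_decision_list r m"
  shows "(\<lambda>x. G (subst_point m \<psi> x)) \<in> r_decision_list r n"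
proof -
  obtain L where L: "\<And>T \<xi> a. (T, \<xi>, a) \<in> set L \<Longrightarrow> T \<in> r_terms r m"
    "\<And>x. x \<in> cube m \<Longrightarrow> dl_eval L x = Some (G x)"
    using G unfolding r_decision_list_def by fastforce
  have "\<exists>L'. (\<forall>(T, \<xi>, a)\<in>set L'. T \<in> r_terms r n) \<and> (\<forall>x\<in>cube n. dl_eval L' x = dl_eval L (subst_point m \<psi> x))"
    using L(1)
  proof (induction L)
    case Nil
    show ?case by (intro exI[of _ "[]"]) simp
  next
    case (Cons i L)
    obtain T \<xi> a where i: "i = (T, \<xi>, a)" by (cases i) auto
    have T: "T \<in> r_terms r m" using Cons.prems[of T \<xi> a] i by simp
    obtain L' where L': "\<forall>(T, \<xi>, a)\<in>set L'. T \<in> r_terms r n"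
      "\<forall>x\<in>cube n. dl_eval L' x = dl_eval L (subst_point m \<psi> x)"
      using Cons.IH Cons.prems by (metis list.set_intros(2))
    from term_eval_subst[OF \<psi> T] consider
      (false) "\<forall>x\<in>cube n. \<not> term_eval T (subst_point m \<psi> x)"
    | (ok) T' where "T' \<in> r_terms r n" "\<forall>x\<in>cube n. term_eval T (subst_point m \<psi> x) = term_eval T' x" by blast
    then show ?case
    proof cases
      case false
      show ?thesis
      \<comment> \<open>For a term that is identically 0, the test for 1 never succeeds and is
        dropped; the test for 0 always succeeds and becomes a test of the empty term for 1.\<close>
      proof (cases \<xi>)
        case True
        then show ?thesis using L' false by (intro exI[of _ L']) (auto simp: i)
      next
        case False
        then show ?thesis using L' false
          by (intro exI[of _ "([], True, a) # L'"]) (auto simp: i r_terms_def term_eval_def)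
      qed
    next
      case (ok T')
      then show ?thesis using L' by (intro exI[of _ "(T', \<xi>, a) # L'"]) (auto simp: i)
    qed
  qed
  then show ?thesis unfolding r_decision_list_def using L(2) by auto
qed

lemma DNF_subst:
  assumes \<psi>: "\<forall>j<m. unary_on n (\<psi> j)" and G: "G \<in> r_DNF r m"
  shows "(\<lambda>x. G (subst_point m \<psi> x)) \<in> r_DNF r n"
proof -
  obtain D where D: "set D \<subseteq> r_terms r m" "\<And>x. x \<in> cube m \<Longrightarrow> G x \<longleftrightarrow> (\<exists>T\<in>set D. term_eval T x)"
    using G unfolding r_DNF_def by auto
  have "\<exists>D'. set D' \<subseteq> r_terms r n \<and>
     (\<forall>x\<in>cube n. (\<exists>T\<in>set D'. term_eval T x) = (\<exists>T\<in>set D. term_eval T (subst_point m \<psi> x)))"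
    using D(1)
  proof (induction D)
    case Nil
    show ?case by (intro exI[of _ "[]"]) simp
  next
    case (Cons T D)
    then obtain D' where D': "set D' \<subseteq> r_terms r n"
      "\<forall>x\<in>cube n. (\<exists>T\<in>set D'. term_eval T x) = (\<exists>T\<in>set D. term_eval T (subst_point m \<psi> x))" by auto
    from term_eval_subst[OF \<psi>, of T r] Cons.prems consider
      (false) "\<forall>x\<in>cube n. \<not> term_eval T (subst_point m \<psi> x)"
    | (ok) T' where "T' \<in> r_terms r n" "\<forall>x\<in>cube n. term_eval T (subst_point m \<psi> x) = term_eval T' x" by auto
    then show ?case
    proof cases
      case false
      then show ?thesis using D' by (intro exI[of _ D']) simp
    next
      case (ok T')
      then show ?thesis using D' by (intro exI[of _ "T' # D'"]) simp
    qed
  qed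
  then obtain D' where D': "set D' \<subseteq> r_terms r n"
    "\<forall>x\<in>cube n. (\<exists>T\<in>set D'. term_eval T x) = (\<exists>T\<in>set D. term_eval T (subst_point m \<psi> x))"
    by (elim exE conjE)
  have "\<forall>x\<in>cube n. G (subst_point m \<psi> x) \<longleftrightarrow> (\<exists>T\<in>set D'. term_eval T x)"
    using D'(2) D(2)[OF subst_point_in_cube] by simp
  with D'(1) show ?thesis unfolding r_DNF_def by blast
qed

lemma DNF_subset_decision_list: "r_DNF r n \<subseteq> r_decision_list r n"
proof
  fix f assume "f \<in> r_DNF r n"
  then obtain D where D: "set D \<subseteq> r_terms r n" "\<And>x. x \<in> cube n \<Longrightarrow> f x \<longleftrightarrow> (\<exists>T\<in>set D. term_eval T x)"
    unfolding r_DNF_def by auto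
  let ?L = "map (\<lambda>T. (T, True, True)) D @ [([], True, False)]"
  have "dl_eval (map (\<lambda>T. (T, True, True)) D @ [([], True, False)]) x = Some (\<exists>T\<in>set D. term_eval T x)" for x D
    by (induction D) (auto simp: term_eval_def)
  then have "\<forall>x\<in>cube n. dl_eval ?L x = Some (f x)" using D(2) by simp
  moreover have "\<forall>(T, \<xi>, a)\<in>set ?L. T \<in> r_terms r n" using D(1) by (auto simp: r_terms_def)
  ultimately show "f \<in> r_decision_list r n" unfolding r_decision_list_def by blast
qed

subsection \<open>Counting decision lists\<close>

lemma dl_eval_filter: "dl_eval [i] x = None \<Longrightarrow> dl_eval (filter (\<lambda>j. j \<noteq> i) L) x = dl_eval L x"
proof (induction L)
  case (Cons j L)
  then show ?case by (cases i; cases j) (auto split: if_splits)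
qed simp

lemma dl_eval_cons: "dl_eval (i # L) x = (case dl_eval [i] x of None \<Rightarrow> dl_eval L x | Some b \<Rightarrow> Some b)"
  by (cases i) auto

text \<open>A later copy of an item is reached only if its test has already failed. Hence the length
  can be bounded by the number of items.\<close>

lemma dl_distinct:
  "\<exists>L'. set L' \<subseteq> set L \<and> distinct L' \<and> (\<forall>x. dl_eval L' x = dl_eval L x)"
proof (induction L)
  case (Cons i L)
  then obtain L' where L': "set L' \<subseteq> set L" "distinct L'" "\<forall>x. dl_eval L' x = dl_eval L x" by auto
  let ?L = "i # filter (\<lambda>j. j \<noteq> i) L'"
  have "dl_eval ?L x = dl_eval (i # L) x" for x
    using L'(3) dl_eval_filter[of i x L'] by (subst (1 2) dl_eval_cons) (auto split: option.splits)
  then show ?case using L'(1,2) by (intro exI[of _ ?L]) auto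
qed simp

lemma sum_powers_le: "(\<Sum>i\<le>r. a ^ i) \<le> (a + 1) ^ (r::nat)" for a :: nat
proof (induction r)
  case (Suc r)
  have "(\<Sum>i\<le>Suc r. a ^ i) = 1 + a * (\<Sum>i\<le>r. a ^ i)"
    by (subst sum.atMost_Suc_shift) (simp add: sum_distrib_left)
  also have "\<dots> \<le> (a + 1) ^ r + a * (a + 1) ^ r" using Suc by (intro add_mono mult_le_mono2) auto
  finally show ?case by (simp add: algebra_simps)
qed simp

lemma card_r_terms: "finite (r_terms r m)" "card (r_terms r m) \<le> (2 * m + 1) ^ r"
proof -
  let ?Lits = "Pos ` {..<m} \<union> Neg ` {..<m}"
  have fin: "finite ?Lits" by simp
  have "lit_var l < m \<longleftrightarrow> l \<in> ?Lits" for l by (cases l) auto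
  then have eq: "r_terms r m = {T. set T \<subseteq> ?Lits \<and> length T \<le> r}"
    unfolding r_terms_def by blast
  show "finite (r_terms r m)" unfolding eq by (rule finite_lists_length_le[OF fin])
  have "card ?Lits \<le> card (Pos ` {..<m}) + card (Neg ` {..<m})" by (rule card_Un_le)
  also have "\<dots> \<le> m + m"
    using card_image_le[of "{..<m}" Pos] card_image_le[of "{..<m}" Neg] by (intro add_mono) auto
  finally have "card ?Lits + 1 \<le> 2 * m + 1" by simp
  have "card (r_terms r m) = (\<Sum>i\<le>r. card ?Lits ^ i)" unfolding eq by (rule card_lists_length_le[OF fin])
  also have "\<dots> \<le> (card ?Lits + 1) ^ r" by (rule sum_powers_le)
  also have "\<dots> \<le> (2 * m + 1) ^ r" by (intro power_mono \<open>card ?Lits + 1 \<le> 2 * m + 1\<close> le0)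
  finally show "card (r_terms r m) \<le> (2 * m + 1) ^ r" .
qed

text \<open>Members of a class are arbitrary outside the cube, so the class itself is infinite; only
  its traces on the cube can be counted.\<close>

definition restrictions :: "nat \<Rightarrow> (bool list \<Rightarrow> bool) set \<Rightarrow> (bool list \<Rightarrow> bool) set" where
  "restrictions m C = (\<lambda>G. restrict G (cube m)) ` C"

text \<open>The square of the bound on the number \<open>k\<close> of items. There are at most
  \<open>(k + 1) ^ k\<close> lists without repetition, and this is at most
  \<open>exp (k * k)\<close>.\<close>

definition entropy_bound :: "nat \<Rightarrow> nat \<Rightarrow> nat" where
  "entropy_bound r m = (4 * (2 * m + 1) ^ r) ^ 2"

lemma card_restrictions_decision_list:
  "finite (restrictions m (r_decision_list r m))"
  "real (card (restrictions m (r_decision_list r m))) \<le> exp (real (entropy_bound r m))"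
proof -
  define I where "I = r_terms r m \<times> (UNIV :: bool set) \<times> (UNIV :: bool set)"
  have fin: "finite I" using card_r_terms(1) by (simp add: I_def)
  have cI: "card I \<le> 4 * (2 * m + 1) ^ r"
    using card_r_terms(2)[of r m] by (simp add: I_def card_cartesian_product)
  define W where "W = {xs. set xs \<subseteq> I \<and> length xs \<le> card I}"
  have finW: "finite W" unfolding W_def by (rule finite_lists_length_le[OF fin])
  have "card W = (\<Sum>i\<le>card I. card I ^ i)" unfolding W_def by (rule card_lists_length_le[OF fin])
  also have "\<dots> \<le> (card I + 1) ^ card I" by (rule sum_powers_le)
  finally have "real (card W) \<le> real ((card I + 1) ^ card I)" by (simp only: of_nat_le_iff)
  also have "\<dots> = (1 + real (card I)) ^ card I" by (simp add: add.commute)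
  also have "\<dots> \<le> exp (real (card I)) ^ card I"
    by (intro power_mono exp_ge_add_one_self) simp
  also have "\<dots> = exp (real (card I * card I))" by (simp add: exp_of_nat_mult)
  also have "\<dots> \<le> exp (real (entropy_bound r m))"
    unfolding entropy_bound_def power2_eq_square exp_le_cancel_iff of_nat_le_iff using cI by (intro mult_le_mono)
  finally have cW: "real (card W) \<le> exp (real (entropy_bound r m))" .
  have sub: "restrictions m (r_decision_list r m) \<subseteq> (\<lambda>L. restrict (\<lambda>x. the (dl_eval L x)) (cube m)) ` W"
  proof
    fix g assume "g \<in> restrictions m (r_decision_list r m)"
    then obtain G L where G: "g = restrict G (cube m)" "\<forall>(T, \<xi>, a)\<in>set L. T \<in> r_terms r m"
      "\<forall>x\<in>cube m. dl_eval L x = Some (G x)"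
      unfolding restrictions_def r_decision_list_def by blast
    obtain L' where L': "set L' \<subseteq> set L" "distinct L'" "\<forall>x. dl_eval L' x = dl_eval L x"
      using dl_distinct by blast
    have "set L \<subseteq> I" using G(2) unfolding I_def by auto
    then have "set L' \<subseteq> I" using L'(1) by auto
    moreover have "length L' \<le> card I" using L'(2) card_mono[OF fin \<open>set L' \<subseteq> I\<close>] by (simp add: distinct_card)
    ultimately have "L' \<in> W" by (simp add: W_def)
    moreover have "g = restrict (\<lambda>x. the (dl_eval L' x)) (cube m)"
      using G(1,3) L'(3) by (auto simp: restrict_def)
    ultimately show "g \<in> (\<lambda>L. restrict (\<lambda>x. the (dl_eval L x)) (cube m)) ` W" by blast
  qed
  show "finite (restrictions m (r_decision_list r m))" using sub finW by (rule finite_surj[rotated])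
  have "card (restrictions m (r_decision_list r m)) \<le> card W" using sub finW by (rule surj_card_le[rotated])
  then show "real (card (restrictions m (r_decision_list r m))) \<le> exp (real (entropy_bound r m))"
    using cW by linarith
qed

subsection \<open>Adaptive query algorithms\<close>

text \<open>Results of arbitrary type, computable with at most \<open>q\<close> queries. Decision
  trees output only bits, whereas the intermediate phases of the tester return tables, so trees are
  extracted only at the end.\<close>

inductive adaptive :: "'x set \<Rightarrow> nat \<Rightarrow> (('x \<Rightarrow> bool) \<Rightarrow> 'a) \<Rightarrow> bool" for X where
  adaptive_const: "adaptive X q (\<lambda>f. c)"
| adaptive_query: "x \<in> X \<Longrightarrow> adaptive X q \<Phi>0 \<Longrightarrow> adaptive X q \<Phi>1 \<Longrightarrow>
    adaptive X (Suc q) (\<lambda>f. if f x then \<Phi>1 f else \<Phi>0 f)"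

lemma adaptive_mono: "adaptive X q \<Phi> \<Longrightarrow> q \<le> q' \<Longrightarrow> adaptive X q' \<Phi>"
proof (induction arbitrary: q' rule: adaptive.induct)
  case (adaptive_const q c)
  show ?case by (rule adaptive.adaptive_const)
next
  case (adaptive_query x q \<Phi>0 \<Phi>1)
  then obtain p where "q' = Suc p" "q \<le> p" by (cases q') auto
  then show ?case using adaptive_query by (auto intro: adaptive.adaptive_query)
qed

text \<open>Sequential composition: the queries of the second phase may depend on the result of the
  first. This is where the tester is adaptive.\<close>

lemma adaptive_bind:
  assumes "adaptive X q \<Phi>" "\<And>a. adaptive X q' (\<Psi> a)"
  shows "adaptive X (q + q') (\<lambda>f. \<Psi> (\<Phi> f) f)"
  using assms(1)
proof (induction rule: adaptive.induct)
  case (adaptive_const q c)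
  show ?case by (rule adaptive_mono[OF assms(2)]) simp
next
  case (adaptive_query x q \<Phi>0 \<Phi>1)
  have eq: "(\<lambda>f. \<Psi> (if f x then \<Phi>1 f else \<Phi>0 f) f) = (\<lambda>f. if f x then \<Psi> (\<Phi>1 f) f else \<Psi> (\<Phi>0 f) f)"
    by (rule ext) simp
  show ?case
    unfolding eq add_Suc by (rule adaptive.adaptive_query) (rule adaptive_query.hyps adaptive_query.IH)+
qed

lemma adaptive_map:
  assumes "adaptive X q \<Phi>"
  shows "adaptive X q (\<lambda>f. g (\<Phi> f))"
  using adaptive_bind[OF assms, of 0 "\<lambda>a f. g a", OF adaptive_const] by simp

lemma adaptive_list:
  assumes "set xs \<subseteq> X"
  shows "adaptive X (length xs) (\<lambda>f. map f xs)"
  using assms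
proof (induction xs)
  case Nil
  show ?case using adaptive_const[of X 0 "[]"] by simp
next
  case (Cons x xs)
  have eq: "(\<lambda>f. map f (x # xs)) = (\<lambda>f. if f x then True # map f xs else False # map f xs)"
    by (rule ext) simp
  show ?case
    unfolding eq length_Cons
    by (rule adaptive_query) (use Cons adaptive_map[where g="Cons True"] adaptive_map[where g="Cons False"] in auto)
qed

lemma adaptive_points: "set xs \<subseteq> X \<Longrightarrow> adaptive X (length xs) (\<lambda>f. g (map f xs))"
  by (rule adaptive_map[OF adaptive_list])

lemma adaptive_table:
  assumes "finite I" "\<And>i. i \<in> I \<Longrightarrow> adaptive X q (\<Phi> i)"
  shows "adaptive X (card I * q) (\<lambda>f i. if i \<in> I then \<Phi> i f else d)"
  using assms
proof (induction I rule: finite_induct)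
  case empty
  show ?case using adaptive_const[of X 0 "\<lambda>i. d"] by simp
next
  case (insert k I)
  have "adaptive X (card I * q + q) (\<lambda>f. (\<lambda>i. if i = k then \<Phi> k f else (if i \<in> I then \<Phi> i f else d)))"
    by (rule adaptive_bind[of X "card I * q" "\<lambda>f i. if i \<in> I then \<Phi> i f else d" q
           "\<lambda>tab f. (\<lambda>i. if i = k then \<Phi> k f else tab i)"])
       (use insert in \<open>auto intro: adaptive_map\<close>)
  moreover have "(\<lambda>f. (\<lambda>i. if i = k then \<Phi> k f else (if i \<in> I then \<Phi> i f else d))) =
      (\<lambda>f i. if i \<in> insert k I then \<Phi> i f else d)"
    using insert.hyps by (intro ext) auto
  ultimately show ?case using insert.hyps by (simp add: add.commute)
qed

lemma adaptive_ball:
  assumes "finite I" "\<And>i. i \<in> I \<Longrightarrow> adaptive X q (\<Phi> i)"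
  shows "adaptive X (card I * q) (\<lambda>f. \<forall>i\<in>I. \<Phi> i f)"
  using adaptive_map[OF adaptive_table[OF assms, where d=True], where g="\<lambda>tab. \<forall>i\<in>I. tab i"] by simp

lemma adaptive_conj:
  assumes "adaptive X q \<Phi>" "adaptive X q' \<Psi>"
  shows "adaptive X (q + q') (\<lambda>f. \<Phi> f \<and> \<Psi> f)"
  by (rule adaptive_bind[OF assms(1), of q' "\<lambda>a f. a \<and> \<Psi> f"]) (rule adaptive_map[OF assms(2)])

lemma adaptive_imp_dtree:
  assumes "adaptive X q \<Phi>"
  shows "\<exists>t. queried t \<subseteq> X \<and> depth t \<le> q \<and> (\<forall>f. run t f = \<Phi> f)"
  using assms
proof (induction rule: adaptive.induct)
  case (adaptive_const q c)
  show ?case by (intro exI[of _ "Output c"]) simp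
next
  case (adaptive_query x q \<Phi>0 \<Phi>1)
  then obtain t0 t1 where "queried t0 \<subseteq> X" "depth t0 \<le> q" "\<forall>f. run t0 f = \<Phi>0 f"
    "queried t1 \<subseteq> X" "depth t1 \<le> q" "\<forall>f. run t1 f = \<Phi>1 f" by blast
  then show ?case using adaptive_query.hyps(1) by (intro exI[of _ "Query x t0 t1"]) simp
qed

subsection \<open>The tester\<close>

text \<open>The value \<open>\<sigma> (j, s)\<close> is the \<open>s\<close>-th probe of block
  \<open>j\<close>: a point and fresh values for the block. If they change \<open>f\<close>, the
  point is a witness for the influence of the block.\<close>

definition found ::
  "nat \<Rightarrow> (nat \<Rightarrow> nat) \<Rightarrow> (nat \<times> nat \<Rightarrow> bool list \<times> bool list) \<Rightarrow> (bool list \<Rightarrow> bool) \<Rightarrow> nat \<times> nat \<Rightarrow> bool" where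
  "found n h \<sigma> f p \<longleftrightarrow> f (fst (\<sigma> p)) \<noteq> f (mix n (\<lambda>i. h i = fst p) (fst (\<sigma> p)) (snd (\<sigma> p)))"

text \<open>The table \<open>D\<close> holds the outcomes of \<open>found\<close>; making it a parameter separates the queries
  of the first phase from the later ones, which depend on them.\<close>

definition reader_with ::
  "nat \<Rightarrow> nat \<Rightarrow> (nat \<Rightarrow> nat) \<Rightarrow> (nat \<times> nat \<Rightarrow> bool list \<times> bool list) \<Rightarrow> (nat \<times> nat \<Rightarrow> bool) \<Rightarrow>
     (bool list \<Rightarrow> bool) \<Rightarrow> nat \<Rightarrow> bool list \<Rightarrow> bool" where
  "reader_with n R h \<sigma> D f j z =
     (case find (\<lambda>s. D (j, s)) [0..<R] of None \<Rightarrow> False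
      | Some s \<Rightarrow> f (mix n (\<lambda>i. h i = j) (fst (\<sigma> (j, s))) z))"

definition reader ::
  "nat \<Rightarrow> nat \<Rightarrow> (nat \<Rightarrow> nat) \<Rightarrow> (nat \<times> nat \<Rightarrow> bool list \<times> bool list) \<Rightarrow>
     (bool list \<Rightarrow> bool) \<Rightarrow> nat \<Rightarrow> bool list \<Rightarrow> bool" where
  "reader n R h \<sigma> f = reader_with n R h \<sigma> (found n h \<sigma> f) f"

definition trials_pass :: "nat \<Rightarrow> nat \<Rightarrow> nat \<Rightarrow>
    (nat \<times> nat \<Rightarrow> (bool list \<times> bool list \<times> bool list) \<times> (bool list \<times> bool list \<times> bool list)) \<Rightarrow>
    (nat \<Rightarrow> bool list \<Rightarrow> bool) \<Rightarrow> bool" where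
  "trials_pass n m T \<tau> \<phi> \<longleftrightarrow> (\<forall>p\<in>{..<m} \<times> {..<T}. trial_ok n (\<phi> (fst p)) (\<tau> p))"

text \<open>The search through \<open>C\<close> is free of charge: only the values of
  \<open>f\<close> and of the readers at the samples are queried.\<close>

definition sample_consistent :: "nat \<Rightarrow> nat \<Rightarrow> (bool list \<Rightarrow> bool) set \<Rightarrow> (nat \<Rightarrow> bool list) \<Rightarrow>
    (nat \<Rightarrow> bool list \<Rightarrow> bool) \<Rightarrow> (bool list \<Rightarrow> bool) \<Rightarrow> bool" where
  "sample_consistent m N C \<rho> \<phi> f \<longleftrightarrow> (\<exists>G\<in>C. \<forall>t<N. f (\<rho> t) = G (subst_point m \<phi> (\<rho> t)))"

lemma trials_pass_cong:
  assumes "\<forall>j<m. \<phi> j = \<phi>' j"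
  shows "trials_pass n m T \<tau> \<phi> = trials_pass n m T \<tau> \<phi>'"
  using assms unfolding trials_pass_def by auto

lemma sample_consistent_cong:
  assumes "\<forall>j<m. \<phi> j = \<phi>' j"
  shows "sample_consistent m N C \<rho> \<phi> f = sample_consistent m N C \<rho> \<phi>' f"
proof -
  have "subst_point m \<phi> = subst_point m \<phi>'" using assms by (intro ext) (simp add: subst_point_def)
  then show ?thesis by (simp add: sample_consistent_def)
qed

text \<open>The seed consists of the hash, the probes, the trials and the samples. The readers
  depend on the first two only, so trials and samples are independent of them.\<close>

definition accepts where
  "accepts n m R T N C = (\<lambda>(h, \<sigma>, \<tau>, \<rho>) f.
     trials_pass n m T \<tau> (reader n R h \<sigma> f) \<and> sample_consistent m N C \<rho> (reader n R h \<sigma> f) f)"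

lemma adaptive_reader_with:
  "adaptive (cube n) 1 (\<lambda>f. reader_with n R h \<sigma> D f j z)"
proof (cases "find (\<lambda>s. D (j, s)) [0..<R]")
  case None
  then show ?thesis using adaptive_const by (simp add: reader_with_def)
next
  case (Some s)
  then show ?thesis
    using adaptive_points[of "[mix n (\<lambda>i. h i = j) (fst (\<sigma> (j, s))) z]" "cube n" hd] by (simp add: reader_with_def)
qed

lemma adaptive_trial:
  "adaptive (cube n) 7 (\<lambda>f. trial_ok n (reader_with n R h \<sigma> D f j) w)"
proof -
  obtain x y u a z v where w: "w = ((x, y, u), (a, z, v))" by (metis surj_pair)
  let ?g = "\<lambda>bs :: bool list. ((bs ! 0 \<noteq> bs ! 1) = (bs ! 2 \<noteq> bs ! 3)) \<and> (bs ! 4 = bs ! 5 \<or> bs ! 4 = bs ! 6)"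
  let ?pts = "[x, y, u, xr x (xr y u), z, mix n (\<lambda>i. a ! i) z v, mix n (\<lambda>i. \<not> a ! i) z v]"
  have ok: "trial_ok n \<phi> w = ?g (map \<phi> ?pts)" for \<phi>
    by (simp add: w trial_ok_def affine_ok_def split_ok_def numeral_eq_Suc)
  show ?thesis
  proof (cases "find (\<lambda>s. D (j, s)) [0..<R]")
    case None
    then show ?thesis using adaptive_const by (simp add: reader_with_def[abs_def] ok)
  next
    case (Some s)
    let ?m = "mix n (\<lambda>i. h i = j) (fst (\<sigma> (j, s)))"
    have "adaptive (cube n) (length (map ?m ?pts)) (\<lambda>f. ?g (map f (map ?m ?pts)))"
      by (rule adaptive_points[where g="?g"]) auto
    moreover have "reader_with n R h \<sigma> D f j = (\<lambda>z. f (?m z))" for f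
      using Some by (simp add: reader_with_def[abs_def])
    ultimately show ?thesis unfolding ok by (simp add: numeral_eq_Suc)
  qed
qed

text \<open>Two queries per probe, seven per trial, and \<open>m + 1\<close> per sample: one for
  \<open>f\<close> and one for each reader.\<close>

lemma adaptive_accepts:
  assumes \<sigma>: "\<And>j s. j < m \<Longrightarrow> s < R \<Longrightarrow> fst (\<sigma> (j, s)) \<in> cube n"
    and \<rho>: "\<And>t. t < N \<Longrightarrow> \<rho> t \<in> cube n"
  shows "adaptive (cube n) (2 * m * R + 7 * m * T + N * (m + 1)) (accepts n m R T N C (h, \<sigma>, \<tau>, \<rho>))"
proof -
  let ?I = "{..<m} \<times> {..<R}"
  have tab: "adaptive (cube n) (card ?I * 2) (\<lambda>f p. if p \<in> ?I then found n h \<sigma> f p else False)"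
  proof (rule adaptive_table)
    fix p assume p: "p \<in> ?I"
    have "fst (\<sigma> p) \<in> cube n" using p \<sigma> by auto
    then show "adaptive (cube n) 2 (\<lambda>f. found n h \<sigma> f p)"
      using adaptive_points[of "[fst (\<sigma> p), mix n (\<lambda>i. h i = fst p) (fst (\<sigma> p)) (snd (\<sigma> p))]" "cube n" "\<lambda>bs. bs ! 0 \<noteq> bs ! 1"]
      by (simp add: found_def numeral_2_eq_2)
  qed simp
  define \<Psi> where "\<Psi> = (\<lambda>D f. trials_pass n m T \<tau> (reader_with n R h \<sigma> D f) \<and>
     sample_consistent m N C \<rho> (reader_with n R h \<sigma> D f) f)"
  have "adaptive (cube n) (card ({..<m} \<times> {..<T}) * 7 + card {..<N} * (m + 1)) (\<Psi> D)" for D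
    unfolding \<Psi>_def
  proof (rule adaptive_conj)
    show "adaptive (cube n) (card ({..<m} \<times> {..<T}) * 7) (\<lambda>f. trials_pass n m T \<tau> (reader_with n R h \<sigma> D f))"
      unfolding trials_pass_def by (rule adaptive_ball) (auto intro: adaptive_trial)
    have sample: "adaptive (cube n) (m + 1) (\<lambda>f. (f (\<rho> t), subst_point m (reader_with n R h \<sigma> D f) (\<rho> t)))"
      if "t \<in> {..<N}" for t
    proof -
      have "adaptive (cube n) (card {..<m} * 1) (\<lambda>f j. if j \<in> {..<m} then reader_with n R h \<sigma> D f j (\<rho> t) else False)"
        by (intro adaptive_table adaptive_reader_with finite_lessThan)
      from adaptive_map[OF this, where g="\<lambda>tab. map tab [0..<m]"]
      have "adaptive (cube n) (card {..<m} * 1)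
          (\<lambda>f. map (\<lambda>j. if j \<in> {..<m} then reader_with n R h \<sigma> D f j (\<rho> t) else False) [0..<m])" .
      moreover have "map (\<lambda>j. if j \<in> {..<m} then q j else False) [0..<m] = map q [0..<m]" for q :: "nat \<Rightarrow> bool"
        by (intro map_cong) auto
      ultimately have 2: "adaptive (cube n) m (\<lambda>f. subst_point m (reader_with n R h \<sigma> D f) (\<rho> t))"
        by (simp only: subst_point_def card_lessThan mult_1_right)
      have 3: "adaptive (cube n) 1 (\<lambda>f. (f (\<rho> t), y))" for y :: "bool list"
        using adaptive_points[of "[\<rho> t]" "cube n" "\<lambda>bs. (hd bs, y)"] \<rho> that by simp
      show ?thesis
        using adaptive_bind[OF 2, of 1 "\<lambda>y f. (f (\<rho> t), y)", OF 3] .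
    qed
    have "adaptive (cube n) (card {..<N} * (m + 1))
       (\<lambda>f t. if t \<in> {..<N} then (f (\<rho> t), subst_point m (reader_with n R h \<sigma> D f) (\<rho> t)) else (False, []))"
      by (rule adaptive_table) (use sample in auto)
    from adaptive_map[OF this, where g="\<lambda>tab. \<exists>G\<in>C. \<forall>t<N. fst (tab t) = G (snd (tab t))"]
    show "adaptive (cube n) (card {..<N} * (m + 1))
       (\<lambda>f. sample_consistent m N C \<rho> (reader_with n R h \<sigma> D f) f)"
      unfolding sample_consistent_def by simp
  qed
  from adaptive_bind[OF tab this]
  have "adaptive (cube n) (card ?I * 2 + (card ({..<m} \<times> {..<T}) * 7 + card {..<N} * (m + 1)))
    (\<lambda>f. \<Psi> (\<lambda>p. if p \<in> ?I then found n h \<sigma> f p else False) f)" .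
  moreover have "\<Psi> (\<lambda>p. if p \<in> ?I then found n h \<sigma> f p else False) f = accepts n m R T N C (h, \<sigma>, \<tau>, \<rho>) f" for f
  proof -
    \<comment> \<open>The default entries outside \<open>?I\<close> do not matter, since readers of
      blocks below \<open>m\<close> look up only probes below \<open>R\<close>.\<close>
    have "reader_with n R h \<sigma> (\<lambda>p. if p \<in> ?I then found n h \<sigma> f p else False) f j z = reader n R h \<sigma> f j z"
      if "j < m" for j z
    proof -
      have "find (\<lambda>s. if (j, s) \<in> ?I then found n h \<sigma> f (j, s) else False) [0..<R] = find (\<lambda>s. found n h \<sigma> f (j, s)) [0..<R]"
        by (rule find_cong) (use that in auto)
      then show ?thesis unfolding reader_def reader_with_def by simp
    qed
    then have "\<forall>j<m. reader_with n R h \<sigma> (\<lambda>p. if p \<in> ?I then found n h \<sigma> f p else False) f j = reader n R h \<sigma> f j"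
      by (intro allI impI ext)
    then show ?thesis
      unfolding \<Psi>_def accepts_def prod.case
      by (intro arg_cong2[where f="(\<and>)"] trials_pass_cong sample_consistent_cong)
  qed
  ultimately have "adaptive (cube n) (card ?I * 2 + (card ({..<m} \<times> {..<T}) * 7 + card {..<N} * (m + 1)))
    (accepts n m R T N C (h, \<sigma>, \<tau>, \<rho>))" by (simp only:)
  moreover have "card ?I * 2 + (card ({..<m} \<times> {..<T}) * 7 + card {..<N} * (m + 1)) = 2 * m * R + 7 * m * T + N * (m + 1)"
    by (simp add: card_cartesian_product)
  ultimately show ?thesis by (simp only:)
qed

subsection \<open>Soundness\<close>

definition probe_pmf :: "nat \<Rightarrow> nat \<Rightarrow> nat \<Rightarrow> (nat \<times> nat \<Rightarrow> bool list \<times> bool list) pmf" where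
  "probe_pmf n m R = Pi_pmf ({..<m} \<times> {..<R}) ([], []) (\<lambda>_. pair_pmf (unif n) (unif n))"

definition trial_pmf :: "nat \<Rightarrow> nat \<Rightarrow> nat \<Rightarrow>
    (nat \<times> nat \<Rightarrow> (bool list \<times> bool list \<times> bool list) \<times> (bool list \<times> bool list \<times> bool list)) pmf" where
  "trial_pmf n m T = Pi_pmf ({..<m} \<times> {..<T}) (([], [], []), ([], [], [])) (\<lambda>_. unif6 n)"

definition sample_pmf :: "nat \<Rightarrow> nat \<Rightarrow> (nat \<Rightarrow> bool list) pmf" where
  "sample_pmf n N = Pi_pmf {..<N} [] (\<lambda>_. unif n)"

definition hash_pmf :: "nat \<Rightarrow> nat \<Rightarrow> (nat \<Rightarrow> nat) pmf" where
  "hash_pmf n m = Pi_pmf {..<n} 0 (\<lambda>_. pmf_of_set {..<m})"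

definition seed_pmf where
  "seed_pmf n m R T N =
     pair_pmf (hash_pmf n m) (pair_pmf (probe_pmf n m R) (pair_pmf (trial_pmf n m T) (sample_pmf n N)))"

lemma trials_pass_le:
  assumes j: "j < m" and \<beta>: "0 \<le> \<beta>" "\<beta> \<le> 1 / 56"
    and far: "\<nexists>\<psi>. unary_on n \<psi> \<and> measure_pmf.prob (unif n) {x. \<phi> j x \<noteq> \<psi> x} \<le> 2 * \<beta>"
  shows "measure_pmf.prob (trial_pmf n m T) {\<tau>. trials_pass n m T \<tau> \<phi>} \<le> (1 - \<beta>) ^ T"
proof -
  have "\<not> measure_pmf.prob (unif6 n) {w. \<not> trial_ok n (\<phi> j) w} < \<beta>"
    using trial_sound[of n "\<phi> j" \<beta>] far \<beta>(2) by blast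
  then have ok: "measure_pmf.prob (unif6 n) {w. trial_ok n (\<phi> j) w} \<le> 1 - \<beta>"
    using prob_compl[of "unif6 n" "trial_ok n (\<phi> j)"] by linarith
  have "measure_pmf.prob (trial_pmf n m T) {\<tau>. trials_pass n m T \<tau> \<phi>}
     \<le> measure_pmf.prob (trial_pmf n m T) {\<tau>. \<forall>p\<in>{j} \<times> {..<T}. trial_ok n (\<phi> (fst p)) (\<tau> p)}"
    using j by (intro prob_mono) (auto simp: trials_pass_def)
  also have "\<dots> \<le> (1 - \<beta>) ^ card ({j} \<times> {..<T})"
    unfolding trial_pmf_def
    by (rule prob_Pi_all_sub[where P="\<lambda>p w. trial_ok n (\<phi> (fst p)) w"]) (use j ok in auto)
  finally show ?thesis by (simp add: card_cartesian_product)
qed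

text \<open>Occam bound. Unless some reader errs on some sample, consistency means that a member of
  \<open>Cn\<close>, a hypothesis composed with the \<psi>, agrees with \<open>f\<close> on all
  samples. A fixed far function survives with probability at most
  \<open>exp (- \<epsilon> * N)\<close>, and there are as many candidates as traces on the small
  cube.\<close>

lemma sample_consistent_le:
  assumes close: "\<forall>j<m. unary_on n (\<psi> j) \<and> measure_pmf.prob (unif n) {x. \<phi> j x \<noteq> \<psi> j x} \<le> \<tau>"
    and far: "far_from n \<epsilon> Cn f"
    and closed: "\<And>G. G \<in> Cm \<Longrightarrow> (\<lambda>x. G (subst_point m \<psi> x)) \<in> Cn"
    and fin: "finite (restrictions m Cm)"
  shows "measure_pmf.prob (sample_pmf n N) {\<rho>. sample_consistent m N Cm \<rho> \<phi> f}
     \<le> real (N * m) * \<tau> + real (card (restrictions m Cm)) * exp (- \<epsilon> * N)"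
proof -
  let ?I = "{..<N} \<times> {..<m}"
  have comp: "measure_pmf.prob (sample_pmf n N) {\<rho>. P (\<rho> t)} = measure_pmf.prob (unif n) {x. P x}" if "t < N" for t P
    unfolding sample_pmf_def using that by (intro prob_Pi_component) auto
  have 1: "measure_pmf.prob (sample_pmf n N) {\<rho>. \<exists>p\<in>?I. \<phi> (snd p) (\<rho> (fst p)) \<noteq> \<psi> (snd p) (\<rho> (fst p))} \<le> real (card ?I) * \<tau>"
  proof (rule prob_UN_le[where P="\<lambda>p \<rho>. \<phi> (snd p) (\<rho> (fst p)) \<noteq> \<psi> (snd p) (\<rho> (fst p))"])
    fix p assume "p \<in> ?I"
    then show "measure_pmf.prob (sample_pmf n N) {\<rho>. \<phi> (snd p) (\<rho> (fst p)) \<noteq> \<psi> (snd p) (\<rho> (fst p))} \<le> \<tau>"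
      using comp[of "fst p" "\<lambda>x. \<phi> (snd p) x \<noteq> \<psi> (snd p) x"] close by auto
  qed auto
  have 2: "measure_pmf.prob (sample_pmf n N) {\<rho>. \<exists>G\<in>restrictions m Cm. \<forall>t\<in>{..<N}. f (\<rho> t) = G (subst_point m \<psi> (\<rho> t))}
     \<le> real (card (restrictions m Cm)) * exp (- \<epsilon> * N)"
  proof (rule prob_UN_le[OF fin, where P="\<lambda>G \<rho>. \<forall>t\<in>{..<N}. f (\<rho> t) = G (subst_point m \<psi> (\<rho> t))"])
    fix g assume "g \<in> restrictions m Cm"
    then obtain G where G: "G \<in> Cm" "g = restrict G (cube m)" by (auto simp: restrictions_def)
    have "\<epsilon> \<le> measure_pmf.prob (unif n) {x. f x \<noteq> G (subst_point m \<psi> x)}"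
      using bspec[OF far[unfolded far_from_def] closed[OF G(1)]] .
    then have "measure_pmf.prob (unif n) {x. f x = G (subst_point m \<psi> x)} \<le> 1 - \<epsilon>"
      using prob_compl[of "unif n" "\<lambda>x. f x = G (subst_point m \<psi> x)"] by linarith
    also have "\<dots> \<le> exp (- \<epsilon>)" using exp_ge_add_one_self[of "- \<epsilon>"] by simp
    finally have "measure_pmf.prob (unif n) {x. f x = g (subst_point m \<psi> x)} \<le> exp (- \<epsilon>)"
      by (simp add: G(2))
    then have "measure_pmf.prob (sample_pmf n N) {\<rho>. \<forall>t\<in>{..<N}. f (\<rho> t) = g (subst_point m \<psi> (\<rho> t))} \<le> exp (- \<epsilon>) ^ card {..<N}"
      unfolding sample_pmf_def by (intro prob_Pi_all_sub) auto
    also have "\<dots> = exp (- \<epsilon> * N)" by (simp add: exp_of_nat_mult[symmetric] mult.commute)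
    finally show "measure_pmf.prob (sample_pmf n N) {\<rho>. \<forall>t\<in>{..<N}. f (\<rho> t) = g (subst_point m \<psi> (\<rho> t))} \<le> exp (- \<epsilon> * N)" .
  qed
  have "measure_pmf.prob (sample_pmf n N) {\<rho>. sample_consistent m N Cm \<rho> \<phi> f}
     \<le> real (card ?I) * \<tau> + real (card (restrictions m Cm)) * exp (- \<epsilon> * N)"
  proof (rule prob_Un_le[OF _ 1 2])
    fix \<rho> assume cons: "sample_consistent m N Cm \<rho> \<phi> f"
    then obtain G where G: "G \<in> Cm" "\<And>t. t < N \<Longrightarrow> f (\<rho> t) = G (subst_point m \<phi> (\<rho> t))"
      unfolding sample_consistent_def by blast
    show "(\<exists>p\<in>?I. \<phi> (snd p) (\<rho> (fst p)) \<noteq> \<psi> (snd p) (\<rho> (fst p))) \<or>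
       (\<exists>G\<in>restrictions m Cm. \<forall>t\<in>{..<N}. f (\<rho> t) = G (subst_point m \<psi> (\<rho> t)))"
    proof (cases "\<exists>p\<in>?I. \<phi> (snd p) (\<rho> (fst p)) \<noteq> \<psi> (snd p) (\<rho> (fst p))")
      case False
      then have "\<phi> j (\<rho> t) = \<psi> j (\<rho> t)" if "j < m" "t < N" for j t using that by auto
      then have "subst_point m \<phi> (\<rho> t) = subst_point m \<psi> (\<rho> t)" if "t < N" for t
        using that by (simp add: subst_point_def)
      then have "\<forall>t\<in>{..<N}. f (\<rho> t) = restrict G (cube m) (subst_point m \<psi> (\<rho> t))"
        using G(2) by simp
      then show ?thesis using G(1) unfolding restrictions_def by (intro disjI2 bexI[of _ "restrict G (cube m)"] imageI)
    qed blast
  qed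
  then show ?thesis by (simp add: card_cartesian_product)
qed

text \<open>With hash and probes fixed, the readers are fixed functions. If one of them is far from
  every literal and constant, the trials reject it; otherwise the samples expose \<open>f\<close>.
  It remains to average over hash and probes.\<close>

theorem soundness:
  assumes far: "far_from n \<epsilon> Cn f"
    and closed: "\<And>G \<psi>. G \<in> Cm \<Longrightarrow> \<forall>j<m. unary_on n (\<psi> j) \<Longrightarrow> (\<lambda>x. G (subst_point m \<psi> x)) \<in> Cn"
    and fin: "finite (restrictions m Cm)"
    and \<beta>: "0 \<le> \<beta>" "\<beta> \<le> 1 / 56" and T: "(1 - \<beta>) ^ T \<le> 1 / 3"
    and N: "real (N * m) * (2 * \<beta>) + real (card (restrictions m Cm)) * exp (- \<epsilon> * N) \<le> 1 / 3"
  shows "measure_pmf.prob (seed_pmf n m R T N) {\<omega>. accepts n m R T N Cm \<omega> f} \<le> 1 / 3"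
proof -
  have fixed: "measure_pmf.prob (pair_pmf (trial_pmf n m T) (sample_pmf n N))
     {w. trials_pass n m T (fst w) \<phi> \<and> sample_consistent m N Cm (snd w) \<phi> f} \<le> 1 / 3" for \<phi>
  proof (cases "\<forall>j<m. \<exists>\<psi>. unary_on n \<psi> \<and> measure_pmf.prob (unif n) {x. \<phi> j x \<noteq> \<psi> x} \<le> 2 * \<beta>")
    case True
    then have "\<exists>\<psi>. \<forall>j<m. unary_on n (\<psi> j) \<and> measure_pmf.prob (unif n) {x. \<phi> j x \<noteq> \<psi> j x} \<le> 2 * \<beta>"
      by (intro choice) blast
    then obtain \<psi> where \<psi>: "\<forall>j<m. unary_on n (\<psi> j) \<and> measure_pmf.prob (unif n) {x. \<phi> j x \<noteq> \<psi> j x} \<le> 2 * \<beta>" by blast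
    have "measure_pmf.prob (pair_pmf (trial_pmf n m T) (sample_pmf n N))
       {w. trials_pass n m T (fst w) \<phi> \<and> sample_consistent m N Cm (snd w) \<phi> f} \<le>
      measure_pmf.prob (pair_pmf (trial_pmf n m T) (sample_pmf n N)) {w. sample_consistent m N Cm (snd w) \<phi> f}"
      by (intro prob_mono) auto
    also have "\<dots> = measure_pmf.prob (sample_pmf n N) {\<rho>. sample_consistent m N Cm \<rho> \<phi> f}"
      by (rule prob_snd_pair)
    also have "\<dots> \<le> real (N * m) * (2 * \<beta>) + real (card (restrictions m Cm)) * exp (- \<epsilon> * N)"
      by (rule sample_consistent_le[OF \<psi> far closed fin]) (use \<psi> in auto)
    finally show ?thesis using N by linarith
  next
    case False
    then obtain j where j: "j < m" "\<nexists>\<psi>. unary_on n \<psi> \<and> measure_pmf.prob (unif n) {x. \<phi> j x \<noteq> \<psi> x} \<le> 2 * \<beta>" by blast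
    have "measure_pmf.prob (pair_pmf (trial_pmf n m T) (sample_pmf n N))
       {w. trials_pass n m T (fst w) \<phi> \<and> sample_consistent m N Cm (snd w) \<phi> f} \<le>
      measure_pmf.prob (pair_pmf (trial_pmf n m T) (sample_pmf n N)) {w. trials_pass n m T (fst w) \<phi>}"
      by (intro prob_mono) auto
    also have "\<dots> = measure_pmf.prob (trial_pmf n m T) {\<tau>. trials_pass n m T \<tau> \<phi>}"
      by (rule prob_fst_pair)
    also have "\<dots> \<le> (1 - \<beta>) ^ T" by (rule trials_pass_le[where \<phi>=\<phi>, OF j(1) \<beta> j(2)])
    finally show ?thesis using T by linarith
  qed
  have eq: "{\<omega>. accepts n m R T N Cm \<omega> f} =
      {w. (\<lambda>h w. trials_pass n m T (fst (snd w)) (reader n R h (fst w) f) \<and>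
            sample_consistent m N Cm (snd (snd w)) (reader n R h (fst w) f) f) (fst w) (snd w)}"
    by (auto simp: accepts_def)
  show ?thesis
    unfolding eq seed_pmf_def
  proof (rule prob_pair_le)
    fix h
    show "measure_pmf.prob (pair_pmf (probe_pmf n m R) (pair_pmf (trial_pmf n m T) (sample_pmf n N)))
       {w. trials_pass n m T (fst (snd w)) (reader n R h (fst w) f) \<and>
            sample_consistent m N Cm (snd (snd w)) (reader n R h (fst w) f) f} \<le> 1 / 3"
      by (rule prob_pair_le[where P="\<lambda>\<sigma> w. trials_pass n m T (fst w) (reader n R h \<sigma> f) \<and>
            sample_consistent m N Cm (snd w) (reader n R h \<sigma> f) f"]) (rule fixed)
  qed
qed

subsection \<open>Completeness\<close>

text \<open>Listing the points at which a trial evaluates its function gives the union bound an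
  index to range over.\<close>

fun trial_points where
  "trial_points n ((x, y, u), (a, z, v)) =
     [x, y, u, xr x (xr y u), z, mix n (\<lambda>i. a ! i) z v, mix n (\<lambda>i. \<not> a ! i) z v]"

lemma trial_ok_cong:
  assumes "\<And>k. k < 7 \<Longrightarrow> \<phi> (trial_points n w ! k) = \<phi>' (trial_points n w ! k)"
  shows "trial_ok n \<phi> w = trial_ok n \<phi>' w"
proof -
  obtain x y u a z v where w: "w = ((x, y, u), (a, z, v))" by (metis surj_pair)
  show ?thesis
    using assms[of 0] assms[of 1] assms[of 2] assms[of 3] assms[of 4] assms[of 5] assms[of 6]
    by (simp add: w trial_ok_def affine_ok_def split_ok_def numeral_eq_Suc)
qed

lemma trial_ok_literal:
  assumes "i < n" "w \<in> set_pmf (unif6 n)"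
  shows "trial_ok n (\<lambda>x. x ! i \<noteq> c) w"
proof -
  obtain x y u a z v where w: "w = ((x, y, u), (a, z, v))" by (metis surj_pair)
  have "x \<in> cube n" "y \<in> cube n" "u \<in> cube n" using assms(2) by (auto simp: w)
  then have "xr x (xr y u) ! i = (x ! i \<noteq> (y ! i \<noteq> u ! i))"
    using assms(1) nth_xr[of x n "xr y u" i] nth_xr[of y n u i] xr_in_cube[of y n u] by blast
  then show ?thesis
    using assms(1) by (simp add: w trial_ok_def affine_ok_def split_ok_def) argo
qed

text \<open>The union bound needs only that each point is uniform by itself; the seven points are
  far from independent.\<close>

lemma map_trial_points:
  assumes "k < 7"
  shows "map_pmf (\<lambda>w. trial_points n w ! k) (unif6 n) = unif n"
proof -
  have fs: "map_pmf (\<lambda>w. F (fst w)) (unif6 n) = map_pmf F (unif3 n)" for F :: "_ \<Rightarrow> bool list"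
  proof -
    have "map_pmf (\<lambda>w. F (fst w)) (unif6 n) = map_pmf F (map_pmf fst (unif6 n))" by (simp only: map_pmf_comp)
    then show ?thesis by (simp only: map_fst_pair_pmf)
  qed
  have sn: "map_pmf (\<lambda>w. F (snd w)) (unif6 n) = map_pmf F (unif3 n)" for F :: "_ \<Rightarrow> bool list"
  proof -
    have "map_pmf (\<lambda>w. F (snd w)) (unif6 n) = map_pmf F (map_pmf snd (unif6 n))" by (simp only: map_pmf_comp)
    then show ?thesis by (simp only: map_snd_pair_pmf)
  qed
  have x: "map_pmf fst (unif3 n) = unif n" by (rule map_fst_pair_pmf)
  have u: "map_pmf (\<lambda>w. snd (snd w)) (unif3 n) = unif n"
  proof -
    have "map_pmf (\<lambda>w. snd (snd w)) (unif3 n) = map_pmf snd (map_pmf snd (unif3 n))" by (simp only: map_pmf_comp)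
    then show ?thesis by (simp only: map_snd_pair_pmf)
  qed
  have xyu: "map_pmf (\<lambda>w. xr (fst w) (xr (fst (snd w)) (snd (snd w)))) (unif3 n) = unif n"
  proof -
    have "map_pmf (\<lambda>w. xr (fst w) (xr (fst (snd w)) (snd (snd w)))) (unif3 n) =
      bind_pmf (unif n) (\<lambda>x. bind_pmf (unif n) (\<lambda>y. map_pmf (xr x) (map_pmf (xr y) (unif n))))"
      by (simp only: pair_pmf_def map_pmf_def bind_assoc_pmf bind_return_pmf fst_conv snd_conv)
    also have "\<dots> = bind_pmf (unif n) (\<lambda>x. bind_pmf (unif n) (\<lambda>y. unif n))"
      by (intro bind_pmf_cong refl) (auto simp: map_xr_unif)
    also have "\<dots> = unif n" by (simp add: bind_pmf_const)
    finally show ?thesis .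
  qed
  have pts: "trial_points n w = [fst (fst w), fst (snd (fst w)), snd (snd (fst w)),
      xr (fst (fst w)) (xr (fst (snd (fst w))) (snd (snd (fst w)))), fst (snd (snd w)),
      mix n (\<lambda>i. fst (snd w) ! i) (fst (snd (snd w))) (snd (snd (snd w))),
      mix n (\<lambda>i. \<not> fst (snd w) ! i) (fst (snd (snd w))) (snd (snd (snd w)))]" for w
    by (cases "(n, w)" rule: trial_points.cases) simp
  consider "k = 0" | "k = 1" | "k = 2" | "k = 3" | "k = 4" | "k = 5" | "k = 6" using assms by linarith
  then show ?thesis
  proof cases
    case 1
    then show ?thesis using fs[of fst] x by (simp add: pts)
  next
    case 2
    then show ?thesis using fs[of "\<lambda>w. fst (snd w)"] map_unif3_z by (simp add: pts)
  next
    case 3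
    then show ?thesis using fs[of "\<lambda>w. snd (snd w)"] u by (simp add: pts numeral_eq_Suc)
  next
    case 4
    then show ?thesis using fs[of "\<lambda>w. xr (fst w) (xr (fst (snd w)) (snd (snd w)))"] xyu by (simp add: pts numeral_eq_Suc)
  next
    case 5
    then show ?thesis using sn[of "\<lambda>w. fst (snd w)"] map_unif3_z by (simp add: pts numeral_eq_Suc)
  next
    case 6
    then show ?thesis using sn[of "\<lambda>w. mix n (\<lambda>i. fst w ! i) (fst (snd w)) (snd (snd w))"]
      map_unif3_mix[of n "\<lambda>a i. a ! i"] by (simp add: pts numeral_eq_Suc)
  next
    case 7
    then show ?thesis using sn[of "\<lambda>w. mix n (\<lambda>i. \<not> fst w ! i) (fst (snd w)) (snd (snd w))"]
      map_unif3_mix[of n "\<lambda>a i. \<not> a ! i"] by (simp add: pts numeral_eq_Suc)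
  qed
qed

definition relevant where
  "relevant n R h \<sigma> f j \<longleftrightarrow> (\<exists>s<R. found n h \<sigma> f (j, s))"

lemma reader_cases:
  obtains (none) "\<not> relevant n R h \<sigma> f j" "\<And>z. reader n R h \<sigma> f j z = False"
  | (some) s where "s < R" "found n h \<sigma> f (j, s)" "relevant n R h \<sigma> f j"
      "\<And>z. reader n R h \<sigma> f j z = f (mix n (\<lambda>i. h i = j) (fst (\<sigma> (j, s))) z)"
proof (cases "find (\<lambda>s. found n h \<sigma> f (j, s)) [0..<R]")
  case None
  then have "\<not> relevant n R h \<sigma> f j" by (auto simp: find_None_iff relevant_def)
  then show ?thesis using None none by (simp add: reader_def reader_with_def)
next
  case (Some s)
  then have s: "s < R" "found n h \<sigma> f (j, s)" by (auto simp: find_Some_iff)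
  then have "relevant n R h \<sigma> f j" by (auto simp: relevant_def)
  then show ?thesis using Some s some by (simp add: reader_def reader_with_def)
qed

text \<open>By injectivity a block holds at most one variable of \<open>J\<close>. The change of
  \<open>g\<close> shows that it holds one and that \<open>g\<close> really depends on it there, and
  a nonconstant function of one bit is a literal.\<close>

lemma junta_block_literal:
  assumes g: "junta_on n J g" and J: "J \<subseteq> {..<n}" and inj: "inj_on h J"
    and w: "w \<in> cube n" and z0: "z0 \<in> cube n"
    and ne: "g w \<noteq> g (mix n (\<lambda>i. h i = j) w z0)"
  shows "\<exists>i c. i \<in> J \<and> h i = j \<and> (\<forall>z. g (mix n (\<lambda>i. h i = j) w z) = (z ! i \<noteq> c))"
proof -
  let ?m = "mix n (\<lambda>i. h i = j) w"
  have eqI: "g x = g y" if "x \<in> cube n" "y \<in> cube n" "\<And>i. i \<in> J \<Longrightarrow> x ! i = y ! i" for x y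
    using g that unfolding junta_on_def by blast
  have "\<exists>i\<in>J. h i = j"
  proof (rule ccontr)
    assume "\<not> ?thesis"
    then have "g w = g (?m z0)" using w J by (intro eqI) auto
    then show False using ne by simp
  qed
  then obtain i where i: "i \<in> J" "h i = j" by blast
  have uniq: "i' = i" if "i' \<in> J" "h i' = j" for i' using inj i that by (auto simp: inj_on_def)
  have n: "i' < n" if "i' \<in> J" for i' using that J by auto
  have same: "g (?m z) = g (?m z')" if "z ! i = z' ! i" for z z'
  proof (rule eqI)
    fix i' assume "i' \<in> J"
    then show "?m z ! i' = ?m z' ! i'" using uniq[of i'] n[of i'] that by auto
  qed auto
  have "?m w = w" by (rule cube_eqI[where n=n]) (use w in auto)
  then have gw: "g (?m z) = g w" if "z ! i = w ! i" for z using same[of z w] that by simp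
  have ne_i: "z0 ! i \<noteq> w ! i" using gw[of z0] ne by auto
  have gz: "g (?m z) = (\<not> g w)" if "z ! i \<noteq> w ! i" for z
  proof -
    have "z ! i = z0 ! i" using that ne_i by argo
    then show ?thesis using same[of z z0] ne by argo
  qed
  have "g (?m z) = (z ! i \<noteq> (w ! i \<noteq> g w))" for z
    using gw[of z] gz[of z] by argo
  then show ?thesis using i by blast
qed

text \<open>The deterministic core of completeness. The consistent hypothesis is \<open>f\<close>
  with the signed block value \<open>b ! h i\<close> in place of each detected variable of
  \<open>J\<close> and the constant \<open>\<zeta> ! i\<close> in place of every other one; by
  \<open>F\<close> this does not change \<open>f\<close> on the samples. Agreement with
  \<open>g\<close> is required for every probe \<open>s\<close>, since it depends on
  \<open>f\<close> which of them becomes the witness.\<close>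

lemma accepts_good_seed:
  assumes f: "f \<in> Cn"
    and closed: "\<And>\<eta>. \<forall>i<n. unary_on m (\<eta> i) \<Longrightarrow> (\<lambda>b. f (subst_point n \<eta> b)) \<in> Cm"
    and g: "junta_on n J g" and J: "J \<subseteq> {..<n}"
    and h: "\<And>i. i < n \<Longrightarrow> h i < m" and inj: "inj_on h J"
    and \<sigma>: "\<And>j s. j < m \<Longrightarrow> s < R \<Longrightarrow> \<sigma> (j, s) \<in> cube n \<times> cube n"
    and \<tau>: "\<And>j t. j < m \<Longrightarrow> t < T \<Longrightarrow> \<tau> (j, t) \<in> set_pmf (unif6 n)"
    and \<rho>: "\<And>t. t < N \<Longrightarrow> \<rho> t \<in> cube n"
    and B: "\<And>j s. j < m \<Longrightarrow> s < R \<Longrightarrow> f (fst (\<sigma> (j, s))) = g (fst (\<sigma> (j, s))) \<and>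
        f (mix n (\<lambda>i. h i = j) (fst (\<sigma> (j, s))) (snd (\<sigma> (j, s)))) = g (mix n (\<lambda>i. h i = j) (fst (\<sigma> (j, s))) (snd (\<sigma> (j, s))))"
    and C: "\<And>j s t k. j < m \<Longrightarrow> s < R \<Longrightarrow> t < T \<Longrightarrow> k < 7 \<Longrightarrow>
        f (mix n (\<lambda>i. h i = j) (fst (\<sigma> (j, s))) (trial_points n (\<tau> (j, t)) ! k)) =
        g (mix n (\<lambda>i. h i = j) (fst (\<sigma> (j, s))) (trial_points n (\<tau> (j, t)) ! k))"
    and D: "\<And>j s t. j < m \<Longrightarrow> s < R \<Longrightarrow> t < N \<Longrightarrow>
        f (mix n (\<lambda>i. h i = j) (fst (\<sigma> (j, s))) (\<rho> t)) = g (mix n (\<lambda>i. h i = j) (fst (\<sigma> (j, s))) (\<rho> t))"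
    and F: "\<exists>\<zeta>. \<forall>t<N. f (\<rho> t) = f (mix n (\<lambda>i. \<not> (i \<in> J \<and> relevant n R h \<sigma> f (h i))) (\<rho> t) \<zeta>)"
  shows "accepts n m R T N Cm (h, \<sigma>, \<tau>, \<rho>) f"
proof -
  let ?\<phi> = "reader n R h \<sigma> f"
  have lit: "\<exists>i c. i \<in> J \<and> h i = j \<and> (\<forall>t<T. \<forall>k<7. ?\<phi> j (trial_points n (\<tau> (j, t)) ! k) = (trial_points n (\<tau> (j, t)) ! k ! i \<noteq> c))
      \<and> (\<forall>t<N. ?\<phi> j (\<rho> t) = (\<rho> t ! i \<noteq> c))"
    if j: "j < m" and rel: "relevant n R h \<sigma> f j" for j
  proof (cases n R h \<sigma> f j rule: reader_cases)
    case none
    then show ?thesis using rel by blast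
  next
    case (some s)
    have "g (fst (\<sigma> (j, s))) \<noteq> g (mix n (\<lambda>i. h i = j) (fst (\<sigma> (j, s))) (snd (\<sigma> (j, s))))"
      using some(2) B[OF j some(1)] by (simp add: found_def)
    from junta_block_literal[OF g J inj _ _ this] \<sigma>[OF j some(1)]
    obtain i c where ic: "i \<in> J" "h i = j" "\<And>z. g (mix n (\<lambda>i. h i = j) (fst (\<sigma> (j, s))) z) = (z ! i \<noteq> c)"
      by (auto simp: mem_Times_iff)
    have "?\<phi> j (trial_points n (\<tau> (j, t)) ! k) = (trial_points n (\<tau> (j, t)) ! k ! i \<noteq> c)" if "t < T" "k < 7" for t k
      unfolding some(4) C[OF j some(1) that] ic(3) ..
    moreover have "?\<phi> j (\<rho> t) = (\<rho> t ! i \<noteq> c)" if "t < N" for t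
      unfolding some(4) D[OF j some(1) that] ic(3) ..
    ultimately show ?thesis using ic(1,2) by (intro exI[of _ i] exI[of _ c]) simp
  qed
  have "trial_ok n (?\<phi> j) (\<tau> (j, t))" if jt: "j < m" "t < T" for j t
  proof (cases "relevant n R h \<sigma> f j")
    case True
    from lit[OF jt(1) True] obtain i c where "i \<in> J"
      and eq: "\<forall>t<T. \<forall>k<7. ?\<phi> j (trial_points n (\<tau> (j, t)) ! k) = (trial_points n (\<tau> (j, t)) ! k ! i \<noteq> c)" by blast
    then have "trial_ok n (?\<phi> j) (\<tau> (j, t)) = trial_ok n (\<lambda>x. x ! i \<noteq> c) (\<tau> (j, t))"
      using jt(2) by (intro trial_ok_cong) simp
    moreover have "i < n" using \<open>i \<in> J\<close> J by auto
    ultimately show ?thesis using trial_ok_literal \<tau>[OF jt] by simp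
  next
    case False
    have "?\<phi> j z = False" for z
      by (cases n R h \<sigma> f j rule: reader_cases) (use False in auto)
    then show ?thesis by (simp add: trial_ok_def affine_ok_def split_ok_def case_prod_unfold)
  qed
  then have tp: "trials_pass n m T \<tau> ?\<phi>" by (auto simp: trials_pass_def)
  obtain \<zeta> where \<zeta>: "\<And>t. t < N \<Longrightarrow> f (\<rho> t) = f (mix n (\<lambda>i. \<not> (i \<in> J \<and> relevant n R h \<sigma> f (h i))) (\<rho> t) \<zeta>)"
    using F by blast
  define S where "S = {i\<in>J. relevant n R h \<sigma> f (h i)}"
  have "\<exists>c. \<forall>t<N. ?\<phi> (h i) (\<rho> t) = (\<rho> t ! i \<noteq> c)" if "i \<in> S" for i
  proof -
    have "i \<in> J" "relevant n R h \<sigma> f (h i)" using that by (auto simp: S_def)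
    moreover from this have "h i < m" using h J by auto
    ultimately obtain i' c where "i' \<in> J" "h i' = h i" "\<forall>t<N. ?\<phi> (h i) (\<rho> t) = (\<rho> t ! i' \<noteq> c)"
      using lit[of "h i"] by blast
    then show ?thesis using inj \<open>i \<in> J\<close> by (auto simp: inj_on_def)
  qed
  then obtain c where c: "\<And>i t. i \<in> S \<Longrightarrow> t < N \<Longrightarrow> ?\<phi> (h i) (\<rho> t) = (\<rho> t ! i \<noteq> c i)"
    by metis
  \<comment> \<open>Adding \<open>c i\<close> once more undoes the sign with which the reader of
    block \<open>h i\<close> returns coordinate \<open>i\<close>.\<close>
  define \<eta> where "\<eta> = (\<lambda>i b :: bool list. if i \<in> S then b ! h i \<noteq> c i else \<zeta> ! i)"
  have un: "unary_on m (\<eta> i)" if "i < n" for i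
  proof (cases "i \<in> S")
    case True
    have "\<forall>b\<in>cube m. \<eta> i b = (b ! h i \<noteq> c i)" using True by (simp add: \<eta>_def)
    then show ?thesis unfolding unary_on_def using h[OF that] by (intro disjI2 exI[of _ "h i"] exI[of _ "c i"] conjI)
  next
    case False
    have "\<forall>b\<in>cube m. \<eta> i b = \<zeta> ! i" using False by (simp add: \<eta>_def)
    then show ?thesis unfolding unary_on_def by (intro disjI1 exI)
  qed
  have "sample_consistent m N Cm \<rho> ?\<phi> f"
    unfolding sample_consistent_def
  proof (intro bexI allI impI)
    show "(\<lambda>b. f (subst_point n \<eta> b)) \<in> Cm" by (rule closed) (use un in blast)
    fix t assume t: "t < N"
    have "subst_point n \<eta> (subst_point m ?\<phi> (\<rho> t)) = mix n (\<lambda>i. \<not> (i \<in> J \<and> relevant n R h \<sigma> f (h i))) (\<rho> t) \<zeta>"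
    proof (rule cube_eqI[where n=n])
      fix i assume i: "i < n"
      show "subst_point n \<eta> (subst_point m ?\<phi> (\<rho> t)) ! i = mix n (\<lambda>i. \<not> (i \<in> J \<and> relevant n R h \<sigma> f (h i))) (\<rho> t) \<zeta> ! i"
      proof (cases "i \<in> S")
        case True
        then have "\<eta> i (subst_point m ?\<phi> (\<rho> t)) = (\<rho> t ! i)"
          using c[OF True t] h[OF i] by (simp add: \<eta>_def) argo
        then show ?thesis using i True by (simp add: S_def)
      next
        case False
        then show ?thesis using i by (auto simp: \<eta>_def S_def)
      qed
    qed auto
    then show "f (\<rho> t) = f (subst_point n \<eta> (subst_point m ?\<phi> (\<rho> t)))" using \<zeta>[OF t] by simp
  qed
  with tp show ?thesis by (simp add: accepts_def)
qed

section \<open>Uniformity of the readers' queries and re-randomization of blocks\<close>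

lemma prob_pair_swap:
  "measure_pmf.prob (pair_pmf p q) {w. P (fst w) (snd w)} = measure_pmf.prob (pair_pmf q p) {w. P (snd w) (fst w)}"
proof -
  have "map_pmf (\<lambda>w. (snd w, fst w)) (pair_pmf q p) = pair_pmf p q"
    using pair_commute_pmf[of p q] by (simp add: case_prod_unfold)
  from prob_map_eq[OF this, of "\<lambda>w. P (fst w) (snd w)"] show ?thesis by simp
qed

text \<open>A uniform witness outside the block and an independent uniform point inside it form a
  uniform query.\<close>

lemma prob_pair_map_mix:
  assumes "map_pmf F p = unif n" "map_pmf G q = unif n"
  shows "measure_pmf.prob (pair_pmf p q) {w. Q (mix n P (F (fst w)) (G (snd w)))} = measure_pmf.prob (unif n) {x. Q x}"
proof -
  have "map_pmf (\<lambda>w. mix n P (F (fst w)) (G (snd w))) (pair_pmf p q) =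
     map_pmf (\<lambda>v. mix n P (fst v) (snd v)) (map_pmf (\<lambda>(a, b). (F a, G b)) (pair_pmf p q))"
    by (simp add: map_pmf_comp case_prod_unfold)
  also have "\<dots> = unif n" unfolding map_pair assms by (rule map_mix)
  finally show ?thesis by (rule prob_map_eq)
qed

definition block_influence where
  "block_influence n h f j = measure_pmf.prob (pair_pmf (unif n) (unif n))
     {v. f (fst v) \<noteq> f (mix n (\<lambda>i. h i = j) (fst v) (snd v))}"

text \<open>Hybrid argument: the blocks are re-randomized one after the other, and each step costs
  at most \<tau>.\<close>

lemma prob_rerandomize_blocks:
  assumes "finite Q" "\<And>j. j \<in> Q \<Longrightarrow> block_influence n h f j \<le> \<tau>"
  shows "measure_pmf.prob (pair_pmf (unif n) (unif n))
     {v. f (fst v) \<noteq> f (mix n (\<lambda>i. h i \<in> Q) (fst v) (snd v))} \<le> real (card Q) * \<tau>"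
  using assms
proof (induction Q rule: finite_induct)
  case empty
  have "mix n (\<lambda>i. False) x z = x" if "x \<in> cube n" for x z
    by (rule cube_eqI[where n=n]) (use that in auto)
  then have "measure_pmf.prob (pair_pmf (unif n) (unif n)) {v. f (fst v) \<noteq> f (mix n (\<lambda>i. h i \<in> {}) (fst v) (snd v))}
     \<le> measure_pmf.prob (pair_pmf (unif n) (unif n)) {}"
    by (intro prob_mono) auto
  then show ?case by simp
next
  case (insert j Q)
  let ?U = "pair_pmf (unif n) (unif n)"
  let ?q = "\<lambda>v. mix n (\<lambda>i. h i \<in> Q) (fst v) (snd v)" and ?q' = "\<lambda>v. mix n (\<lambda>i. h i \<in> Q) (snd v) (fst v)"
  have IH: "measure_pmf.prob ?U {v. f (fst v) \<noteq> f (?q v)} \<le> real (card Q) * \<tau>"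
    using insert by auto
  \<comment> \<open>The hybrid \<open>?q\<close> and its complementary mixture \<open>?q'\<close>
    are again an independent uniform pair, and \<open>?q'\<close> still holds the fresh values of
    block \<open>j\<close>.\<close>
  have "measure_pmf.prob ?U {v. f (?q v) \<noteq> f (mix n (\<lambda>i. h i = j) (?q v) (?q' v))} = block_influence n h f j"
    unfolding block_influence_def
    using prob_map_eq[OF map_mix_pair[of n "\<lambda>i. h i \<in> Q"], of "\<lambda>v. f (fst v) \<noteq> f (mix n (\<lambda>i. h i = j) (fst v) (snd v))"]
    by simp
  then have 2: "measure_pmf.prob ?U {v. f (?q v) \<noteq> f (mix n (\<lambda>i. h i = j) (?q v) (?q' v))} \<le> \<tau>"
    using insert.prems[of j] by simp
  have "mix n (\<lambda>i. h i = j) (?q v) (?q' v) = mix n (\<lambda>i. h i \<in> insert j Q) (fst v) (snd v)" for v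
    by (rule cube_eqI[where n=n]) (use insert.hyps in auto)
  then have "measure_pmf.prob ?U {v. f (fst v) \<noteq> f (mix n (\<lambda>i. h i \<in> insert j Q) (fst v) (snd v))} \<le> real (card Q) * \<tau> + \<tau>"
    by (intro prob_Un_le[OF _ IH 2]) auto
  then show ?case using insert.hyps by (simp add: algebra_simps)
qed

text \<open>Re-randomizing the undetected blocks rarely changes \<open>f\<close>. Re-randomizing
  everything except the detected variables of \<open>J\<close> gives a point with the same
  \<open>J\<close>-coordinates, so \<open>g\<close> sees no difference and \<open>f\<close> pays
  \<open>2 * \<delta>\<close>. Averaging then freezes the fresh values to a single \<zeta>.\<close>

lemma exists_fixing:
  assumes g: "junta_on n J g" and J: "J \<subseteq> {..<n}"
    and \<delta>: "measure_pmf.prob (unif n) {x. f x \<noteq> g x} \<le> \<delta>"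
    and h: "\<And>i. i < n \<Longrightarrow> h i < m"
    and small: "\<And>j. j < m \<Longrightarrow> \<not> rel j \<Longrightarrow> block_influence n h f j \<le> \<tau>" and \<tau>: "0 \<le> \<tau>"
  shows "\<exists>\<zeta>\<in>cube n. measure_pmf.prob (unif n) {x. f x \<noteq> f (mix n (\<lambda>i. \<not> (i \<in> J \<and> rel (h i))) x \<zeta>)} \<le> real m * \<tau> + 2 * \<delta>"
proof -
  let ?U = "pair_pmf (unif n) (unif n)"
  let ?P = "\<lambda>i. \<not> (i \<in> J \<and> rel (h i))"
  define Q where "Q = {j. j < m \<and> \<not> rel j}"
  have Q: "finite Q" "card Q \<le> m" using card_mono[of "{..<m}" Q] by (auto simp: Q_def)
  let ?q = "\<lambda>v. mix n (\<lambda>i. h i \<in> Q) (fst v) (snd v)" and ?p = "\<lambda>v. mix n ?P (fst v) (snd v)"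
  have "measure_pmf.prob ?U {v. f (fst v) \<noteq> f (?q v)} \<le> real (card Q) * \<tau>"
    by (rule prob_rerandomize_blocks[OF Q(1)]) (use small in \<open>auto simp: Q_def\<close>)
  also have "\<dots> \<le> real m * \<tau>" using Q(2) \<tau> by (intro mult_right_mono) auto
  finally have 1: "measure_pmf.prob ?U {v. f (fst v) \<noteq> f (?q v)} \<le> real m * \<tau>" .
  have 2: "measure_pmf.prob ?U {v. f (mix n P (fst v) (snd v)) \<noteq> g (mix n P (fst v) (snd v))} \<le> \<delta>" for P
    using \<delta> by (subst prob_mix[of n "\<lambda>x. f x \<noteq> g x" P])
  have "measure_pmf.prob ?U {v. f (fst v) \<noteq> f (?p v)} \<le> real m * \<tau> + (\<delta> + \<delta>)"
  proof (rule prob_Un_le[OF _ 1 prob_Un_le[OF _ 2[of "\<lambda>i. h i \<in> Q"] 2[of ?P]]])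
    fix v assume "f (fst v) \<noteq> f (?p v)"
    moreover have "g (?q v) = g (?p v)"
    proof -
      have "?q v ! i = ?p v ! i" if "i \<in> J" for i
      proof -
        have "i < n" using that J by auto
        then show ?thesis using that h[of i] by (auto simp: Q_def)
      qed
      then show ?thesis using g unfolding junta_on_def by (meson mix_in_cube)
    qed
    ultimately show "f (fst v) \<noteq> f (?q v) \<or> (f (?q v) \<noteq> g (?q v) \<or> f (?p v) \<noteq> g (?p v))" by argo
  qed auto
  then have "measure_pmf.prob ?U {v. f (snd v) \<noteq> f (mix n ?P (snd v) (fst v))} \<le> real m * \<tau> + 2 * \<delta>"
    using prob_pair_swap[of "unif n" "unif n" "\<lambda>x z. f x \<noteq> f (mix n ?P x z)"] by simp
  from prob_pair_le_imp_ex[OF _ this] show ?thesis by simp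
qed

text \<open>The summands of \<open>total\<close> are, in this order, the failures \<open>bA\<close>
  to \<open>bE\<close> and the failure of \<open>fixable\<close>.\<close>

theorem completeness:
  assumes f: "f \<in> Cn"
    and closed: "\<And>\<eta>. \<forall>i<n. unary_on m (\<eta> i) \<Longrightarrow> (\<lambda>b. f (subst_point n \<eta> b)) \<in> Cm"
    and g: "junta_on n J g" and J: "J \<subseteq> {..<n}" and m: "m > 0"
    and \<delta>: "measure_pmf.prob (unif n) {x. f x \<noteq> g x} \<le> \<delta>"
    and \<tau>: "0 \<le> \<tau>" "\<tau> \<le> 1"
    and total: "real (card J * card J) * (1 / real m) + real (m * R) * (2 * \<delta>) + real (m * R * T * 7) * \<delta> + real (m * R * N) * \<delta>
        + real m * (1 - \<tau>) ^ R + real N * (real m * \<tau> + 2 * \<delta>) \<le> 1 / 3"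
  shows "measure_pmf.prob (seed_pmf n m R T N) {\<omega>. \<not> accepts n m R T N Cm \<omega> f} \<le> 1 / 3"
proof -
  let ?D = "\<lambda>x. f x \<noteq> g x"
  let ?S = "seed_pmf n m R T N"
  let ?B = "\<lambda>(h :: nat \<Rightarrow> nat) j i. h i = j"
  have finJ: "finite J" using J finite_subset by blast
  have hm: "h i < m" if "h \<in> set_pmf (hash_pmf n m)" "i < n" for h i
    using that m unfolding hash_pmf_def by (auto simp: set_Pi_pmf PiE_dflt_def set_pmf_of_set lessThan_empty_iff)
  have \<sigma>: "map_pmf (\<lambda>\<sigma>. \<sigma> p) (probe_pmf n m R) = pair_pmf (unif n) (unif n)" if "p \<in> {..<m} \<times> {..<R}" for p
    unfolding probe_pmf_def using that by (subst Pi_pmf_component) auto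
  have \<sigma>1: "map_pmf (\<lambda>\<sigma>. fst (\<sigma> p)) (probe_pmf n m R) = unif n" if "p \<in> {..<m} \<times> {..<R}" for p
  proof -
    have "map_pmf (\<lambda>\<sigma>. fst (\<sigma> p)) (probe_pmf n m R) = map_pmf fst (map_pmf (\<lambda>\<sigma>. \<sigma> p) (probe_pmf n m R))"
      by (simp only: map_pmf_comp)
    then show ?thesis by (simp only: \<sigma>[OF that] map_fst_pair_pmf)
  qed
  have \<tau>c: "map_pmf (\<lambda>\<tau>. trial_points n (\<tau> p) ! k) (trial_pmf n m T) = unif n" if "p \<in> {..<m} \<times> {..<T}" "k < 7" for p k
  proof -
    have "map_pmf (\<lambda>\<tau>. trial_points n (\<tau> p) ! k) (trial_pmf n m T) =
       map_pmf (\<lambda>w. trial_points n w ! k) (map_pmf (\<lambda>\<tau>. \<tau> p) (trial_pmf n m T))"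
      by (simp only: map_pmf_comp)
    also have "map_pmf (\<lambda>\<tau>. \<tau> p) (trial_pmf n m T) = unif6 n"
      unfolding trial_pmf_def using that by (subst Pi_pmf_component) auto
    finally show ?thesis by (simp only: map_trial_points[OF that(2)])
  qed
  have \<rho>c: "map_pmf (\<lambda>\<rho>. \<rho> t) (sample_pmf n N) = unif n" if "t < N" for t
    unfolding sample_pmf_def using that by (subst Pi_pmf_component) auto

  \<comment> \<open>Two variables of the junta fall into the same block.\<close>
  define bA where "bA = (\<lambda>h :: nat \<Rightarrow> nat. \<exists>p\<in>J \<times> J. fst p \<noteq> snd p \<and> h (fst p) = h (snd p))"
  have A: "measure_pmf.prob (hash_pmf n m) {h. bA h} \<le> real (card (J \<times> J)) * (1 / real m)"
  proof (rule prob_UN_le[where P="\<lambda>p h. fst p \<noteq> snd p \<and> h (fst p) = h (snd p)"])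
    fix p assume p: "p \<in> J \<times> J"
    show "measure_pmf.prob (hash_pmf n m) {h. fst p \<noteq> snd p \<and> h (fst p) = h (snd p)} \<le> 1 / real m"
    proof (cases "fst p = snd p")
      case False
      have "measure_pmf.prob (hash_pmf n m) {h. fst p \<noteq> snd p \<and> h (fst p) = h (snd p)} =
         measure_pmf.prob (hash_pmf n m) {h. (\<lambda>w. fst w = snd w) (h (fst p), h (snd p))}" using False by simp
      also have "\<dots> = measure_pmf.prob (pair_pmf (pmf_of_set {..<m}) (pmf_of_set {..<m})) {w. fst w = snd w}"
        unfolding hash_pmf_def
        by (rule prob_map_eq, rule map_Pi_two_components) (use p J False in auto)
      also have "\<dots> \<le> 1 / real m"
      proof (rule prob_pair_le[where P="\<lambda>a b. a = b"])
        fix a :: nat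
        have "{b. a = b} = {a}" by auto
        moreover have "card ({..<m} \<inter> {a}) \<le> 1" using card_mono[of "{a}" "{..<m} \<inter> {a}"] by simp
        ultimately show "measure_pmf.prob (pmf_of_set {..<m}) {b. a = b} \<le> 1 / real m"
          using m by (subst measure_pmf_of_set) (auto simp: lessThan_empty_iff divide_right_mono)
      qed
      finally show ?thesis .
    qed simp
  qed (use finJ in \<open>auto simp: bA_def\<close>)

  \<comment> \<open>The junta is wrong at an end of some probe.\<close>
  define bB where "bB = (\<lambda>h (\<sigma> :: nat \<times> nat \<Rightarrow> bool list \<times> bool list). \<exists>p\<in>{..<m} \<times> {..<R}.
     ?D (fst (\<sigma> p)) \<or> ?D (mix n (?B h (fst p)) (fst (\<sigma> p)) (snd (\<sigma> p))))"
  have B: "measure_pmf.prob (probe_pmf n m R) {\<sigma>. bB h \<sigma>} \<le> real (card ({..<m} \<times> {..<R})) * (2 * \<delta>)" for h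
  proof (rule prob_UN_le[where P="\<lambda>p \<sigma>. ?D (fst (\<sigma> p)) \<or> ?D (mix n (?B h (fst p)) (fst (\<sigma> p)) (snd (\<sigma> p)))"])
    fix p assume p: "p \<in> {..<m} \<times> {..<R}"
    have b1: "measure_pmf.prob (probe_pmf n m R) {\<sigma>. ?D (fst (\<sigma> p))} \<le> \<delta>"
      using prob_map_eq[OF \<sigma>1[OF p], of ?D] \<delta> by simp
    have b2: "measure_pmf.prob (probe_pmf n m R) {\<sigma>. ?D (mix n (?B h (fst p)) (fst (\<sigma> p)) (snd (\<sigma> p)))} \<le> \<delta>"
      using prob_map_eq[OF \<sigma>[OF p], of "\<lambda>v. ?D (mix n (?B h (fst p)) (fst v) (snd v))"]
        prob_mix[of n ?D "?B h (fst p)"] \<delta> by simp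
    have "measure_pmf.prob (probe_pmf n m R) {\<sigma>. ?D (fst (\<sigma> p)) \<or> ?D (mix n (?B h (fst p)) (fst (\<sigma> p)) (snd (\<sigma> p)))} \<le> \<delta> + \<delta>"
      by (rule prob_Un_le[OF _ b1 b2]) auto
    then show "measure_pmf.prob (probe_pmf n m R) {\<sigma>. ?D (fst (\<sigma> p)) \<or> ?D (mix n (?B h (fst p)) (fst (\<sigma> p)) (snd (\<sigma> p)))} \<le> 2 * \<delta>"
      by simp
  qed (auto simp: bB_def)

  \<comment> \<open>The junta is wrong at a trial query of some potential reader, one for each
    probe.\<close>
  define bC where "bC = (\<lambda>h (\<sigma> :: nat \<times> nat \<Rightarrow> bool list \<times> bool list) \<tau>. \<exists>p\<in>({..<m} \<times> {..<R}) \<times> ({..<T} \<times> {..<7}).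
     ?D (mix n (?B h (fst (fst p))) (fst (\<sigma> (fst p))) (trial_points n (\<tau> (fst (fst p), fst (snd p))) ! snd (snd p))))"
  have C: "measure_pmf.prob (pair_pmf (probe_pmf n m R) (trial_pmf n m T)) {w. bC h (fst w) (snd w)}
     \<le> real (card (({..<m} \<times> {..<R}) \<times> ({..<T} \<times> {..<7 :: nat}))) * \<delta>" for h
  proof (rule prob_UN_le[where P="\<lambda>p w. ?D (mix n (?B h (fst (fst p))) (fst (fst w (fst p)))
        (trial_points n (snd w (fst (fst p), fst (snd p))) ! snd (snd p)))"])
    fix p assume p: "p \<in> ({..<m} \<times> {..<R}) \<times> ({..<T} \<times> {..<7 :: nat})"
    have "measure_pmf.prob (pair_pmf (probe_pmf n m R) (trial_pmf n m T)) {w. ?D (mix n (?B h (fst (fst p))) (fst (fst w (fst p)))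
        (trial_points n (snd w (fst (fst p), fst (snd p))) ! snd (snd p)))} = measure_pmf.prob (unif n) {x. ?D x}"
      by (rule prob_pair_map_mix[OF \<sigma>1 \<tau>c]) (use p in auto)
    then show "measure_pmf.prob (pair_pmf (probe_pmf n m R) (trial_pmf n m T)) {w. ?D (mix n (?B h (fst (fst p))) (fst (fst w (fst p)))
        (trial_points n (snd w (fst (fst p), fst (snd p))) ! snd (snd p)))} \<le> \<delta>" using \<delta> by simp
  qed (auto simp: bC_def)

  \<comment> \<open>The junta is wrong where a potential reader is evaluated on a sample.\<close>
  define bD where "bD = (\<lambda>h (\<sigma> :: nat \<times> nat \<Rightarrow> bool list \<times> bool list) \<rho>. \<exists>p\<in>({..<m} \<times> {..<R}) \<times> {..<N}.
     ?D (mix n (?B h (fst (fst p))) (fst (\<sigma> (fst p))) (\<rho> (snd p))))"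
  have D: "measure_pmf.prob (pair_pmf (probe_pmf n m R) (sample_pmf n N)) {w. bD h (fst w) (snd w)}
     \<le> real (card (({..<m} \<times> {..<R}) \<times> {..<N})) * \<delta>" for h
  proof (rule prob_UN_le[where P="\<lambda>p w. ?D (mix n (?B h (fst (fst p))) (fst (fst w (fst p))) (snd w (snd p)))"])
    fix p assume p: "p \<in> ({..<m} \<times> {..<R}) \<times> {..<N}"
    have "measure_pmf.prob (pair_pmf (probe_pmf n m R) (sample_pmf n N)) {w. ?D (mix n (?B h (fst (fst p))) (fst (fst w (fst p)))
        (snd w (snd p)))} = measure_pmf.prob (unif n) {x. ?D x}"
      by (rule prob_pair_map_mix[OF \<sigma>1 \<rho>c]) (use p in auto)
    then show "measure_pmf.prob (pair_pmf (probe_pmf n m R) (sample_pmf n N)) {w. ?D (mix n (?B h (fst (fst p))) (fst (fst w (fst p)))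
        (snd w (snd p)))} \<le> \<delta>" using \<delta> by simp
  qed (auto simp: bD_def)

  \<comment> \<open>All probes of some influential block fail to show its influence.\<close>
  define bE where "bE = (\<lambda>h \<sigma>. \<exists>j\<in>{..<m}. block_influence n h f j > \<tau> \<and> \<not> relevant n R h \<sigma> f j)"
  have E: "measure_pmf.prob (probe_pmf n m R) {\<sigma>. bE h \<sigma>} \<le> real (card {..<m}) * (1 - \<tau>) ^ R" for h
  proof (rule prob_UN_le[where P="\<lambda>j \<sigma>. block_influence n h f j > \<tau> \<and> \<not> relevant n R h \<sigma> f j"])
    fix j assume j: "j \<in> {..<m}"
    show "measure_pmf.prob (probe_pmf n m R) {\<sigma>. block_influence n h f j > \<tau> \<and> \<not> relevant n R h \<sigma> f j} \<le> (1 - \<tau>) ^ R"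
    proof (cases "block_influence n h f j > \<tau>")
      case False
      then show ?thesis using \<tau> by simp
    next
      case True
      have one: "measure_pmf.prob (pair_pmf (unif n) (unif n)) {v. f (fst v) = f (mix n (?B h j) (fst v) (snd v))} \<le> 1 - \<tau>"
        using True prob_compl[of "pair_pmf (unif n) (unif n)" "\<lambda>v. f (fst v) = f (mix n (?B h j) (fst v) (snd v))"]
        unfolding block_influence_def by linarith
      have "measure_pmf.prob (probe_pmf n m R) {\<sigma>. block_influence n h f j > \<tau> \<and> \<not> relevant n R h \<sigma> f j}
         \<le> measure_pmf.prob (probe_pmf n m R) {\<sigma>. \<forall>p\<in>{j} \<times> {..<R}. f (fst (\<sigma> p)) = f (mix n (?B h j) (fst (\<sigma> p)) (snd (\<sigma> p)))}"
        by (intro prob_mono) (auto simp: relevant_def found_def)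
      also have "\<dots> \<le> (1 - \<tau>) ^ card ({j} \<times> {..<R})"
        unfolding probe_pmf_def
        by (rule prob_Pi_all_sub[where P="\<lambda>p v. f (fst v) = f (mix n (?B h j) (fst v) (snd v))"]) (use j one in auto)
      finally show ?thesis by (simp add: card_cartesian_product)
    qed
  qed (auto simp: bE_def)

  define fixable where "fixable = (\<lambda>h \<sigma> \<rho>. \<exists>\<zeta>. \<forall>t<N. f (\<rho> t) = f (mix n (\<lambda>i. \<not> (i \<in> J \<and> relevant n R h \<sigma> f (h i))) (\<rho> t) \<zeta>))"
  \<comment> \<open>The constants \<zeta> are chosen from \<open>h\<close> and \<sigma> alone,
    before the samples, which are therefore still uniform. The conjunct excluding \<open>bE\<close>
    makes the bound valid for every \<sigma>.\<close>
  have F: "measure_pmf.prob (sample_pmf n N) {\<rho>. \<not> bE h \<sigma> \<and> \<not> fixable h \<sigma> \<rho>} \<le> real N * (real m * \<tau> + 2 * \<delta>)"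
    if h: "h \<in> set_pmf (hash_pmf n m)" for h \<sigma>
  proof (cases "bE h \<sigma>")
    case True
    have "0 \<le> \<delta>" using \<delta> measure_nonneg order_trans by blast
    then show ?thesis using True \<tau> by simp
  next
    case False
    have "\<exists>\<zeta>\<in>cube n. measure_pmf.prob (unif n) {x. f x \<noteq> f (mix n (\<lambda>i. \<not> (i \<in> J \<and> relevant n R h \<sigma> f (h i))) x \<zeta>)} \<le> real m * \<tau> + 2 * \<delta>"
      by (rule exists_fixing[OF g J \<delta> hm[OF h] _ \<tau>(1)]) (use False in \<open>auto simp: bE_def not_less\<close>)
    then obtain \<zeta> where \<zeta>: "measure_pmf.prob (unif n) {x. f x \<noteq> f (mix n (\<lambda>i. \<not> (i \<in> J \<and> relevant n R h \<sigma> f (h i))) x \<zeta>)} \<le> real m * \<tau> + 2 * \<delta>"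
      by blast
    have "measure_pmf.prob (sample_pmf n N) {\<rho>. \<not> bE h \<sigma> \<and> \<not> fixable h \<sigma> \<rho>} \<le> real (card {..<N}) * (real m * \<tau> + 2 * \<delta>)"
    proof (rule prob_UN_le[where P="\<lambda>t \<rho>. f (\<rho> t) \<noteq> f (mix n (\<lambda>i. \<not> (i \<in> J \<and> relevant n R h \<sigma> f (h i))) (\<rho> t) \<zeta>)"])
      fix t assume "t \<in> {..<N}"
      then show "measure_pmf.prob (sample_pmf n N) {\<rho>. f (\<rho> t) \<noteq> f (mix n (\<lambda>i. \<not> (i \<in> J \<and> relevant n R h \<sigma> f (h i))) (\<rho> t) \<zeta>)} \<le> real m * \<tau> + 2 * \<delta>"
        using prob_map_eq[OF \<rho>c, of t "\<lambda>x. f x \<noteq> f (mix n (\<lambda>i. \<not> (i \<in> J \<and> relevant n R h \<sigma> f (h i))) x \<zeta>)"] \<zeta> by simp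
    qed (auto simp: fixable_def)
    then show ?thesis by simp
  qed

  let ?H = "hash_pmf n m" and ?P = "probe_pmf n m R" and ?T = "trial_pmf n m T" and ?N = "sample_pmf n N"
  have A': "measure_pmf.prob ?S {w. bA (fst w)} \<le> real (card (J \<times> J)) * (1 / real m)"
    unfolding seed_pmf_def prob_fst_pair by (rule A)
  have B': "measure_pmf.prob ?S {w. bB (fst w) (fst (snd w))} \<le> real (card ({..<m} \<times> {..<R})) * (2 * \<delta>)"
    unfolding seed_pmf_def
  proof (rule prob_pair_le[where P="\<lambda>h w. bB h (fst w)"])
    fix h show "measure_pmf.prob (pair_pmf ?P (pair_pmf ?T ?N)) {w. bB h (fst w)} \<le> real (card ({..<m} \<times> {..<R})) * (2 * \<delta>)"
      unfolding prob_fst_pair by (rule B)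
  qed
  have E': "measure_pmf.prob ?S {w. bE (fst w) (fst (snd w))} \<le> real (card {..<m}) * (1 - \<tau>) ^ R"
    unfolding seed_pmf_def
  proof (rule prob_pair_le[where P="\<lambda>h w. bE h (fst w)"])
    fix h show "measure_pmf.prob (pair_pmf ?P (pair_pmf ?T ?N)) {w. bE h (fst w)} \<le> real (card {..<m}) * (1 - \<tau>) ^ R"
      unfolding prob_fst_pair by (rule E)
  qed
  have C': "measure_pmf.prob ?S {w. bC (fst w) (fst (snd w)) (fst (snd (snd w)))}
     \<le> real (card (({..<m} \<times> {..<R}) \<times> ({..<T} \<times> {..<7 :: nat}))) * \<delta>"
    unfolding seed_pmf_def
  proof (rule prob_pair_le[where P="\<lambda>h w. bC h (fst w) (fst (snd w))"])
    fix h
    have "map_pmf (\<lambda>w. (fst w, fst (snd w))) (pair_pmf ?P (pair_pmf ?T ?N)) = pair_pmf ?P ?T"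
      using map_pair[of "\<lambda>x. x" fst ?P "pair_pmf ?T ?N"] by (simp add: case_prod_unfold map_fst_pair_pmf)
    from prob_map_eq[OF this, of "\<lambda>w. bC h (fst w) (snd w)"] C[of h]
    show "measure_pmf.prob (pair_pmf ?P (pair_pmf ?T ?N)) {w. bC h (fst w) (fst (snd w))}
      \<le> real (card (({..<m} \<times> {..<R}) \<times> ({..<T} \<times> {..<7 :: nat}))) * \<delta>" by simp
  qed
  have D': "measure_pmf.prob ?S {w. bD (fst w) (fst (snd w)) (snd (snd (snd w)))}
     \<le> real (card (({..<m} \<times> {..<R}) \<times> {..<N})) * \<delta>"
    unfolding seed_pmf_def
  proof (rule prob_pair_le[where P="\<lambda>h w. bD h (fst w) (snd (snd w))"])
    fix h
    have "map_pmf (\<lambda>w. (fst w, snd (snd w))) (pair_pmf ?P (pair_pmf ?T ?N)) = pair_pmf ?P ?N"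
      using map_pair[of "\<lambda>x. x" snd ?P "pair_pmf ?T ?N"] by (simp add: case_prod_unfold map_snd_pair_pmf)
    from prob_map_eq[OF this, of "\<lambda>w. bD h (fst w) (snd w)"] D[of h]
    show "measure_pmf.prob (pair_pmf ?P (pair_pmf ?T ?N)) {w. bD h (fst w) (snd (snd w))}
      \<le> real (card (({..<m} \<times> {..<R}) \<times> {..<N})) * \<delta>" by simp
  qed
  have F': "measure_pmf.prob ?S {w. \<not> bE (fst w) (fst (snd w)) \<and> \<not> fixable (fst w) (fst (snd w)) (snd (snd (snd w)))}
     \<le> real N * (real m * \<tau> + 2 * \<delta>)"
    unfolding seed_pmf_def
  proof (rule prob_pair_le[where P="\<lambda>h w. \<not> bE h (fst w) \<and> \<not> fixable h (fst w) (snd (snd w))"])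
    fix h assume h: "h \<in> set_pmf ?H"
    show "measure_pmf.prob (pair_pmf ?P (pair_pmf ?T ?N)) {w. \<not> bE h (fst w) \<and> \<not> fixable h (fst w) (snd (snd w))}
      \<le> real N * (real m * \<tau> + 2 * \<delta>)"
    proof (rule prob_pair_le[where P="\<lambda>\<sigma> w. \<not> bE h \<sigma> \<and> \<not> fixable h \<sigma> (snd w)"])
      fix \<sigma>
      show "measure_pmf.prob (pair_pmf ?T ?N) {w. \<not> bE h \<sigma> \<and> \<not> fixable h \<sigma> (snd w)} \<le> real N * (real m * \<tau> + 2 * \<delta>)"
        using F[OF h, of \<sigma>] unfolding prob_snd_pair[of ?T ?N "\<lambda>\<rho>. \<not> bE h \<sigma> \<and> \<not> fixable h \<sigma> \<rho>"] .
    qed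
  qed
  have "measure_pmf.prob ?S {w. \<not> accepts n m R T N Cm w f} \<le>
     real (card (J \<times> J)) * (1 / real m) + (real (card ({..<m} \<times> {..<R})) * (2 * \<delta>) +
      (real (card (({..<m} \<times> {..<R}) \<times> ({..<T} \<times> {..<7 :: nat}))) * \<delta> +
      (real (card (({..<m} \<times> {..<R}) \<times> {..<N})) * \<delta> + (real (card {..<m}) * (1 - \<tau>) ^ R + real N * (real m * \<tau> + 2 * \<delta>)))))"
  proof (rule prob_Un_le[OF _ A' prob_Un_le[OF _ B' prob_Un_le[OF _ C' prob_Un_le[OF _ D' prob_Un_le[OF _ E' F']]]]])
    fix w assume w: "w \<in> set_pmf ?S" and rej: "\<not> accepts n m R T N Cm w f"
    obtain h \<sigma> \<tau>' \<rho> where weq: "w = (h, \<sigma>, \<tau>', \<rho>)" by (metis surj_pair)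
    have sets: "h \<in> set_pmf ?H" "\<sigma> \<in> set_pmf ?P" "\<tau>' \<in> set_pmf ?T" "\<rho> \<in> set_pmf ?N"
      using w by (auto simp: weq seed_pmf_def)
    have s\<sigma>: "\<sigma> (j, s) \<in> cube n \<times> cube n" if "j < m" "s < R" for j s
      using sets(2) that unfolding probe_pmf_def by (auto simp: set_Pi_pmf PiE_dflt_def)
    have s\<tau>: "\<tau>' (j, t) \<in> set_pmf (unif6 n)" if "j < m" "t < T" for j t
      using sets(3) that unfolding trial_pmf_def by (auto simp: set_Pi_pmf PiE_dflt_def)
    have s\<rho>: "\<rho> t \<in> cube n" if "t < N" for t
      using sets(4) that unfolding sample_pmf_def by (auto simp: set_Pi_pmf PiE_dflt_def)
    have "bA h \<or> bB h \<sigma> \<or> bC h \<sigma> \<tau>' \<or> bD h \<sigma> \<rho> \<or> \<not> fixable h \<sigma> \<rho>"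
    proof (rule ccontr)
      assume neg: "\<not> ?thesis"
      have "accepts n m R T N Cm (h, \<sigma>, \<tau>', \<rho>) f"
      proof (rule accepts_good_seed[where f=f and Cn=Cn and g=g and J=J and h=h and \<sigma>=\<sigma> and \<tau>=\<tau>' and \<rho>=\<rho>])
        show "f \<in> Cn" "junta_on n J g" "J \<subseteq> {..<n}" by fact+
        show "(\<lambda>b. f (subst_point n \<eta> b)) \<in> Cm" if "\<forall>i<n. unary_on m (\<eta> i)" for \<eta> by (rule closed[OF that])
        show "h i < m" if "i < n" for i by (rule hm[OF sets(1) that])
        show "\<sigma> (j, s) \<in> cube n \<times> cube n" if "j < m" "s < R" for j s by (rule s\<sigma>[OF that])
        show "\<tau>' (j, t) \<in> set_pmf (unif6 n)" if "j < m" "t < T" for j t by (rule s\<tau>[OF that])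
        show "\<rho> t \<in> cube n" if "t < N" for t by (rule s\<rho>[OF that])
        show "inj_on h J" using neg by (auto simp: bA_def inj_on_def)
        show "f (fst (\<sigma> (j, s))) = g (fst (\<sigma> (j, s))) \<and>
          f (mix n (\<lambda>i. h i = j) (fst (\<sigma> (j, s))) (snd (\<sigma> (j, s)))) = g (mix n (\<lambda>i. h i = j) (fst (\<sigma> (j, s))) (snd (\<sigma> (j, s))))"
          if "j < m" "s < R" for j s using neg that unfolding bB_def by fastforce
        show "f (mix n (\<lambda>i. h i = j) (fst (\<sigma> (j, s))) (trial_points n (\<tau>' (j, t)) ! k)) =
          g (mix n (\<lambda>i. h i = j) (fst (\<sigma> (j, s))) (trial_points n (\<tau>' (j, t)) ! k))"
          if "j < m" "s < R" "t < T" "k < 7" for j s t k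
          using neg that unfolding bC_def by (auto dest!: bspec[of _ _ "((j, s), (t, k))"])
        show "f (mix n (\<lambda>i. h i = j) (fst (\<sigma> (j, s))) (\<rho> t)) = g (mix n (\<lambda>i. h i = j) (fst (\<sigma> (j, s))) (\<rho> t))"
          if "j < m" "s < R" "t < N" for j s t
          using neg that unfolding bD_def by (auto dest!: bspec[of _ _ "((j, s), t)"])
        show "\<exists>\<zeta>. \<forall>t<N. f (\<rho> t) = f (mix n (\<lambda>i. \<not> (i \<in> J \<and> relevant n R h \<sigma> f (h i))) (\<rho> t) \<zeta>)"
          using neg unfolding fixable_def by blast
      qed
      then show False using rej weq by simp
    qed
    then show "bA (fst w) \<or> bB (fst w) (fst (snd w)) \<or> bC (fst w) (fst (snd w)) (fst (snd (snd w))) \<or>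
      bD (fst w) (fst (snd w)) (snd (snd (snd w))) \<or> bE (fst w) (fst (snd w)) \<or>
      (\<not> bE (fst w) (fst (snd w)) \<and> \<not> fixable (fst w) (fst (snd w)) (snd (snd (snd w))))"
      unfolding weq by auto
  qed auto
  also have "\<dots> = real (card J * card J) * (1 / real m) + real (m * R) * (2 * \<delta>) + real (m * R * T * 7) * \<delta> + real (m * R * N) * \<delta>
        + real m * (1 - \<tau>) ^ R + real N * (real m * \<tau> + 2 * \<delta>)"
    by (simp add: card_cartesian_product)
  also note total
  finally show ?thesis .
qed

subsection \<open>Choice of parameters\<close>

definition junta_size :: "nat \<Rightarrow> nat \<Rightarrow> nat" where
  "junta_size r M = r * ((1 + M) * (1 + 2 * r * M) ^ r)"

text \<open>Twenty times the squared junta size bounds the collision probability by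
  \<open>1 / 20\<close>; the added 1 keeps the number of blocks positive when \<open>r\<close> is
  0.\<close>

definition num_blocks :: "nat \<Rightarrow> nat \<Rightarrow> nat" where
  "num_blocks r M = 20 * (junta_size r M)\<^sup>2 + 1"

text \<open>Samples per unit of \<open>1 / \<epsilon>\<close>. The entropy bound pays for the union
  over all hypotheses, and the 4 leaves \<open>exp (- 4)\<close>.\<close>

definition sample_rate :: "nat \<Rightarrow> nat \<Rightarrow> nat" where
  "sample_rate r M = entropy_bound r (num_blocks r M) + 4"

text \<open>Multiply by \<open>(1 + \<beta>) ^ T\<close>: the product is at most 1, and Bernoulli's
  inequality bounds that factor from below.\<close>

lemma power_one_minus_le:
  assumes "0 \<le> \<beta>" "\<beta> \<le> (1 :: real)"
  shows "(1 - \<beta>) ^ T \<le> 1 / (1 + real T * \<beta>)"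
proof -
  have "(1 - \<beta>) ^ T * (1 + real T * \<beta>) \<le> (1 - \<beta>) ^ T * (1 + \<beta>) ^ T"
    using assms by (intro mult_left_mono Bernoulli_inequality) auto
  also have "\<dots> = (1 - \<beta>\<^sup>2) ^ T" by (simp add: power_mult_distrib[symmetric] power2_eq_square algebra_simps)
  also have "\<dots> \<le> 1" using assms by (intro power_le_one) (auto simp: power_le_one)
  finally show ?thesis using assms by (simp add: pos_le_divide_eq add_pos_nonneg)
qed

lemma tester_exists:
  fixes C :: "nat \<Rightarrow> (bool list \<Rightarrow> bool) set"
  assumes closed: "\<And>m n G \<psi>. G \<in> C m \<Longrightarrow> \<forall>j<m. unary_on n (\<psi> j) \<Longrightarrow> (\<lambda>x. G (subst_point m \<psi> x)) \<in> C n"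
    and sub: "\<And>n. C n \<subseteq> r_decision_list r n"
    and M: "M > 0" and \<epsilon>: "\<epsilon> > 0" and E: "real E \<ge> 1 / \<epsilon>"
    and small: "(1 - 1 / 2 ^ r) ^ M * real ((1 + 2 * r * M) ^ r) *
       real (20000000 * (sample_rate r M)\<^sup>2 * (num_blocks r M) ^ 4 * E\<^sup>2) \<le> 1"
  shows "\<exists>A. query_algorithm n (10000 * sample_rate r M * num_blocks r M ^ 3 * E) A \<and> two_sided_tester n \<epsilon> (C n) A"
proof -
  define m where "m = num_blocks r M"
  define \<nu> where "\<nu> = sample_rate r M"
  define N where "N = \<nu> * E"
  \<comment> \<open>A sample involves \<open>m\<close> readings, so \<open>N * m\<close> of them
    must succeed together: \<beta> makes the total reading error \<open>1 / 10\<close>, and \<tau>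
    the total influence of the missed blocks \<open>1 / 100\<close>. Then
    \<open>R * \<tau> = 20 * m\<close> bounds the probability of missing any influential block by
    \<open>1 / 20\<close>, and \<open>T * \<beta> = 2\<close> that of a bad reader passing by
    \<open>1 / 3\<close>.\<close>
  define R where "R = 2000 * N * m * m"
  define T where "T = 40 * N * m"
  define \<beta> where "\<beta> = 1 / (20 * real (N * m))"
  define \<tau> where "\<tau> = 1 / (100 * real (N * m))"
  define \<delta> where "\<delta> = (1 - 1 / 2 ^ r) ^ M * real ((1 + 2 * r * M) ^ r)"
  have E1: "E \<ge> 1" using E \<epsilon> by (cases E) (auto simp: field_simps)
  have m1: "m \<ge> 1" by (simp add: m_def num_blocks_def)
  have \<nu>4: "\<nu> \<ge> 4" by (simp add: \<nu>_def sample_rate_def)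
  have N4: "N \<ge> 4" using mult_le_mono[OF \<nu>4 E1] by (simp add: N_def)
  have Nm4: "N * m \<ge> 4" using mult_le_mono[OF N4 m1] by simp
  have Nm: "real (N * m) > 0" using Nm4 by linarith
  have Nm': "real (N * m) \<ge> 4" using Nm4 by linarith
  have nz: "real N > 0" "real m > 0" using N4 m1 by auto
  have \<delta>0: "\<delta> \<ge> 0" by (simp add: \<delta>_def)
  let ?S = "seed_pmf n m R T N"
  let ?acc = "accepts n m R T N (C m)"
  have q: "2 * m * R + 7 * m * T + N * (m + 1) \<le> 10000 * \<nu> * m ^ 3 * E"
  proof -
    have m2: "m \<le> m ^ 3" "m * m \<le> m ^ 3" "1 \<le> m ^ 3"
      using m1 power_increasing[of 1 3 m] power_increasing[of 2 3 m] by (auto simp: power2_eq_square)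
    have "2 * m * R + 7 * m * T + N * (m + 1) = N * (4000 * m ^ 3 + 280 * (m * m) + m + 1)"
      by (simp add: R_def T_def algebra_simps power3_eq_cube)
    also have "\<dots> \<le> N * (10000 * m ^ 3)" using m2 by (intro mult_le_mono2) linarith
    finally show ?thesis by (simp add: N_def algebra_simps)
  qed
  have "\<exists>t. queried t \<subseteq> cube n \<and> depth t \<le> 10000 * \<nu> * m ^ 3 * E \<and> (\<forall>f. run t f = ?acc \<omega> f)"
    if "\<omega> \<in> set_pmf ?S" for \<omega>
  proof -
    obtain h \<sigma> \<tau>' \<rho> where weq: "\<omega> = (h, \<sigma>, \<tau>', \<rho>)" by (metis surj_pair)
    have sets: "\<sigma> \<in> set_pmf (probe_pmf n m R)" "\<rho> \<in> set_pmf (sample_pmf n N)"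
      using that by (auto simp: weq seed_pmf_def)
    have "adaptive (cube n) (2 * m * R + 7 * m * T + N * (m + 1)) (?acc (h, \<sigma>, \<tau>', \<rho>))"
    proof (rule adaptive_accepts)
      show "fst (\<sigma> (j, s)) \<in> cube n" if "j < m" "s < R" for j s
      proof -
        have "\<sigma> (j, s) \<in> cube n \<times> cube n"
          using sets(1) that unfolding probe_pmf_def by (auto simp: set_Pi_pmf PiE_dflt_def)
        then show ?thesis by auto
      qed
      show "\<rho> t \<in> cube n" if "t < N" for t
        using sets(2) that unfolding sample_pmf_def by (auto simp: set_Pi_pmf PiE_dflt_def)
    qed
    then show ?thesis unfolding weq by (intro adaptive_imp_dtree adaptive_mono[OF _ q])
  qed
  then have "\<exists>tree. \<forall>\<omega>\<in>set_pmf ?S. queried (tree \<omega>) \<subseteq> cube n \<and> depth (tree \<omega>) \<le> 10000 * \<nu> * m ^ 3 * E \<and> (\<forall>f. run (tree \<omega>) f = ?acc \<omega> f)"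
    by (intro bchoice ballI)
  then obtain tree where tree: "\<And>\<omega>. \<omega> \<in> set_pmf ?S \<Longrightarrow> queried (tree \<omega>) \<subseteq> cube n"
    "\<And>\<omega>. \<omega> \<in> set_pmf ?S \<Longrightarrow> depth (tree \<omega>) \<le> 10000 * \<nu> * m ^ 3 * E"
    "\<And>\<omega> f. \<omega> \<in> set_pmf ?S \<Longrightarrow> run (tree \<omega>) f = ?acc \<omega> f" by blast
  define A where "A = map_pmf tree ?S"
  have acc: "accept_prob A f = measure_pmf.prob ?S {\<omega>. ?acc \<omega> f}" for f
    unfolding accept_prob_def A_def prob_map_pmf by (rule prob_cong) (simp add: tree(3))
  have rej: "reject_prob A f = measure_pmf.prob ?S {\<omega>. \<not> ?acc \<omega> f}" for f
    unfolding reject_prob_def A_def prob_map_pmf by (rule prob_cong) (simp add: tree(3))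
  have "accept_prob A f \<ge> 2 / 3" if f: "f \<in> C n" for f
  proof -
    have "f \<in> r_decision_list r n" using f sub by blast
    from decision_list_near_junta[OF this M] obtain J g where J: "J \<subseteq> {..<n}" "card J \<le> junta_size r M"
      and g: "junta_on n J g" and \<delta>: "measure_pmf.prob (unif n) {x. f x \<noteq> g x} \<le> \<delta>"
      unfolding junta_size_def \<delta>_def by blast
    have "measure_pmf.prob ?S {\<omega>. \<not> ?acc \<omega> f} \<le> 1 / 3"
    proof (rule completeness[OF f _ g J(1) _ \<delta>, where \<tau>=\<tau>])
      show "(\<lambda>b. f (subst_point n \<eta> b)) \<in> C m" if "\<forall>i<n. unary_on m (\<eta> i)" for \<eta>
        by (rule closed[OF f that])
      show "0 < m" using m1 by simp
      show \<tau>0: "0 \<le> \<tau>" by (simp add: \<tau>_def)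
      show \<tau>1: "\<tau> \<le> 1" using Nm' by (simp add: \<tau>_def field_simps)
      have "card J * card J \<le> (junta_size r M)\<^sup>2" unfolding power2_eq_square using J(2) by (intro mult_le_mono)
      then have "20 * (card J * card J) \<le> m" by (simp add: m_def num_blocks_def)
      then have "20 * real (card J * card J) \<le> real m" by linarith
      then have t1: "real (card J * card J) * (1 / real m) \<le> 1 / 20" using m1 by (simp add: field_simps)
      have "real R * \<tau> = 20 * real m" using nz by (simp add: R_def \<tau>_def field_simps)
      then have "(1 - \<tau>) ^ R \<le> 1 / (1 + 20 * real m)" using power_one_minus_le[OF \<tau>0 \<tau>1, of R] by simp
      then have "real m * (1 - \<tau>) ^ R \<le> real m * (1 / (1 + 20 * real m))" by (rule mult_left_mono) simp
      also have "\<dots> \<le> 1 / 20" using m1 by (simp add: field_simps)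
      finally have t2: "real m * (1 - \<tau>) ^ R \<le> 1 / 20" .
      have t3: "real N * (real m * \<tau>) = 1 / 100" using nz by (simp add: \<tau>_def field_simps)
      \<comment> \<open>The number of points at which the junta must be right. The products of
        \<open>R\<close> with \<open>T\<close> and with \<open>N\<close> make it quadratic in
        \<open>E\<close>, since every probe counts as a possible witness.\<close>
      have "2 * (m * R) + m * R * T * 7 + m * R * N + 2 * N \<le> 1000000 * \<nu>\<^sup>2 * m ^ 4 * E\<^sup>2"
      proof -
        have N2: "N \<le> N\<^sup>2" using N4 by (simp add: power2_eq_square)
        have m4: "m ^ 3 \<le> m ^ 4" "1 \<le> m ^ 4" using m1 power_increasing[of 3 4 m] by auto
        have a1: "m ^ 3 * N \<le> m ^ 4 * N\<^sup>2" by (intro mult_le_mono m4(1) N2)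
        have a2: "m ^ 3 * N\<^sup>2 \<le> m ^ 4 * N\<^sup>2" by (intro mult_le_mono1 m4(1))
        have a3: "N \<le> m ^ 4 * N\<^sup>2" using mult_le_mono[OF m4(2) N2] by simp
        have "2 * (m * R) + m * R * T * 7 + m * R * N + 2 * N =
          4000 * (m ^ 3 * N) + 560000 * (m ^ 4 * N\<^sup>2) + 2000 * (m ^ 3 * N\<^sup>2) + 2 * N"
          by (simp add: R_def T_def algebra_simps power2_eq_square power3_eq_cube power4_eq_xxxx)
        also have "\<dots> \<le> 1000000 * (m ^ 4 * N\<^sup>2)" using a1 a2 a3 by linarith
        finally show ?thesis by (simp add: N_def power_mult_distrib algebra_simps)
      qed
      then have "real (2 * (m * R) + m * R * T * 7 + m * R * N + 2 * N) \<le> real (1000000 * \<nu>\<^sup>2 * m ^ 4 * E\<^sup>2)"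
        by (simp only: of_nat_le_iff)
      then have "\<delta> * real (2 * (m * R) + m * R * T * 7 + m * R * N + 2 * N) \<le> \<delta> * real (1000000 * \<nu>\<^sup>2 * m ^ 4 * E\<^sup>2)"
        using \<delta>0 by (rule mult_left_mono)
      also have "\<dots> \<le> 1 / 20" using small by (simp add: \<delta>_def m_def \<nu>_def algebra_simps)
      finally have t4: "\<delta> * real (2 * (m * R) + m * R * T * 7 + m * R * N + 2 * N) \<le> 1 / 20" .
      have "real (card J * card J) * (1 / real m) + real (m * R) * (2 * \<delta>) + real (m * R * T * 7) * \<delta> + real (m * R * N) * \<delta>
        + real m * (1 - \<tau>) ^ R + real N * (real m * \<tau> + 2 * \<delta>) =
        real (card J * card J) * (1 / real m) + real m * (1 - \<tau>) ^ R + real N * (real m * \<tau>) +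
        \<delta> * real (2 * (m * R) + m * R * T * 7 + m * R * N + 2 * N)"
        by (simp add: algebra_simps)
      also have "\<dots> \<le> 1 / 3" using t1 t2 t3 t4 by linarith
      finally show "real (card J * card J) * (1 / real m) + real (m * R) * (2 * \<delta>) + real (m * R * T * 7) * \<delta> + real (m * R * N) * \<delta>
        + real m * (1 - \<tau>) ^ R + real N * (real m * \<tau> + 2 * \<delta>) \<le> 1 / 3" .
    qed
    then show ?thesis using prob_compl[of ?S "\<lambda>\<omega>. ?acc \<omega> f"] by (simp add: acc)
  qed
  moreover have "reject_prob A f \<ge> 2 / 3" if far: "far_from n \<epsilon> (C n) f" for f
  proof -
    have rsub: "restrictions m (C m) \<subseteq> restrictions m (r_decision_list r m)"
      unfolding restrictions_def using sub by (intro image_mono)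
    have fin: "finite (restrictions m (C m))"
      using rsub card_restrictions_decision_list(1) finite_subset by blast
    have "real (card (restrictions m (C m))) \<le> real (card (restrictions m (r_decision_list r m)))"
      using rsub card_restrictions_decision_list(1) by (simp add: card_mono)
    also have "\<dots> \<le> exp (real (entropy_bound r m))" by (rule card_restrictions_decision_list(2))
    finally have card: "real (card (restrictions m (C m))) \<le> exp (real (entropy_bound r m))" .
    have "1 \<le> real E * \<epsilon>" using E \<epsilon> by (simp add: field_simps)
    then have "real \<nu> * 1 \<le> real \<nu> * (real E * \<epsilon>)" by (rule mult_left_mono) simp
    then have "exp (- \<epsilon> * real N) \<le> exp (- real \<nu>)" by (simp add: N_def algebra_simps)
    then have "real (card (restrictions m (C m))) * exp (- \<epsilon> * real N) \<le> exp (real (entropy_bound r m)) * exp (- real \<nu>)"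
      using card by (intro mult_mono) auto
    also have "\<dots> = exp (- 4)" by (simp add: exp_add[symmetric] \<nu>_def sample_rate_def m_def)
    also have "\<dots> \<le> 1 / 5" using exp_ge_add_one_self[of 4] by (simp add: exp_minus field_simps)
    finally have "real (card (restrictions m (C m))) * exp (- \<epsilon> * real N) \<le> 1 / 5" .
    moreover have "real (N * m) * (2 * \<beta>) = 1 / 10" using nz by (simp add: \<beta>_def)
    ultimately have Nb: "real (N * m) * (2 * \<beta>) + real (card (restrictions m (C m))) * exp (- \<epsilon> * real N) \<le> 1 / 3" by linarith
    have \<beta>: "0 \<le> \<beta>" "\<beta> \<le> 1 / 56" using Nm' by (auto simp: \<beta>_def field_simps)
    have "real T * \<beta> = 2" using nz by (simp add: T_def \<beta>_def)
    then have Tb: "(1 - \<beta>) ^ T \<le> 1 / 3" using power_one_minus_le[of \<beta> T] \<beta> by simp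
    have "measure_pmf.prob ?S {\<omega>. ?acc \<omega> f} \<le> 1 / 3"
      by (rule soundness[OF far _ fin \<beta> Tb Nb]) (rule closed)
    then show ?thesis using prob_compl[of ?S "\<lambda>\<omega>. ?acc \<omega> f"] by (simp add: rej)
  qed
  moreover have "query_algorithm n (10000 * \<nu> * m ^ 3 * E) A"
    unfolding query_algorithm_def A_def using tree(1,2) by auto
  ultimately show ?thesis unfolding two_sided_tester_def m_def \<nu>_def by blast
qed

section \<open>Polynomial growth and the choice of \<open>M\<close>\<close>

definition poly_bounded :: "(nat \<Rightarrow> nat) \<Rightarrow> bool" where
  "poly_bounded F \<longleftrightarrow> (\<exists>c d. \<forall>M. real (F M) \<le> c * (real M + 1) ^ d)"

lemma poly_bounded_const: "poly_bounded (\<lambda>M. c)"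
  unfolding poly_bounded_def by (intro exI[of _ "real c"] exI[of _ 0]) simp

lemma poly_bounded_id: "poly_bounded (\<lambda>M. M)"
  unfolding poly_bounded_def by (intro exI[of _ 1] exI[of _ 1]) simp

lemma poly_bounded_add:
  assumes "poly_bounded F" "poly_bounded G"
  shows "poly_bounded (\<lambda>M. F M + G M)"
proof -
  obtain c d c' d' where F: "\<And>M. real (F M) \<le> c * (real M + 1) ^ d" and G: "\<And>M. real (G M) \<le> c' * (real M + 1) ^ d'"
    using assms unfolding poly_bounded_def by blast
  have c: "0 \<le> c" "0 \<le> c'" using F[of 0] G[of 0] by auto
  have "real (F M + G M) \<le> (c + c') * (real M + 1) ^ (d + d')" for M
  proof -
    have "c * (real M + 1) ^ d \<le> c * (real M + 1) ^ (d + d')" "c' * (real M + 1) ^ d' \<le> c' * (real M + 1) ^ (d + d')"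
      using c by (auto intro!: mult_left_mono power_increasing)
    then show ?thesis using F[of M] G[of M] by (simp add: algebra_simps)
  qed
  then show ?thesis unfolding poly_bounded_def by blast
qed

lemma poly_bounded_mult:
  assumes "poly_bounded F" "poly_bounded G"
  shows "poly_bounded (\<lambda>M. F M * G M)"
proof -
  obtain c d c' d' where F: "\<And>M. real (F M) \<le> c * (real M + 1) ^ d" and G: "\<And>M. real (G M) \<le> c' * (real M + 1) ^ d'"
    using assms unfolding poly_bounded_def by blast
  have "real (F M * G M) \<le> (c * c') * (real M + 1) ^ (d + d')" for M
  proof -
    have "real (F M) * real (G M) \<le> (c * (real M + 1) ^ d) * (c' * (real M + 1) ^ d')"
      using F[of M] G[of M] by (intro mult_mono) (auto intro: order_trans[OF of_nat_0_le_iff])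
    then show ?thesis by (simp add: power_add algebra_simps)
  qed
  then show ?thesis unfolding poly_bounded_def by blast
qed

lemma poly_bounded_power: "poly_bounded F \<Longrightarrow> poly_bounded (\<lambda>M. F M ^ k)"
  by (induction k) (auto intro: poly_bounded_const poly_bounded_mult)

lemmas poly_bounded_intros = poly_bounded_const poly_bounded_id poly_bounded_add poly_bounded_mult poly_bounded_power

lemma poly_bounded_num_blocks: "poly_bounded (num_blocks r)"
  unfolding num_blocks_def[abs_def] junta_size_def by (intro poly_bounded_intros)

lemma poly_bounded_sample_rate: "poly_bounded (sample_rate r)"
  unfolding sample_rate_def[abs_def] entropy_bound_def by (intro poly_bounded_intros poly_bounded_num_blocks)

text \<open>Each of the first \<open>M + 1\<close> terms of the geometric series is at least
  \<open>x ^ M\<close>.\<close>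

lemma linear_times_geometric_le:
  assumes "0 \<le> x" "x < (1 :: real)"
  shows "(real M + 1) * x ^ M \<le> 1 / (1 - x)"
proof -
  have "(real M + 1) * x ^ M = (\<Sum>i<Suc M. x ^ M)" by (simp add: algebra_simps)
  also have "\<dots> \<le> (\<Sum>i<Suc M. x ^ i)" using assms by (intro sum_mono power_decreasing) auto
  also have "\<dots> = (1 - x ^ Suc M) / (1 - x)" using assms by (simp only: sum_gp_strict) auto
  also have "\<dots> \<le> 1 / (1 - x)" using assms by (intro divide_right_mono) auto
  finally show ?thesis .
qed

text \<open>One linear factor is absorbed at a time, each time at the price of a slightly larger
  base.\<close>

lemma poly_times_geometric_le:
  assumes "0 \<le> \<gamma>" "\<gamma> < \<theta>"
  shows "\<exists>K. \<forall>M. (real M + 1) ^ d * \<gamma> ^ M \<le> K * \<theta> ^ M"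
  using assms
proof (induction d arbitrary: \<theta>)
  case 0
  then show ?case by (intro exI[of _ 1]) (auto intro: power_mono)
next
  case (Suc d)
  define \<mu> where "\<mu> = (\<gamma> + \<theta>) / 2"
  have \<mu>: "\<gamma> < \<mu>" "\<mu> < \<theta>" using Suc.prems by (auto simp: \<mu>_def)
  obtain K where K: "\<And>M. (real M + 1) ^ d * \<gamma> ^ M \<le> K * \<mu> ^ M" using Suc.IH[OF Suc.prems(1) \<mu>(1)] by blast
  have K0: "0 \<le> K" using K[of 0] by simp
  have "(real M + 1) ^ Suc d * \<gamma> ^ M \<le> (K * (1 / (1 - \<mu> / \<theta>))) * \<theta> ^ M" for M
  proof -
    have "(real M + 1) ^ Suc d * \<gamma> ^ M = (real M + 1) * ((real M + 1) ^ d * \<gamma> ^ M)" by simp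
    also have "\<dots> \<le> (real M + 1) * (K * \<mu> ^ M)" by (intro mult_left_mono K) simp
    also have "\<dots> = K * \<theta> ^ M * ((real M + 1) * (\<mu> / \<theta>) ^ M)"
      using \<mu> Suc.prems by (simp add: power_divide)
    also have "\<dots> \<le> K * \<theta> ^ M * (1 / (1 - \<mu> / \<theta>))"
      using \<mu> Suc.prems K0 by (intro mult_left_mono linear_times_geometric_le) auto
    finally show ?thesis by (simp add: mult.commute mult.left_commute)
  qed
  then show ?case by blast
qed

text \<open>The polynomial is absorbed by passing from \<gamma> to a base \<theta> still below 1. It
  then suffices that \<open>\<theta> ^ M\<close> is at most the inverse of \<open>L * E ^ 2\<close>,
  that is, \<open>M\<close> of order \<open>ln E\<close>.\<close>

lemma log_depth_choice:
  assumes F: "poly_bounded F" and \<gamma>: "0 \<le> \<gamma>" "\<gamma> < 1"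
  shows "\<exists>a\<ge>0. \<exists>b\<ge>0. \<forall>E\<ge>1. \<exists>M>0. real M \<le> a + b * ln (real E) \<and> \<gamma> ^ M * real (F M) * (real E)\<^sup>2 \<le> 1"
proof -
  define \<theta> where "\<theta> = (1 + \<gamma>) / 2"
  have \<theta>: "\<gamma> < \<theta>" "\<theta> < 1" "0 < \<theta>" using \<gamma> by (auto simp: \<theta>_def)
  obtain c d where F: "\<And>M. real (F M) \<le> c * (real M + 1) ^ d" using F unfolding poly_bounded_def by blast
  have c: "0 \<le> c" using F[of 0] by auto
  obtain K where K: "\<And>M. (real M + 1) ^ d * \<gamma> ^ M \<le> K * \<theta> ^ M" using poly_times_geometric_le[OF \<gamma>(1) \<theta>(1)] by blast
  define L where "L = c * K + 1"
  have L: "L \<ge> 1" using K[of 0] c by (simp add: L_def)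
  have bound: "\<gamma> ^ M * real (F M) \<le> L * \<theta> ^ M" for M
  proof -
    have "\<gamma> ^ M * real (F M) \<le> \<gamma> ^ M * (c * (real M + 1) ^ d)" using F \<gamma> by (intro mult_left_mono) auto
    also have "\<dots> = c * ((real M + 1) ^ d * \<gamma> ^ M)" by simp
    also have "\<dots> \<le> c * (K * \<theta> ^ M)" using K c by (intro mult_left_mono) auto
    also have "\<dots> \<le> L * \<theta> ^ M" using \<theta> by (simp add: L_def algebra_simps)
    finally show ?thesis .
  qed
  define l where "l = - ln \<theta>"
  have l: "l > 0" using \<theta> by (simp add: l_def)
  show ?thesis
  proof (rule exI[of _ "ln L / l + 2"], rule conjI, goal_cases)
    case 1
    then show ?case using l L by simp
  next
    case 2
    show ?case
    proof (rule exI[of _ "2 / l"], intro conjI allI impI)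
      show "0 \<le> 2 / l" using l by simp
      fix E :: nat assume E: "E \<ge> 1"
      define y where "y = (ln L + 2 * ln (real E)) / l"
      have y: "0 \<le> y" using l L E by (auto simp: y_def)
      \<comment> \<open>The ceiling reaches \<open>y\<close> and the added 1 makes \<open>M\<close>
        positive; together they cost at most the 2 in the additive constant.\<close>
      define M where "M = nat \<lceil>y\<rceil> + 1"
      have M: "y \<le> real M" "real M \<le> y + 2" using y unfolding M_def by linarith+
      have "ln L + 2 * ln (real E) \<le> real M * l" using M(1) l by (simp add: y_def field_simps)
      then have "exp (ln L + 2 * ln (real E)) \<le> exp (real M * l)" by simp
      moreover have "exp (ln L + 2 * ln (real E)) = L * (real E)\<^sup>2"
        using L E by (simp add: exp_add exp_of_nat_mult[of 2 "ln (real E)", simplified])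
      moreover have "exp (real M * l) = 1 / \<theta> ^ M"
        using \<theta> by (simp add: exp_of_nat_mult l_def exp_minus power_inverse inverse_eq_divide power_divide)
      ultimately have "L * (real E)\<^sup>2 \<le> 1 / \<theta> ^ M" by simp
      then have LE: "L * \<theta> ^ M * (real E)\<^sup>2 \<le> 1" using \<theta> by (simp add: field_simps)
      have "\<gamma> ^ M * real (F M) * (real E)\<^sup>2 \<le> L * \<theta> ^ M * (real E)\<^sup>2" by (intro mult_right_mono bound) simp
      then have "\<gamma> ^ M * real (F M) * (real E)\<^sup>2 \<le> 1" using LE by linarith
      moreover have "real M \<le> ln L / l + 2 + 2 / l * ln (real E)" using M(2) by (simp add: y_def add_divide_distrib)
      moreover have "M > 0" by (simp add: M_def)
      ultimately show "\<exists>M>0. real M \<le> ln L / l + 2 + 2 / l * ln (real E) \<and> \<gamma> ^ M * real (F M) * (real E)\<^sup>2 \<le> 1" by blast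
    qed
  qed
qed

text \<open>Closure is used in both directions: from \<open>m\<close> to \<open>n\<close> variables
  for soundness, and from \<open>n\<close> to \<open>m\<close> variables for completeness.\<close>

lemma class_testable:
  fixes C :: "nat \<Rightarrow> (bool list \<Rightarrow> bool) set"
  assumes closed: "\<And>m n G \<psi>. G \<in> C m \<Longrightarrow> \<forall>j<m. unary_on n (\<psi> j) \<Longrightarrow> (\<lambda>x. G (subst_point m \<psi> x)) \<in> C n"
    and sub: "\<And>n. C n \<subseteq> r_decision_list r n"
  shows "\<exists>q. (\<lambda>\<epsilon>. real (q \<epsilon>)) \<in> soft_O (at_right 0) (\<lambda>\<epsilon>. 1 / \<epsilon>) \<and> testable_with_queries C q"
proof -
  define F where "F = (\<lambda>M. (1 + 2 * r * M) ^ r * (20000000 * (sample_rate r M)\<^sup>2 * (num_blocks r M) ^ 4))"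
  define G where "G = (\<lambda>M. 10000 * sample_rate r M * num_blocks r M ^ 3)"
  have F: "poly_bounded F" unfolding F_def
    by (intro poly_bounded_intros poly_bounded_num_blocks poly_bounded_sample_rate)
  have G: "poly_bounded G" unfolding G_def
    by (intro poly_bounded_intros poly_bounded_num_blocks poly_bounded_sample_rate)
  obtain a b where ab: "a \<ge> 0" "b \<ge> 0"
    and choice: "\<And>E. E \<ge> 1 \<Longrightarrow> \<exists>M>0. real M \<le> a + b * ln (real E) \<and> (1 - 1 / 2 ^ r) ^ M * real (F M) * (real E)\<^sup>2 \<le> 1"
    using log_depth_choice[OF F, of "1 - 1 / 2 ^ r"] by auto
  define depth_of where "depth_of = (\<lambda>E. SOME M. M > 0 \<and> real M \<le> a + b * ln (real E) \<and> (1 - 1 / 2 ^ r) ^ M * real (F M) * (real E)\<^sup>2 \<le> 1)"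
  have M: "depth_of E > 0" "real (depth_of E) \<le> a + b * ln (real E)"
     "(1 - 1 / 2 ^ r) ^ depth_of E * real (F (depth_of E)) * (real E)\<^sup>2 \<le> 1" if "E \<ge> 1" for E
    using someI_ex[OF choice[OF that]] unfolding depth_of_def by auto
  define E where "E = (\<lambda>\<epsilon> :: real. nat \<lceil>1 / \<epsilon>\<rceil>)"
  define q where "q = (\<lambda>\<epsilon>. G (depth_of (E \<epsilon>)) * E \<epsilon>)"
  have E: "1 \<le> E \<epsilon>" "1 / \<epsilon> \<le> real (E \<epsilon>)" if "\<epsilon> > 0" for \<epsilon> :: real
  proof -
    show "1 / \<epsilon> \<le> real (E \<epsilon>)" unfolding E_def by (rule real_nat_ceiling_ge)
    moreover have "1 / \<epsilon> > 0" using that by simp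
    ultimately show "1 \<le> E \<epsilon>" by (cases "E \<epsilon>") auto
  qed
  have ex: "\<exists>A. query_algorithm n (q \<epsilon>) A \<and> two_sided_tester n \<epsilon> (C n) A" if "\<epsilon> > 0" for \<epsilon> n
  proof -
    have "(1 - 1 / 2 ^ r) ^ depth_of (E \<epsilon>) * real ((1 + 2 * r * depth_of (E \<epsilon>)) ^ r) *
       real (20000000 * (sample_rate r (depth_of (E \<epsilon>)))\<^sup>2 * (num_blocks r (depth_of (E \<epsilon>))) ^ 4 * (E \<epsilon>)\<^sup>2) \<le> 1"
      using M(3)[OF E(1)[OF that]] by (simp add: F_def mult.assoc)
    from tester_exists[OF closed sub M(1)[OF E(1)[OF that]] that E(2)[OF that] this, of n]
    show ?thesis unfolding q_def G_def .
  qed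
  have "testable_with_queries C q"
    unfolding testable_with_queries_def
  proof (intro exI[of _ "\<lambda>\<epsilon> n. SOME A. query_algorithm n (q \<epsilon>) A \<and> two_sided_tester n \<epsilon> (C n) A"] allI impI)
    fix \<epsilon> :: real and n assume "\<epsilon> > 0"
    from someI_ex[OF ex[OF this, of n]]
    show "query_algorithm n (q \<epsilon>) (SOME A. query_algorithm n (q \<epsilon>) A \<and> two_sided_tester n \<epsilon> (C n) A) \<and>
      two_sided_tester n \<epsilon> (C n) (SOME A. query_algorithm n (q \<epsilon>) A \<and> two_sided_tester n \<epsilon> (C n) A)" .
  qed
  moreover have "(\<lambda>\<epsilon>. real (q \<epsilon>)) \<in> soft_O (at_right 0) (\<lambda>\<epsilon>. 1 / \<epsilon>)"
  proof -
    obtain c d where cd: "\<And>M. real (G M) \<le> c * (real M + 1) ^ d" using G unfolding poly_bounded_def by blast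
    have c: "0 \<le> c" using cd[of 0] by auto
    \<comment> \<open>For \<epsilon> below 1, \<open>E \<epsilon>\<close> is at most
      \<open>2 / \<epsilon>\<close>, so the chosen \<open>M\<close> plus 1 is at most this linear
      polynomial at \<open>ln (1 / \<epsilon>)\<close>; the power \<open>d\<close> comes from the
      growth of \<open>G\<close>.\<close>
    define p where "p = [:a + b * ln 2 + 1, b:] ^ d"
    have bound: "real (q \<epsilon>) \<le> 2 * c * (1 / \<epsilon> * poly p (ln (1 / \<epsilon>)))" if "0 < \<epsilon>" "\<epsilon> < 1" for \<epsilon>
    proof -
      have inv: "1 < 1 / \<epsilon>" using that by simp
      have "real (E \<epsilon>) \<le> 1 / \<epsilon> + 1" using inv unfolding E_def by linarith
      then have E2: "real (E \<epsilon>) \<le> 2 * (1 / \<epsilon>)" using inv by linarith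
      have "ln (real (E \<epsilon>)) \<le> ln (2 * (1 / \<epsilon>))" using E2 E(1)[OF that(1)] that by (subst ln_le_cancel_iff) auto
      also have "\<dots> = ln 2 + ln (1 / \<epsilon>)" using inv by (subst ln_mult) auto
      finally have "b * ln (real (E \<epsilon>)) \<le> b * (ln 2 + ln (1 / \<epsilon>))" using ab by (intro mult_left_mono)
      then have "real (depth_of (E \<epsilon>)) + 1 \<le> a + b * ln 2 + 1 + ln (1 / \<epsilon>) * b"
        using M(2)[OF E(1)[OF that(1)]] by (simp add: algebra_simps)
      then have "(real (depth_of (E \<epsilon>)) + 1) ^ d \<le> poly p (ln (1 / \<epsilon>))"
        unfolding p_def poly_power by (intro power_mono) simp_all
      then have "real (G (depth_of (E \<epsilon>))) \<le> c * poly p (ln (1 / \<epsilon>))"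
        using cd[of "depth_of (E \<epsilon>)"] c by (meson mult_left_mono order_trans)
      then have "real (q \<epsilon>) \<le> (c * poly p (ln (1 / \<epsilon>))) * (2 * (1 / \<epsilon>))"
        unfolding q_def of_nat_mult using E2 by (intro mult_mono) (auto intro: order_trans[OF of_nat_0_le_iff])
      then show ?thesis by (simp add: mult.commute mult.left_commute)
    qed
    have "eventually (\<lambda>\<epsilon>. \<epsilon> \<in> {0<..<1}) (at_right (0 :: real))" by (rule eventually_at_right_real) simp
    then have "(\<lambda>\<epsilon>. real (q \<epsilon>)) \<in> O[at_right 0](\<lambda>\<epsilon>. 1 / \<epsilon> * poly p (ln (1 / \<epsilon>)))"
    proof (intro bigoI[of _ "2 * c"], elim eventually_mono)
      fix \<epsilon> :: real assume "\<epsilon> \<in> {0<..<1}"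
      then have "real (q \<epsilon>) \<le> 2 * c * (1 / \<epsilon> * poly p (ln (1 / \<epsilon>)))" using bound by simp
      also have "\<dots> \<le> 2 * c * norm (1 / \<epsilon> * poly p (ln (1 / \<epsilon>)))"
        unfolding real_norm_def using c by (intro mult_left_mono abs_ge_self) simp
      finally show "norm (real (q \<epsilon>)) \<le> 2 * c * norm (1 / \<epsilon> * poly p (ln (1 / \<epsilon>)))" by simp
    qed
    then show ?thesis unfolding soft_O_def by blast
  qed
  ultimately show ?thesis by blast
qed

theorem theorem22:
  fixes r :: nat
  shows "(\<exists>q. (\<lambda>\<epsilon>. real (q \<epsilon>)) \<in> soft_O (at_right 0) (\<lambda>\<epsilon>. 1 / \<epsilon>) \<and>
              testable_with_queries (r_decision_list r) q) \<and>
         (\<exists>q. (\<lambda>\<epsilon>. real (q \<epsilon>)) \<in> soft_O (at_right 0) (\<lambda>\<epsilon>. 1 / \<epsilon>) \<and>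
              testable_with_queries (r_DNF r) q)"
proof (intro conjI)
  show "\<exists>q. (\<lambda>\<epsilon>. real (q \<epsilon>)) \<in> soft_O (at_right 0) (\<lambda>\<epsilon>. 1 / \<epsilon>) \<and> testable_with_queries (r_decision_list r) q"
    by (rule class_testable[where r=r]) (auto intro: decision_list_subst)
  show "\<exists>q. (\<lambda>\<epsilon>. real (q \<epsilon>)) \<in> soft_O (at_right 0) (\<lambda>\<epsilon>. 1 / \<epsilon>) \<and> testable_with_queries (r_DNF r) q"
    by (rule class_testable[where r=r]) (rule DNF_subst DNF_subset_decision_list; assumption?)+
qed

end
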